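(* Given a set of points $Y\subseteq\mathbb{R}^d$ with $|Y|=n$, and $0\le\delta\le1$, $0\le\gamma\le1$, such that there exists a subset $Y^\star\subseteq Y$ with $|Y^\star|\ge\delta|Y|$ that is contained in an unknown ball $B^\star=B(c^\star,R^\star)$, one can find, in time polynomial in $n$ and $d$, a ball $\widehat{B}=B(\widehat{c},\widehat{R})$ such that $|Y\cap\widehat{B}|\ge(1-\gamma)|Y^\star|$ and $$\mathrm{vol}(\widehat{B})^{1/d}\le\mathrm{vol}(B^\star)^{1/d}\left(1+O\left(\frac{\log\log d}{\gamma\delta\log d}\right)\right).$$
   Context: $B(c,R)=\{y\in\mathbb{R}^d:\|y-c\|_2\le R\}$; $\mathrm{vol}$ is Lebesgue measure.
   Formalization: The algorithm is also given the size |Y*| (from Y, δ, γ alone no single ball can serve all admissible Y*: take half of Y tightly clustered, δ=1/2); the volume bound is claimed for d≥3 and γδ>0, where the O-term is defined and positive; time is counted on a real RAM. *)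

theory Defs
  imports "HOL-Analysis.Analysis"
begin

section \<open>Euclidean space of variable dimension\<close>

text \<open>
  One algorithm has to serve all dimensions, so the dimension cannot be a type: a point of
  \<open>d\<close>-dimensional space is a function on \<open>{..<d}\<close> (\<open>undefined\<close> elsewhere), which is the
  representation used by \<^const>\<open>PiM\<close>.
\<close>

definition Rd :: "nat \<Rightarrow> (nat \<Rightarrow> real) set" where
  "Rd d = {..<d} \<rightarrow>\<^sub>E UNIV"

definition eucl_ball :: "nat \<Rightarrow> (nat \<Rightarrow> real) \<Rightarrow> real \<Rightarrow> (nat \<Rightarrow> real) set" where
  "eucl_ball d c R = {y \<in> Rd d. L2_set (\<lambda>i. y i - c i) {..<d} \<le> R}"

definition vol :: "nat \<Rightarrow> (nat \<Rightarrow> real) set \<Rightarrow> real" where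
  "vol d A = measure (Pi\<^sub>M {..<d} (\<lambda>_. lborel)) A"

lemma space_PiM_lborel_eq_Rd: "space (Pi\<^sub>M {..<d} (\<lambda>_. lborel :: real measure)) = Rd d"
  by (simp add: space_PiM Rd_def)


section \<open>Real-number programs\<close>

text \<open>
  Inputs are arbitrary real vectors and the running time depends on \<open>n\<close> and \<open>d\<close> only, so
  computations take place on a real RAM: unboundedly many real cells with unit-cost exact
  arithmetic, square roots and comparisons, and indirect addressing of these cells by natural
  number registers. Three restrictions keep unit cost honest: real constants are integers
  (an arbitrary real constant could encode an oracle), there is no rounding of reals to
  integers, and the registers are not multiplied.
\<close>

datatype nexp =
    NConst nat
  | NReg nat
  | NAdd nexp nexp
  | NSub nexp nexp

datatype rexp =
    RConst int
  | RCell nexp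
  | RAdd rexp rexp
  | RSub rexp rexp
  | RMul rexp rexp
  | RDiv rexp rexp
  | RSqrt rexp

datatype bexp =
    NLess nexp nexp
  | RLess rexp rexp
  | BNot bexp
  | BAnd bexp bexp

datatype com =
    Skip
  | NAssign nat nexp
  | RAssign nexp rexp
  | Seq com com
  | Cond bexp com com
  | While bexp com

record state =
  reg :: "nat \<Rightarrow> nat"
  cell :: "nat \<Rightarrow> real"

fun nval :: "nexp \<Rightarrow> state \<Rightarrow> nat" where
  "nval (NConst k) s = k"
| "nval (NReg r) s = reg s r"
| "nval (NAdd a b) s = nval a s + nval b s"
| "nval (NSub a b) s = nval a s - nval b s"

fun rval :: "rexp \<Rightarrow> state \<Rightarrow> real" where
  "rval (RConst k) s = of_int k"
| "rval (RCell a) s = cell s (nval a s)"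
| "rval (RAdd a b) s = rval a s + rval b s"
| "rval (RSub a b) s = rval a s - rval b s"
| "rval (RMul a b) s = rval a s * rval b s"
| "rval (RDiv a b) s = rval a s / rval b s"
| "rval (RSqrt a) s = sqrt (rval a s)"

fun bval :: "bexp \<Rightarrow> state \<Rightarrow> bool" where
  "bval (NLess a b) s \<longleftrightarrow> nval a s < nval b s"
| "bval (RLess a b) s \<longleftrightarrow> rval a s < rval b s"
| "bval (BNot b) s \<longleftrightarrow> \<not> bval b s"
| "bval (BAnd a b) s \<longleftrightarrow> bval a s \<and> bval b s"

text \<open>
  \<open>exec p s t s'\<close>: started in state \<open>s\<close>, program \<open>p\<close> terminates in state \<open>s'\<close> after \<open>t\<close> steps.
  Assignments and tests count as one step each; as the expressions in a fixed program have
  bounded size, this is the number of elementary operations up to a constant factor.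
\<close>

inductive exec :: "com \<Rightarrow> state \<Rightarrow> nat \<Rightarrow> state \<Rightarrow> bool" where
  Skip: "exec Skip s 1 s"
| NAssign: "exec (NAssign r a) s 1 (s\<lparr>reg := (reg s)(r := nval a s)\<rparr>)"
| RAssign: "exec (RAssign a e) s 1 (s\<lparr>cell := (cell s)(nval a s := rval e s)\<rparr>)"
| Seq: "exec p s t s' \<Longrightarrow> exec q s' t' s'' \<Longrightarrow> exec (Seq p q) s (t + t') s''"
| CondTrue: "bval b s \<Longrightarrow> exec p s t s' \<Longrightarrow> exec (Cond b p q) s (Suc t) s'"
| CondFalse: "\<not> bval b s \<Longrightarrow> exec q s t s' \<Longrightarrow> exec (Cond b p q) s (Suc t) s'"
| WhileFalse: "\<not> bval b s \<Longrightarrow> exec (While b p) s 1 s"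
| WhileTrue: "bval b s \<Longrightarrow> exec p s t s' \<Longrightarrow> exec (While b p) s' t' s'' \<Longrightarrow>
    exec (While b p) s (Suc (t + t')) s''"

inductive_cases exec_SkipE: "exec Skip s t s'"
inductive_cases exec_NAssignE: "exec (NAssign r a) s t s'"
inductive_cases exec_RAssignE: "exec (RAssign a e) s t s'"
inductive_cases exec_SeqE: "exec (Seq p q) s t s'"
inductive_cases exec_CondE: "exec (Cond b p q) s t s'"
inductive_cases exec_WhileE: "exec (While b p) s t s'"

lemma exec_deterministic:
  "exec p s t s' \<Longrightarrow> exec p s u s'' \<Longrightarrow> t = u \<and> s' = s''"
proof (induction arbitrary: u s'' rule: exec.induct)
  case (Skip s)
  then show ?case by (auto elim: exec_SkipE)
next
  case (NAssign r a s)
  then show ?case by (auto elim: exec_NAssignE)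
next
  case (RAssign a e s)
  then show ?case by (auto elim: exec_RAssignE)
next
  case (Seq p s t s' q t' s2)
  from Seq.prems show ?case
    by (rule exec_SeqE) (use Seq.IH in blast)
next
  case (CondTrue b s p t s' q)
  from CondTrue.prems CondTrue.hyps show ?case
    by (auto elim!: exec_CondE dest: CondTrue.IH)
next
  case (CondFalse b s q t s' p)
  from CondFalse.prems CondFalse.hyps show ?case
    by (auto elim!: exec_CondE dest: CondFalse.IH)
next
  case (WhileFalse b s p)
  from WhileFalse.prems WhileFalse.hyps show ?case
    by (auto elim: exec_WhileE)
next
  case (WhileTrue b s p t s' t' s2)
  from WhileTrue.prems show ?case
    by (rule exec_WhileE) (use WhileTrue.hyps WhileTrue.IH in blast)+
qed


section \<open>Input and output of the ball-finding problem\<close>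

text \<open>
  Initially registers \<open>0, 1, 2\<close> hold the number of points, the dimension and a target size \<open>m\<close>,
  cells \<open>0, 1\<close> hold \<open>\<delta>\<close> and \<open>\<gamma>\<close>, and coordinate \<open>j\<close> of point \<open>i\<close> is in cell \<open>2 + i * d + j\<close>;
  everything else is \<open>0\<close>. Finally cell \<open>0\<close> holds the radius and cell \<open>1 + j\<close> coordinate \<open>j\<close> of
  the centre.

  The target size is the cardinality of the unknown subset. Some such input is unavoidable: if
  half of \<open>Y\<close> is concentrated and the other half is spread out, then for \<open>\<delta> = 1/2\<close> both the
  concentrated half and \<open>Y\<close> itself are admissible subsets, and no single ball is good for both.
\<close>

definition input :: "nat \<Rightarrow> (nat \<Rightarrow> real) list \<Rightarrow> real \<Rightarrow> real \<Rightarrow> nat \<Rightarrow> state" where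
  "input d ys \<delta> \<gamma> m =
    \<lparr>reg = (\<lambda>_. 0)(0 := length ys, 1 := d, 2 := m),
     cell = (\<lambda>a. if a = 0 then \<delta>
                 else if a = 1 then \<gamma>
                 else if a < 2 + length ys * d then (ys ! ((a - 2) div d)) ((a - 2) mod d)
                 else 0)\<rparr>"

definition out_radius :: "state \<Rightarrow> real" where
  "out_radius s = cell s 0"

definition out_centre :: "nat \<Rightarrow> state \<Rightarrow> nat \<Rightarrow> real" where
  "out_centre d s = (\<lambda>j\<in>{..<d}. cell s (1 + j))"

end

theory Submission
  imports Defs
begin

text \<open>
  Fix \<open>y0\<close> in the unknown subset, let \<open>r\<close> be the distance from \<open>y0\<close> to the farthest point of the
  subset, so that \<open>r \<le> 2 * R\<close>, and let \<open>z\<close> range over \<open>y - y0\<close> for the input points \<open>y\<close> within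
  distance \<open>r\<close> of \<open>y0\<close>. Let \<open>V\<close> be spanned by \<open>k\<close> orthonormal approximate top eigenvectors of the sum
  of all \<open>z z\<^sup>T\<close>; for \<open>w\<close> orthogonal to \<open>V\<close> the sum of \<open>\<langle>z, w\<rangle>\<^sup>2\<close> is at most
  \<open>2 * n * r\<^sup>2 / k * \<parallel>w\<parallel>\<^sup>2\<close>. Take for \<open>w\<close> the component orthogonal to \<open>V\<close> of \<open>c - y0\<close>, where \<open>c\<close> is the
  unknown centre. By Markov's inequality, up to \<open>\<gamma> * \<delta> * n\<close> exceptions, replacing \<open>c\<close> by \<open>c - w\<close>
  increases squared distances by at most \<open>2 * r\<^sup>2 / (k * \<gamma> * \<delta>)\<close>. As \<open>c - w\<close> lies in \<open>y0 + V\<close>, a grid of mesh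
  \<open>r / k\<^sup>2\<close> with \<open>(2 * k\<^sup>2 + 1) ^ k\<close> points contains a good centre, and there are at most \<open>d\<close> grid
  points if \<open>k\<close> is of order \<open>ln d / ln (ln d)\<close>. Since \<open>r\<close> is the distance of two input points, all
  choices can be enumerated; the smallest radius that covers \<open>(1 - \<gamma>) * m\<close> points wins.
\<close>

section \<open>A structured language compiled to real-number programs\<close>

text \<open>Exact eigenvectors are out of reach with field operations and square roots; this is the
  origin of the factor 2 in the bound on the sum of squares. Each direction is the best of
  \<open>d\<close> power iterates, and its Rayleigh quotient \<open>\<beta>\<close> is at least half
  of the maximum. Projecting it out lowers the trace of the matrix by exactly
  \<open>\<beta>\<close>, while the quadratic form is at most \<open>2 * \<beta>\<close> there.
  Adding this over \<open>k\<close> directions bounds \<open>k\<close> times the form on the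
  complement of \<open>V\<close> by twice the trace, and the trace is at most
  \<open>n * r\<^sup>2\<close>. The grid covers coordinates up to \<open>r\<close> in absolute
  value, which is enough if \<open>R < r\<close>, since the unknown centre is within
  \<open>R\<close> of \<open>y0\<close>. In the other case \<open>r \<le> R\<close>, and
  \<open>y0\<close> itself is a good centre. On the machine the obstacle is addressing, because
  registers cannot be multiplied. A language with blocks of cells and bounded loops hides this, and
  in it the exponent of the running time can be read off the program text.\<close>

primrec nv :: "nexp \<Rightarrow> (nat \<Rightarrow> nat) \<Rightarrow> nat" where
  "nv (NConst k) \<rho> = k"
| "nv (NReg r) \<rho> = \<rho> r"
| "nv (NAdd a b) \<rho> = nv a \<rho> + nv b \<rho>"
| "nv (NSub a b) \<rho> = nv a \<rho> - nv b \<rho>"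

lemma nval_eq_nv: "nval e s = nv e (reg s)"
  by (induction e) auto

primrec nregs :: "nexp \<Rightarrow> nat set" where
  "nregs (NConst k) = {}"
| "nregs (NReg r) = {r}"
| "nregs (NAdd a b) = nregs a \<union> nregs b"
| "nregs (NSub a b) = nregs a \<union> nregs b"

lemma nv_cong: "(\<And>r. r \<in> nregs e \<Longrightarrow> \<rho> r = \<rho>' r) \<Longrightarrow> nv e \<rho> = nv e \<rho>'"
  by (induction e) auto

datatype binop = Plus | Minus | Times | Divide

datatype hexp =
    HC int
  | HL nat nexp nexp
  | HBin binop hexp hexp
  | HSqrt hexp

datatype hbool =
    HNLess nexp nexp
  | HRLess hexp hexp

datatype hcom =
    HSkip
  | HN nat nexp
  | HR nat nexp nexp hexp
  | HSeq hcom hcom (infixr ";;" 60)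
  | HIf hbool hcom hcom
  | HFor nat nat hcom

text \<open>
  Programs of the structured language work on registers below \<open>100\<close> and on real cells indexed by a
  constant block number, a row and a column; the compiled code uses register \<open>100\<close> as a loop
  counter and the registers above it for addresses. Block \<open>0\<close> is the input array.
\<close>

type_synonym store = "nat \<times> nat \<times> nat \<Rightarrow> real"

primrec opv :: "binop \<Rightarrow> real \<Rightarrow> real \<Rightarrow> real" where
  "opv Plus a b = a + b"
| "opv Minus a b = a - b"
| "opv Times a b = a * b"
| "opv Divide a b = a / b"

primrec opx :: "binop \<Rightarrow> rexp \<Rightarrow> rexp \<Rightarrow> rexp" where
  "opx Plus a b = RAdd a b"
| "opx Minus a b = RSub a b"
| "opx Times a b = RMul a b"
| "opx Divide a b = RDiv a b"

lemma rval_opx [simp]: "rval (opx bo a b) s = opv bo (rval a s) (rval b s)"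
  by (cases bo) auto

primrec rv :: "hexp \<Rightarrow> (nat \<Rightarrow> nat) \<Rightarrow> store \<Rightarrow> real" where
  "rv (HC k) \<rho> f = of_int k"
| "rv (HL b i j) \<rho> f = f (b, nv i \<rho>, nv j \<rho>)"
| "rv (HBin bo a b) \<rho> f = opv bo (rv a \<rho> f) (rv b \<rho> f)"
| "rv (HSqrt a) \<rho> f = sqrt (rv a \<rho> f)"

text \<open>One shape fits all blocks: the \<open>n + d\<close> rows hold either the
  \<open>n\<close> points or up to \<open>d\<close> directions.\<close>

definition valid :: "nexp \<Rightarrow> nexp \<Rightarrow> (nat \<Rightarrow> nat) \<Rightarrow> bool" where
  "valid i j \<rho> \<longleftrightarrow> nv i \<rho> < \<rho> 0 + \<rho> 1 \<and> nv j \<rho> < \<rho> 1"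

primrec vd :: "hexp \<Rightarrow> (nat \<Rightarrow> nat) \<Rightarrow> bool" where
  "vd (HC k) \<rho> = True"
| "vd (HL b i j) \<rho> = valid i j \<rho>"
| "vd (HBin bo a b) \<rho> = (vd a \<rho> \<and> vd b \<rho>)"
| "vd (HSqrt a) \<rho> = vd a \<rho>"

primrec hregs :: "hexp \<Rightarrow> nat set" where
  "hregs (HC k) = {}"
| "hregs (HL b i j) = nregs i \<union> nregs j"
| "hregs (HBin bo a b) = hregs a \<union> hregs b"
| "hregs (HSqrt a) = hregs a"

primrec hblks :: "hexp \<Rightarrow> nat set" where
  "hblks (HC k) = {}"
| "hblks (HL b i j) = {b}"
| "hblks (HBin bo a b) = hblks a \<union> hblks b"
| "hblks (HSqrt a) = hblks a"

primrec bv :: "hbool \<Rightarrow> (nat \<Rightarrow> nat) \<Rightarrow> store \<Rightarrow> bool" where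
  "bv (HNLess a b) \<rho> f \<longleftrightarrow> nv a \<rho> < nv b \<rho>"
| "bv (HRLess a b) \<rho> f \<longleftrightarrow> rv a \<rho> f < rv b \<rho> f"

primrec vdb :: "hbool \<Rightarrow> (nat \<Rightarrow> nat) \<Rightarrow> bool" where
  "vdb (HNLess a b) \<rho> = True"
| "vdb (HRLess a b) \<rho> = (vd a \<rho> \<and> vd b \<rho>)"

primrec bregs :: "hbool \<Rightarrow> nat set" where
  "bregs (HNLess a b) = nregs a \<union> nregs b"
| "bregs (HRLess a b) = hregs a \<union> hregs b"

section \<open>Weakest preconditions and bounded loops\<close>

definition inc :: "nat \<Rightarrow> (nat \<Rightarrow> nat) \<Rightarrow> nat \<Rightarrow> nat" where
  "inc r \<rho> = \<rho>(r := Suc (\<rho> r))"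

lemma inc_apply: "inc r \<rho> x = (if x = r then Suc (\<rho> r) else \<rho> x)"
  by (simp add: inc_def)

text \<open>The number of passes is read once on entry, so a loop is a finite iterate of a predicate
  transformer and termination is built in. The conditions in \<open>wf_com\<close>, by which the
  body changes neither counter nor bound, make the compiled while loop agree with this.\<close>

primrec wp :: "hcom \<Rightarrow> ((nat \<Rightarrow> nat) \<Rightarrow> store \<Rightarrow> bool) \<Rightarrow> (nat \<Rightarrow> nat) \<Rightarrow> store \<Rightarrow> bool" where
  "wp HSkip = (\<lambda>Q. Q)"
| "wp (HN r e) = (\<lambda>Q \<rho> f. Q (\<rho>(r := nv e \<rho>)) f)"
| "wp (HR b i j e) = (\<lambda>Q \<rho> f. valid i j \<rho> \<and> vd e \<rho> \<and> Q \<rho> (f((b, nv i \<rho>, nv j \<rho>) := rv e \<rho> f)))"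
| "wp (p ;; q) = (\<lambda>Q. wp p (wp q Q))"
| "wp (HIf c p q) = (\<lambda>Q \<rho> f. vdb c \<rho> \<and> (if bv c \<rho> f then wp p Q \<rho> f else wp q Q \<rho> f))"
| "wp (HFor r b c) = (\<lambda>Q \<rho> f.
    ((\<lambda>P. wp c (\<lambda>\<rho> f. P (inc r \<rho>) f)) ^^ \<rho> b) Q (\<rho>(r := 0)) f)"

primrec asg :: "hcom \<Rightarrow> nat set" where
  "asg HSkip = {}"
| "asg (HN r e) = {r}"
| "asg (HR b i j e) = {}"
| "asg (p ;; q) = asg p \<union> asg q"
| "asg (HIf c p q) = asg p \<union> asg q"
| "asg (HFor r b c) = insert r (asg c)"

primrec blk :: "hcom \<Rightarrow> nat set" where
  "blk HSkip = {}"
| "blk (HN r e) = {}"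
| "blk (HR b i j e) = {b}"
| "blk (p ;; q) = blk p \<union> blk q"
| "blk (HIf c p q) = blk p \<union> blk q"
| "blk (HFor r b c) = blk c"

primrec bnds :: "hcom \<Rightarrow> nat set" where
  "bnds HSkip = {}"
| "bnds (HN r e) = {}"
| "bnds (HR b i j e) = {}"
| "bnds (p ;; q) = bnds p \<union> bnds q"
| "bnds (HIf c p q) = bnds p \<union> bnds q"
| "bnds (HFor r b c) = insert b (bnds c)"

text \<open>Registers \<open>0\<close> and \<open>1\<close> are never assigned because every address
  depends on them.\<close>

primrec wf_com :: "hcom \<Rightarrow> bool" where
  "wf_com HSkip = True"
| "wf_com (HN r e) = (r < 100 \<and> r \<noteq> 0 \<and> r \<noteq> 1 \<and> nregs e \<subseteq> {..<100})"
| "wf_com (HR b i j e) = (nregs i \<union> nregs j \<union> hregs e \<subseteq> {..<100})"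
| "wf_com (p ;; q) = (wf_com p \<and> wf_com q)"
| "wf_com (HIf c p q) = (bregs c \<subseteq> {..<100} \<and> wf_com p \<and> wf_com q)"
| "wf_com (HFor r b c) = (r < 100 \<and> r \<noteq> 0 \<and> r \<noteq> 1 \<and> b < 100 \<and> r \<notin> asg c \<and> b \<notin> asg c \<and> r \<noteq> b \<and> wf_com c)"

lemma wp_mono:
  "wp c Q \<rho> f \<Longrightarrow> (\<And>\<rho>' f'. Q \<rho>' f' \<Longrightarrow> Q' \<rho>' f') \<Longrightarrow> wp c Q' \<rho> f"
proof (induction c arbitrary: Q Q' \<rho> f)
  case (HSeq p q)
  from HSeq.prems(1) have "wp p (wp q Q) \<rho> f" by simp
  then have "wp p (wp q Q') \<rho> f"
    by (rule HSeq.IH(1)) (erule HSeq.IH(2), rule HSeq.prems(2))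
  then show ?case by simp
next
  case (HIf c p q)
  then show ?case by (auto split: if_splits)
next
  case (HFor r b c)
  let ?F = "\<lambda>P. wp c (\<lambda>\<rho> f. P (inc r \<rho>) f)"
  have "(?F ^^ m) Q \<rho> f \<Longrightarrow> (?F ^^ m) Q' \<rho> f" for m \<rho> f
  proof (induction m arbitrary: \<rho> f)
    case 0
    then show ?case using HFor.prems by simp
  next
    case (Suc m)
    from Suc.prems have "wp c (\<lambda>\<rho> f. (?F ^^ m) Q (inc r \<rho>) f) \<rho> f"
      by simp
    from HFor.IH[OF this Suc.IH] show ?case by simp
  qed
  then show ?case using HFor.prems by simp
qed auto

text \<open>Every specification gets its frame for free, so the specifications of programs mention
  only what is computed.\<close>

lemma wp_frame:
  "wp c Q \<rho> f \<Longrightarrow> wp c (\<lambda>\<rho>' f'. Q \<rho>' f' \<and> (\<forall>x. x \<notin> asg c \<longrightarrow> \<rho>' x = \<rho> x) \<and>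
     (\<forall>b i j. b \<notin> blk c \<longrightarrow> f' (b, i, j) = f (b, i, j))) \<rho> f"
proof (induction c arbitrary: Q \<rho> f)
  case (HSeq p q)
  from HSeq.prems have "wp p (wp q Q) \<rho> f" by simp
  from HSeq.IH(1)[OF this] show ?case
    unfolding wp.simps
  proof (rule wp_mono, elim conjE)
    fix \<rho>' f'
    assume "wp q Q \<rho>' f'" and *: "\<forall>x. x \<notin> asg p \<longrightarrow> \<rho>' x = \<rho> x"
      "\<forall>b i j. b \<notin> blk p \<longrightarrow> f' (b, i, j) = f (b, i, j)"
    from HSeq.IH(2)[OF this(1)]
    show "wp q (\<lambda>\<rho>' f'. Q \<rho>' f' \<and> (\<forall>x. x \<notin> asg (p ;; q) \<longrightarrow> \<rho>' x = \<rho> x) \<and>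
       (\<forall>b i j. b \<notin> blk (p ;; q) \<longrightarrow> f' (b, i, j) = f (b, i, j))) \<rho>' f'"
      by (rule wp_mono) (use * in auto)
  qed
next
  case (HIf c p q)
  show ?case
  proof (cases "bv c \<rho> f")
    case True
    with HIf.prems have "wp p Q \<rho> f" by simp
    from HIf.IH(1)[OF this] HIf.prems True show ?thesis
      by simp (erule wp_mono, auto)
  next
    case False
    with HIf.prems have "wp q Q \<rho> f" by simp
    from HIf.IH(2)[OF this] HIf.prems False show ?thesis
      by simp (erule wp_mono, auto)
  qed
next
  case (HFor r b c)
  let ?F = "\<lambda>P. wp c (\<lambda>\<rho> f. P (inc r \<rho>) f)"
  let ?Q = "\<lambda>\<rho>0 f0 \<rho>' f'. Q \<rho>' f' \<and> (\<forall>x. x \<notin> insert r (asg c) \<longrightarrow> \<rho>' x = \<rho>0 x) \<and>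
     (\<forall>b i j. b \<notin> blk c \<longrightarrow> f' (b, i, j) = f0 (b, i, j))"
  have mono: "(?F ^^ m) Q1 \<rho> f \<Longrightarrow> (\<And>\<rho> f. Q1 \<rho> f \<Longrightarrow> Q2 \<rho> f) \<Longrightarrow> (?F ^^ m) Q2 \<rho> f" for m Q1 Q2 \<rho> f
  proof (induction m arbitrary: \<rho> f)
    case (Suc m)
    from Suc.prems(1) have "wp c (\<lambda>\<rho> f. (?F ^^ m) Q1 (inc r \<rho>) f) \<rho> f" by simp
    from wp_mono[OF this Suc.IH[OF _ Suc.prems(2)]] show ?case by simp
  qed simp
  have "(?F ^^ m) Q \<rho> f \<Longrightarrow> (?F ^^ m) (?Q \<rho> f) \<rho> f" for m \<rho> f
  proof (induction m arbitrary: \<rho> f)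
    case (Suc m)
    from Suc.prems have "wp c (\<lambda>\<rho> f. (?F ^^ m) Q (inc r \<rho>) f) \<rho> f" by simp
    from HFor.IH[OF this] have "wp c (\<lambda>\<rho>' f'. (?F ^^ m) (?Q \<rho> f) (inc r \<rho>') f') \<rho> f"
    proof (rule wp_mono, elim conjE)
      fix \<rho>' f'
      assume a: "(?F ^^ m) Q (inc r \<rho>') f'" "\<forall>x. x \<notin> asg c \<longrightarrow> \<rho>' x = \<rho> x"
        "\<forall>b i j. b \<notin> blk c \<longrightarrow> f' (b, i, j) = f (b, i, j)"
      show "(?F ^^ m) (?Q \<rho> f) (inc r \<rho>') f'"
        by (rule mono[OF Suc.IH[OF a(1)]]) (use a in \<open>auto simp: inc_apply\<close>)
    qed
    then show ?case by simp
  qed simp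
  note * = this
  have "(?F ^^ \<rho> b) (?Q (\<rho>(r := 0)) f) (\<rho>(r := 0)) f"
    by (rule *) (use HFor.prems in \<open>simp only: wp.simps\<close>)
  then have "(?F ^^ \<rho> b) (?Q \<rho> f) (\<rho>(r := 0)) f" by (rule mono) auto
  then show ?case by simp
qed auto

text \<open>The number of completed passes is an explicit argument of the invariant, which must
  ignore the register \<open>r\<close> itself: \<open>r\<close> is incremented between two passes,
  outside the specification of the body.\<close>

lemma wp_For:
  assumes wf: "r \<notin> asg c" "b \<notin> asg c" "r \<noteq> b"
    and init: "I 0 \<rho> f"
    and step: "\<And>i \<rho>' f'. i < \<rho> b \<Longrightarrow> \<rho>' r = i \<Longrightarrow> (\<And>x. x \<notin> insert r (asg c) \<Longrightarrow> \<rho>' x = \<rho> x) \<Longrightarrow>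
       (\<And>b i j. b \<notin> blk c \<Longrightarrow> f' (b, i, j) = f (b, i, j)) \<Longrightarrow> I i \<rho>' f' \<Longrightarrow>
       wp c (\<lambda>\<rho>'' f''. I (Suc i) \<rho>'' f'') \<rho>' f'"
    and indep: "\<And>i j \<rho> f. I i (\<rho>(r := j)) f = I i \<rho> f"
    and fin: "\<And>\<rho>' f'. \<rho>' r = \<rho> b \<Longrightarrow> (\<And>x. x \<notin> insert r (asg c) \<Longrightarrow> \<rho>' x = \<rho> x) \<Longrightarrow>
       (\<And>b i j. b \<notin> blk c \<Longrightarrow> f' (b, i, j) = f (b, i, j)) \<Longrightarrow> I (\<rho> b) \<rho>' f' \<Longrightarrow> Q \<rho>' f'"
  shows "wp (HFor r b c) Q \<rho> f"
proof -
  let ?F = "\<lambda>P. wp c (\<lambda>\<rho> f. P (inc r \<rho>) f)"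
  \<comment> \<open>Here \<open>m\<close> counts the passes still to come, because the iterate in
    \<open>wp\<close> unfolds from the first pass on.\<close>
  have "m \<le> \<rho> b \<Longrightarrow> \<rho>' r = \<rho> b - m \<Longrightarrow> (\<And>x. x \<notin> insert r (asg c) \<Longrightarrow> \<rho>' x = \<rho> x) \<Longrightarrow>
       (\<And>b i j. b \<notin> blk c \<Longrightarrow> f' (b, i, j) = f (b, i, j)) \<Longrightarrow> I (\<rho> b - m) \<rho>' f' \<Longrightarrow> (?F ^^ m) Q \<rho>' f'" for m \<rho>' f'
  proof (induction m arbitrary: \<rho>' f')
    case 0
    then show ?case by (auto intro!: fin)
  next
    case (Suc m)
    have "wp c (\<lambda>\<rho>'' f''. I (Suc (\<rho> b - Suc m)) \<rho>'' f'') \<rho>' f'"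
      by (rule step) (use Suc.prems in auto)
    from wp_frame[OF this] have "wp c (\<lambda>\<rho>'' f''. (?F ^^ m) Q (inc r \<rho>'') f'') \<rho>' f'"
    proof (rule wp_mono, elim conjE)
      fix \<rho>'' f''
      assume a: "I (Suc (\<rho> b - Suc m)) \<rho>'' f''" "\<forall>x. x \<notin> asg c \<longrightarrow> \<rho>'' x = \<rho>' x"
        "\<forall>b i j. b \<notin> blk c \<longrightarrow> f'' (b, i, j) = f' (b, i, j)"
      have eq: "Suc (\<rho> b - Suc m) = \<rho> b - m" using Suc.prems(1) by simp
      have "I (\<rho> b - m) (inc r \<rho>'') f''" using a(1) unfolding eq inc_def indep .
      then show "(?F ^^ m) Q (inc r \<rho>'') f''"
      proof (intro Suc.IH)
        show "m \<le> \<rho> b" using Suc.prems(1) by simp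
        show "inc r \<rho>'' r = \<rho> b - m" using a(2) wf(1) Suc.prems(2) eq by (simp add: inc_apply)
        show "inc r \<rho>'' x = \<rho> x" if "x \<notin> insert r (asg c)" for x
          using that a(2) Suc.prems(3) by (simp add: inc_apply)
        show "f'' (b, i, j) = f (b, i, j)" if "b \<notin> blk c" for b i j
          using that a(3) Suc.prems(4) by simp
      qed
    qed
    then show ?case by simp
  qed
  from this[of "\<rho> b" "\<rho>(r := 0)" f] init indep show ?thesis by simp
qed

section \<open>Addresses and evaluation of expressions\<close>

primrec rowx :: "nat \<Rightarrow> nexp \<Rightarrow> nexp" where
  "rowx 0 i = i"
| "rowx (Suc b) i = NAdd (rowx b i) (NAdd (NReg 0) (NReg 1))"

lemma nv_rowx: "nv (rowx b i) \<rho> = b * (\<rho> 0 + \<rho> 1) + nv i \<rho>"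
  by (induction b) (auto simp: algebra_simps)

text \<open>The offset \<open>2\<close> makes block \<open>0\<close> start with the array of input
  points; cells \<open>0\<close> and \<open>1\<close> lie outside all blocks. For
  \<open>i < n + d\<close> and \<open>j < d\<close> these are mixed-radix digits, hence the
  injectivity.\<close>

definition addr :: "nat \<Rightarrow> nat \<Rightarrow> nat \<times> nat \<times> nat \<Rightarrow> nat" where
  "addr n d = (\<lambda>(b, i, j). 2 + (b * (n + d) + i) * d + j)"

lemma addr_inj:
  assumes "i < n + d" "j < d" "i' < n + d" "j' < d" "addr n d (b, i, j) = addr n d (b', i', j')"
  shows "(b, i, j) = (b', i', j')"
proof -
  have 1: "(b * (n + d) + i) * d + j = (b' * (n + d) + i') * d + j'"
    using assms(5) by (simp add: addr_def)
  have "j = j'" using arg_cong[OF 1, of "\<lambda>x. x mod d"] assms by simp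
  moreover have 2: "b * (n + d) + i = b' * (n + d) + i'"
    using arg_cong[OF 1, of "\<lambda>x. x div d"] assms by simp
  moreover have "i = i'" using arg_cong[OF 2, of "\<lambda>x. x mod (n + d)"] assms by simp
  moreover have "b = b'" using arg_cong[OF 2, of "\<lambda>x. x div (n + d)"] assms by simp
  ultimately show ?thesis by simp
qed

definition rel :: "(nat \<Rightarrow> nat) \<Rightarrow> store \<Rightarrow> state \<Rightarrow> bool" where
  "rel \<rho> f s \<longleftrightarrow> (\<forall>r<100. reg s r = \<rho> r) \<and>
     (\<forall>b i j. i < \<rho> 0 + \<rho> 1 \<longrightarrow> j < \<rho> 1 \<longrightarrow> cell s (addr (\<rho> 0) (\<rho> 1) (b, i, j)) = f (b, i, j))"

lemma nv_rel: "rel \<rho> f s \<Longrightarrow> nregs e \<subseteq> {..<100} \<Longrightarrow> nv e (reg s) = nv e \<rho>"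
  by (rule nv_cong) (auto simp: rel_def)

definition for_com :: "nat \<Rightarrow> nat \<Rightarrow> com \<Rightarrow> com" where
  "for_com r b c = Seq (NAssign r (NConst 0))
     (While (NLess (NReg r) (NReg b)) (Seq c (NAssign r (NAdd (NReg r) (NConst 1)))))"

text \<open>Each pass pays for a test and an increment besides the body, hence \<open>T + 2\<close>;
  the initial assignment and the last, failing test give the final \<open>2\<close>.
  \<open>J i\<close> describes the state after the counter has been set to \<open>i\<close>.\<close>

lemma exec_for_com:
  assumes wf: "r \<noteq> b" and N: "reg s b = N"
    and init: "J 0 (s\<lparr>reg := (reg s)(r := 0)\<rparr>)"
    and step: "\<And>i s'. i < N \<Longrightarrow> reg s' r = i \<Longrightarrow> reg s' b = N \<Longrightarrow> J i s' \<Longrightarrow>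
       \<exists>t s''. exec c s' t s'' \<and> t \<le> T \<and> reg s'' r = i \<and> reg s'' b = N \<and>
         J (Suc i) (s''\<lparr>reg := (reg s'')(r := Suc i)\<rparr>)"
  shows "\<exists>t s'. exec (for_com r b c) s t s' \<and> t \<le> N * (T + 2) + 2 \<and> J N s'"
proof -
  let ?W = "While (NLess (NReg r) (NReg b)) (Seq c (NAssign r (NAdd (NReg r) (NConst 1))))"
  have "m \<le> N \<Longrightarrow> reg s' r = N - m \<Longrightarrow> reg s' b = N \<Longrightarrow> J (N - m) s' \<Longrightarrow>
     \<exists>t s''. exec ?W s' t s'' \<and> t \<le> m * (T + 2) + 1 \<and> J N s''" for m s'
  proof (induction m arbitrary: s')
    case 0
    then have "exec ?W s' 1 s'" by (intro WhileFalse) simp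
    moreover have "1 \<le> 0 * (T + 2) + (1::nat)" "J N s'" using 0 by simp_all
    ultimately show ?case by blast
  next
    case (Suc m)
    from step[of "N - Suc m" s'] Suc.prems obtain t s'' where s'': "exec c s' t s''" "t \<le> T"
      "reg s'' r = N - Suc m" "reg s'' b = N"
      "J (Suc (N - Suc m)) (s''\<lparr>reg := (reg s'')(r := Suc (N - Suc m))\<rparr>)" by auto
    let ?s = "s''\<lparr>reg := (reg s'')(r := Suc (N - Suc m))\<rparr>"
    have eq: "Suc (N - Suc m) = N - m" using Suc.prems(1) by simp
    have "\<exists>t s''. exec ?W ?s t s'' \<and> t \<le> m * (T + 2) + 1 \<and> J N s''"
      by (rule Suc.IH) (use s'' Suc.prems(1) wf eq in simp_all)
    then obtain t' s3 where s3: "exec ?W ?s t' s3" "t' \<le> m * (T + 2) + 1" "J N s3"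
      by blast
    have "exec (NAssign r (NAdd (NReg r) (NConst 1))) s'' 1 ?s"
      using NAssign[of r "NAdd (NReg r) (NConst 1)" s''] s''(3) by simp
    from exec.Seq[OF s''(1) this] have "exec ?W s' (Suc ((t + 1) + t')) s3"
      using s3(1) Suc.prems by (intro WhileTrue) auto
    moreover have "Suc ((t + 1) + t') \<le> Suc m * (T + 2) + 1" using s3(2) s''(2) by simp
    ultimately show ?case using s3(3) by blast
  qed
  from this[of N "s\<lparr>reg := (reg s)(r := 0)\<rparr>"]
  have "\<exists>t s'. exec ?W (s\<lparr>reg := (reg s)(r := 0)\<rparr>) t s' \<and> t \<le> N * (T + 2) + 1 \<and> J N s'"
    using wf N init by simp
  then obtain t s' where
    "exec ?W (s\<lparr>reg := (reg s)(r := 0)\<rparr>) t s'" "t \<le> N * (T + 2) + 1" "J N s'" by blast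
  moreover have "exec (NAssign r (NConst 0)) s 1 (s\<lparr>reg := (reg s)(r := 0)\<rparr>)"
    using NAssign[of r "NConst 0" s] by simp
  ultimately have "exec (for_com r b c) s (1 + t) s'"
    unfolding for_com_def by - (rule exec.Seq)
  moreover have "1 + t \<le> N * (T + 2) + 2" using \<open>t \<le> N * (T + 2) + 1\<close> by simp
  ultimately have "exec (for_com r b c) s (1 + t) s'" "1 + t \<le> N * (T + 2) + 2" .
  then show ?thesis using \<open>J N s'\<close> by blast
qed

text \<open>All running times are bounded by powers of one size \<open>S\<close>, so that running
  two programs in sequence costs one in the exponent. This is crude, but the exponents then depend
  on the program text only.\<close>

lemma pow_Suc_ge: "S \<ge> 2 \<Longrightarrow> a \<le> m \<Longrightarrow> b \<le> m \<Longrightarrow> (S::nat) ^ a + S ^ b \<le> S ^ Suc m"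
proof -
  assume S: "S \<ge> 2" and "a \<le> m" "b \<le> m"
  then have "S ^ a \<le> S ^ m" "S ^ b \<le> S ^ m" by (auto intro!: power_increasing)
  moreover have "2 * S ^ m \<le> S ^ Suc m" using S by simp
  ultimately show ?thesis by linarith
qed

lemma loop_time:
  assumes "S \<ge> (2::nat)" "N \<le> S" "T \<le> S ^ e"
  shows "N * (T + 2) + 2 \<le> S ^ (e + 5)"
proof -
  have "T + 2 \<le> S ^ e + S ^ 1" using assms by simp
  also have "\<dots> \<le> S ^ Suc (e + 1)" by (rule pow_Suc_ge) (use assms in auto)
  finally have "N * (T + 2) \<le> S * S ^ (e + 2)" using assms by (intro mult_mono) auto
  then have "N * (T + 2) + 2 \<le> S ^ (e + 3) + S ^ 1" using assms by (simp add: numeral_3_eq_3)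
  also have "\<dots> \<le> S ^ Suc (e + 3)" by (rule pow_Suc_ge) (use assms in auto)
  also have "\<dots> \<le> S ^ (e + 5)" by (rule power_increasing) (use assms in auto)
  finally show ?thesis .
qed

text \<open>The factor \<open>d\<close> is realised by \<open>d\<close> additions of the row number,
  because registers cannot be multiplied; the constant block number is unrolled by
  \<open>rowx\<close>.\<close>

definition caddr :: "nat \<Rightarrow> nat \<Rightarrow> nexp \<Rightarrow> nexp \<Rightarrow> com" where
  "caddr t b i j = Seq (NAssign t (NAdd (NConst 2) j))
     (for_com 100 1 (NAssign t (NAdd (NReg t) (rowx b i))))"

lemma exec_caddr:
  assumes t: "t > 100" and r: "nregs i \<subseteq> {..<100}" "nregs j \<subseteq> {..<100}"
    and S: "S \<ge> 2" "reg s 1 \<le> S"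
  shows "\<exists>u s'. exec (caddr t b i j) s u s' \<and> u \<le> S ^ 6 \<and> cell s' = cell s \<and>
    (\<forall>x. x \<noteq> 100 \<longrightarrow> x \<noteq> t \<longrightarrow> reg s' x = reg s x) \<and>
    reg s' t = addr (reg s 0) (reg s 1) (b, nv i (reg s), nv j (reg s))"
proof -
  let ?s = "s\<lparr>reg := (reg s)(t := 2 + nv j (reg s))\<rparr>"
  let ?J = "\<lambda>l (s' :: state). cell s' = cell s \<and> (\<forall>x. x \<noteq> 100 \<longrightarrow> x \<noteq> t \<longrightarrow> reg s' x = reg s x) \<and>
    reg s' t = 2 + nv j (reg s) + l * (b * (reg s 0 + reg s 1) + nv i (reg s))"
  have 1: "exec (NAssign t (NAdd (NConst 2) j)) s 1 ?s"
    using NAssign[of t "NAdd (NConst 2) j" s] by (simp add: nval_eq_nv)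
  have "\<exists>u s'. exec (for_com 100 1 (NAssign t (NAdd (NReg t) (rowx b i)))) ?s u s' \<and>
     u \<le> reg s 1 * (1 + 2) + 2 \<and> ?J (reg s 1) s'"
  proof (rule exec_for_com[where J = ?J])
    fix l and s' :: state
    assume l: "l < reg s 1" "reg s' 100 = l" "reg s' 1 = reg s 1" "?J l s'"
    let ?s' = "s'\<lparr>reg := (reg s')(t := reg s' t + (b * (reg s 0 + reg s 1) + nv i (reg s)))\<rparr>"
    have "reg s' x = reg s x" if "x < 100" for x using l(4) t that by simp
    then have "nv i (reg s') = nv i (reg s)" by (intro nv_cong) (use r in blast)
    then have "nval (NAdd (NReg t) (rowx b i)) s' = reg s' t + (b * (reg s 0 + reg s 1) + nv i (reg s))"
      using l t by (simp add: nval_eq_nv nv_rowx)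
    then have "exec (NAssign t (NAdd (NReg t) (rowx b i))) s' 1 ?s'"
      using NAssign[of t "NAdd (NReg t) (rowx b i)" s'] by simp
    moreover have "?J (Suc l) (?s'\<lparr>reg := (reg ?s')(100 := Suc l)\<rparr>)" using l t by simp
    ultimately show "\<exists>u s''. exec (NAssign t (NAdd (NReg t) (rowx b i))) s' u s'' \<and> u \<le> 1 \<and>
       reg s'' 100 = l \<and> reg s'' 1 = reg s 1 \<and> ?J (Suc l) (s''\<lparr>reg := (reg s'')(100 := Suc l)\<rparr>)"
      using l(2,3) t by (intro exI[of _ "1::nat"] exI[of _ ?s']) simp
  qed (use t in simp_all)
  then obtain u s' where s': "exec (for_com 100 1 (NAssign t (NAdd (NReg t) (rowx b i)))) ?s u s'"
     "u \<le> reg s 1 * (1 + 2) + 2" "?J (reg s 1) s'" by blast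
  have "exec (caddr t b i j) s (1 + u) s'" unfolding caddr_def by (rule exec.Seq[OF 1 s'(1)])
  moreover have "1 + u \<le> S ^ 6"
  proof -
    have "u \<le> S ^ 5" using loop_time[of S "reg s 1" 1 0] S s'(2) by simp
    then show ?thesis using pow_Suc_ge[of S 0 5 5] S by simp
  qed
  ultimately show ?thesis using s'(3) by (intro exI[of _ "1 + u"] exI[of _ s']) (simp add: addr_def)
qed

primrec sz :: "hexp \<Rightarrow> nat" where
  "sz (HC k) = 0"
| "sz (HL b i j) = 1"
| "sz (HBin bo a b) = sz a + sz b"
| "sz (HSqrt a) = sz a"

text \<open>Computing an address takes a loop, which no expression can contain. Hence
  \<open>pre\<close> first stores the addresses of all array accesses in the \<open>sz e\<close>
  registers from \<open>t\<close> on, and \<open>ex\<close> reads through these registers.\<close>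

primrec pre :: "hexp \<Rightarrow> nat \<Rightarrow> com" where
  "pre (HC k) t = Skip"
| "pre (HL b i j) t = caddr t b i j"
| "pre (HBin bo a b) t = Seq (pre a t) (pre b (t + sz a))"
| "pre (HSqrt a) t = pre a t"

primrec ex :: "hexp \<Rightarrow> nat \<Rightarrow> rexp" where
  "ex (HC k) t = RConst k"
| "ex (HL b i j) t = RCell (NReg t)"
| "ex (HBin bo a b) t = opx bo (ex a t) (ex b (t + sz a))"
| "ex (HSqrt a) t = RSqrt (ex a t)"

primrec pexp :: "hexp \<Rightarrow> nat" where
  "pexp (HC k) = 0"
| "pexp (HL b i j) = 6"
| "pexp (HBin bo a b) = Suc (max (pexp a) (pexp b))"
| "pexp (HSqrt a) = pexp a"

lemma rel_cong:
  "rel \<rho> f s \<Longrightarrow> cell s' = cell s \<Longrightarrow> (\<And>x. x < 100 \<Longrightarrow> reg s' x = reg s x) \<Longrightarrow> rel \<rho> f s'"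
  unfolding rel_def by metis

text \<open>The value is promised for every later state with the same cells and the same address
  registers, because the addresses of further subexpressions are computed before the expression is
  evaluated.\<close>

definition prepared :: "hexp \<Rightarrow> nat \<Rightarrow> real \<Rightarrow> state \<Rightarrow> state \<Rightarrow> bool" where
  "prepared e t v s s' \<longleftrightarrow> cell s' = cell s \<and>
    (\<forall>x. x \<noteq> 100 \<longrightarrow> \<not> (t \<le> x \<and> x < t + sz e) \<longrightarrow> reg s' x = reg s x) \<and>
    (\<forall>s''. cell s'' = cell s \<longrightarrow> (\<forall>x. t \<le> x \<and> x < t + sz e \<longrightarrow> reg s'' x = reg s' x) \<longrightarrow>
       rval (ex e t) s'' = v)"

lemma prepared_cell: "prepared e t v s s' \<Longrightarrow> cell s' = cell s"
  by (simp add: prepared_def)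

lemma prepared_reg:
  "prepared e t v s s' \<Longrightarrow> x \<noteq> 100 \<Longrightarrow> x < t \<or> t + sz e \<le> x \<Longrightarrow> reg s' x = reg s x"
  unfolding prepared_def by (meson not_le)

lemma prepared_rval:
  "prepared e t v s s' \<Longrightarrow> cell s'' = cell s' \<Longrightarrow>
   (\<And>x. t \<le> x \<Longrightarrow> x < t + sz e \<Longrightarrow> reg s'' x = reg s' x) \<Longrightarrow> rval (ex e t) s'' = v"
  for s'' :: state
  unfolding prepared_def by (elim conjE allE[where x = s'']) simp

lemma prepared_rel: "prepared e t v s s' \<Longrightarrow> rel \<rho> f s \<Longrightarrow> t > 100 \<Longrightarrow> rel \<rho> f s'"
  by (rule rel_cong) (auto simp: prepared_cell prepared_reg)

lemma prepared_HBin: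
  assumes a: "prepared a t v s s1" and b: "prepared b (t + sz a) w s1 s2" and t: "t > 100"
  shows "prepared (HBin bo a b) t (opv bo v w) s s2"
  unfolding prepared_def
proof (intro conjI allI impI)
  show "cell s2 = cell s" using a b by (simp add: prepared_cell)
next
  fix x assume "x \<noteq> 100" "\<not> (t \<le> x \<and> x < t + sz (HBin bo a b))"
  then show "reg s2 x = reg s x"
    using prepared_reg[OF a, of x] prepared_reg[OF b, of x] by auto
next
  fix s'' :: state
  assume c: "cell s'' = cell s" and
    r: "\<forall>x. t \<le> x \<and> x < t + sz (HBin bo a b) \<longrightarrow> reg s'' x = reg s2 x"
  have "rval (ex a t) s'' = v"
    by (rule prepared_rval[OF a]) (use c r t prepared_cell[OF a] prepared_reg[OF b] in auto)
  moreover have "rval (ex b (t + sz a)) s'' = w"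
    by (rule prepared_rval[OF b]) (use c r prepared_cell[OF a] prepared_cell[OF b] in auto)
  ultimately show "rval (ex (HBin bo a b) t) s'' = opv bo v w" by simp
qed

lemma exec_pre:
  assumes "t > 100" "hregs e \<subseteq> {..<100}" "vd e \<rho>" "rel \<rho> f s" "S \<ge> 2" "\<rho> 1 \<le> S"
  shows "\<exists>u s'. exec (pre e t) s u s' \<and> u \<le> S ^ pexp e \<and> prepared e t (rv e \<rho> f) s s'"
  using assms
proof (induction e arbitrary: t s)
  case (HC k)
  have "exec Skip s 1 s" by (rule exec.Skip)
  moreover have "prepared (HC k) t (rv (HC k) \<rho> f) s s" by (simp add: prepared_def)
  ultimately show ?case by auto
next
  case (HL b i j)
  from HL have r1: "reg s 1 = \<rho> 1" "reg s 0 = \<rho> 0" by (auto simp: rel_def)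
  have ij: "nv i (reg s) = nv i \<rho>" "nv j (reg s) = nv j \<rho>" using HL by (auto intro!: nv_rel)
  from exec_caddr[of t i j S s b] HL r1 obtain u s' where s': "exec (caddr t b i j) s u s'"
    "u \<le> S ^ 6" "cell s' = cell s" "\<forall>x. x \<noteq> 100 \<longrightarrow> x \<noteq> t \<longrightarrow> reg s' x = reg s x"
    "reg s' t = addr (reg s 0) (reg s 1) (b, nv i (reg s), nv j (reg s))" by auto
  have "cell s (addr (\<rho> 0) (\<rho> 1) (b, nv i \<rho>, nv j \<rho>)) = f (b, nv i \<rho>, nv j \<rho>)"
    using HL.prems(3,4) by (simp add: valid_def rel_def)
  then have "prepared (HL b i j) t (rv (HL b i j) \<rho> f) s s'"
    unfolding prepared_def using s'(3-5) r1 ij by (auto simp: less_Suc_eq)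
  then show ?case using s'(1,2) by auto
next
  case (HBin bo e1 e2)
  from HBin.IH(1)[of t s] HBin.prems obtain u1 s1 where s1: "exec (pre e1 t) s u1 s1" "u1 \<le> S ^ pexp e1"
    "prepared e1 t (rv e1 \<rho> f) s s1" by auto
  have "rel \<rho> f s1" by (rule prepared_rel[OF s1(3)]) (use HBin.prems in auto)
  with HBin.IH(2)[of "t + sz e1" s1] HBin.prems obtain u2 s2 where
    s2: "exec (pre e2 (t + sz e1)) s1 u2 s2" "u2 \<le> S ^ pexp e2"
    "prepared e2 (t + sz e1) (rv e2 \<rho> f) s1 s2" by auto
  have "exec (pre (HBin bo e1 e2) t) s (u1 + u2) s2" using exec.Seq[OF s1(1) s2(1)] by simp
  moreover have "u1 + u2 \<le> S ^ pexp (HBin bo e1 e2)"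
    using pow_Suc_ge[of S "pexp e1" "max (pexp e1) (pexp e2)" "pexp e2"] s1 s2 HBin.prems by simp
  moreover have "prepared (HBin bo e1 e2) t (rv (HBin bo e1 e2) \<rho> f) s s2"
    using prepared_HBin[OF s1(3) s2(3) HBin.prems(1)] by simp
  ultimately show ?case by blast
next
  case (HSqrt e)
  then obtain u s' where *: "exec (pre e t) s u s'" "u \<le> S ^ pexp e"
    "prepared e t (rv e \<rho> f) s s'" by fastforce
  have "prepared (HSqrt e) t (rv (HSqrt e) \<rho> f) s s'"
    unfolding prepared_def
  proof (intro conjI allI impI)
    fix s'' :: state
    assume "cell s'' = cell s" "\<forall>x. t \<le> x \<and> x < t + sz (HSqrt e) \<longrightarrow> reg s'' x = reg s' x"
    then have "rval (ex e t) s'' = rv e \<rho> f"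
      using prepared_cell[OF *(3)] by (intro prepared_rval[OF *(3)]) auto
    then show "rval (ex (HSqrt e) t) s'' = rv (HSqrt e) \<rho> f" by simp
  qed (use prepared_cell[OF *(3)] prepared_reg[OF *(3)] in auto)
  then show ?case using * by auto
qed

text \<open>\<open>Plus\<close> serves only to pair the two operands, so that their addresses are
  prepared in adjacent registers; no sum is evaluated.\<close>

primrec preb :: "hbool \<Rightarrow> com" where
  "preb (HNLess a b) = Skip"
| "preb (HRLess a b) = pre (HBin Plus a b) 101"

primrec exb :: "hbool \<Rightarrow> bexp" where
  "exb (HNLess a b) = NLess a b"
| "exb (HRLess a b) = RLess (ex a 101) (ex b (101 + sz a))"

primrec pexpb :: "hbool \<Rightarrow> nat" where
  "pexpb (HNLess a b) = 0"
| "pexpb (HRLess a b) = pexp (HBin Plus a b)"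

lemma exec_preb:
  assumes "bregs e \<subseteq> {..<100}" "vdb e \<rho>" "rel \<rho> f s" "S \<ge> 2" "\<rho> 1 \<le> S"
  shows "\<exists>u s'. exec (preb e) s u s' \<and> u \<le> S ^ pexpb e \<and> rel \<rho> f s' \<and> bval (exb e) s' = bv e \<rho> f"
proof (cases e)
  case (HNLess a b)
  have "exec Skip s 1 s" by (rule exec.Skip)
  then show ?thesis using HNLess assms nv_rel[of \<rho> f s a] nv_rel[of \<rho> f s b]
    by (intro exI[of _ 1] exI[of _ s]) (auto simp: nval_eq_nv)
next
  case (HRLess e1 e2)
  from exec_pre[of 101 e1 \<rho> f s S] HRLess assms obtain u1 s1 where s1: "exec (pre e1 101) s u1 s1" "u1 \<le> S ^ pexp e1"
    "prepared e1 101 (rv e1 \<rho> f) s s1" by auto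
  have "rel \<rho> f s1" by (rule prepared_rel[OF s1(3) assms(3)]) simp
  with exec_pre[of "101 + sz e1" e2 \<rho> f s1 S] HRLess assms obtain u2 s2 where
    s2: "exec (pre e2 (101 + sz e1)) s1 u2 s2" "u2 \<le> S ^ pexp e2"
    "prepared e2 (101 + sz e1) (rv e2 \<rho> f) s1 s2" by auto
  have "exec (preb e) s (u1 + u2) s2" using exec.Seq[OF s1(1) s2(1)] HRLess by simp
  moreover have "u1 + u2 \<le> S ^ pexpb e"
    using pow_Suc_ge[of S "pexp e1" "max (pexp e1) (pexp e2)" "pexp e2"] s1 s2 assms HRLess by simp
  moreover have "rel \<rho> f s2" by (rule prepared_rel[OF s2(3) \<open>rel \<rho> f s1\<close>]) simp
  moreover have "rval (ex e1 101) s2 = rv e1 \<rho> f"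
    by (rule prepared_rval[OF s1(3)]) (use prepared_cell[OF s2(3)] prepared_reg[OF s2(3)] in auto)
  moreover have "rval (ex e2 (101 + sz e1)) s2 = rv e2 \<rho> f"
    by (rule prepared_rval[OF s2(3)]) auto
  ultimately show ?thesis using HRLess by (intro exI[of _ "u1 + u2"] exI[of _ s2]) auto
qed

section \<open>Compilation and polynomial running time\<close>

primrec compile :: "hcom \<Rightarrow> com" where
  "compile HSkip = Skip"
| "compile (HN r e) = NAssign r e"
| "compile (HR b i j e) = Seq (pre e 102) (Seq (caddr 101 b i j) (RAssign (NReg 101) (ex e 102)))"
| "compile (p ;; q) = Seq (compile p) (compile q)"
| "compile (HIf c p q) = Seq (preb c) (Cond (exb c) (compile p) (compile q))"
| "compile (HFor r b c) = for_com r b (compile c)"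

text \<open>A sequence adds one to the exponent by \<open>pow_Suc_ge\<close> and a loop adds five by
  \<open>loop_time\<close>, whatever the input.\<close>

primrec texp :: "hcom \<Rightarrow> nat" where
  "texp HSkip = 0"
| "texp (HN r e) = 0"
| "texp (HR b i j e) = max (pexp e) 7 + 1"
| "texp (p ;; q) = max (texp p) (texp q) + 1"
| "texp (HIf c p q) = max (pexpb c) (max (texp p) (texp q) + 1) + 1"
| "texp (HFor r b c) = texp c + 5"

lemma rel_upd:
  assumes "rel \<rho> f s" "valid i j \<rho>"
  shows "rel \<rho> (f((b, nv i \<rho>, nv j \<rho>) := v))
    (s\<lparr>cell := (cell s)(addr (\<rho> 0) (\<rho> 1) (b, nv i \<rho>, nv j \<rho>) := v)\<rparr>)"
  unfolding rel_def
proof (intro conjI allI impI)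
  fix b' i' j' assume *: "i' < \<rho> 0 + \<rho> 1" "j' < \<rho> 1"
  have "(addr (\<rho> 0) (\<rho> 1) (b', i', j') = addr (\<rho> 0) (\<rho> 1) (b, nv i \<rho>, nv j \<rho>)) =
      ((b', i', j') = (b, nv i \<rho>, nv j \<rho>))"
    using addr_inj[OF * , of "nv i \<rho>" "nv j \<rho>" b' b] assms(2) unfolding valid_def by metis
  moreover have "cell s (addr (\<rho> 0) (\<rho> 1) (b', i', j')) = f (b', i', j')"
    using assms(1) * by (simp add: rel_def)
  ultimately show "cell (s\<lparr>cell := (cell s)(addr (\<rho> 0) (\<rho> 1) (b, nv i \<rho>, nv j \<rho>) := v)\<rparr>)
      (addr (\<rho> 0) (\<rho> 1) (b', i', j')) = (f((b, nv i \<rho>, nv j \<rho>) := v)) (b', i', j')"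
    by simp
qed (use assms(1) in \<open>simp add: rel_def\<close>)

text \<open>A simulation along the relation \<open>rel\<close>. Disjointness of
  \<open>bnds c\<close> and \<open>asg c\<close> keeps every loop bound at its initial value, so
  that it is still at most \<open>S\<close> whenever an inner loop is entered.\<close>

lemma compile_correct:
  assumes "wp c Q \<rho> f" "wf_com c" "rel \<rho> f s" "S \<ge> 2" "\<rho> 1 \<le> S"
    "\<And>b. b \<in> bnds c \<Longrightarrow> \<rho> b \<le> S" "bnds c \<inter> asg c = {}"
  shows "\<exists>t s' \<rho>' f'. exec (compile c) s t s' \<and> t \<le> S ^ texp c \<and> rel \<rho>' f' s' \<and> Q \<rho>' f'"
  using assms
proof (induction c arbitrary: Q \<rho> f s)
  case HSkip
  have "exec Skip s 1 s" by (rule exec.Skip)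
  with HSkip show ?case by auto
next
  case (HN r e)
  have "exec (NAssign r e) s 1 (s\<lparr>reg := (reg s)(r := nv e \<rho>)\<rparr>)"
    using NAssign[of r e s] nv_rel[of \<rho> f s e] HN by (simp add: nval_eq_nv)
  moreover have "rel (\<rho>(r := nv e \<rho>)) f (s\<lparr>reg := (reg s)(r := nv e \<rho>)\<rparr>)"
    using HN.prems unfolding rel_def by auto
  ultimately show ?case using HN by fastforce
next
  case (HR b i j e)
  then have v: "valid i j \<rho>" "vd e \<rho>" and Q: "Q \<rho> (f((b, nv i \<rho>, nv j \<rho>) := rv e \<rho> f))" by auto
  from exec_pre[of 102 e \<rho> f s S] HR v obtain u1 s1 where s1: "exec (pre e 102) s u1 s1" "u1 \<le> S ^ pexp e"
    "prepared e 102 (rv e \<rho> f) s s1" by auto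
  have rel1: "rel \<rho> f s1" by (rule prepared_rel[OF s1(3) HR.prems(3)]) simp
  then have r1: "reg s1 0 = \<rho> 0" "reg s1 1 = \<rho> 1" by (auto simp: rel_def)
  obtain u2 s2 where s2: "exec (caddr 101 b i j) s1 u2 s2"
    "u2 \<le> S ^ 6" "cell s2 = cell s1" "\<forall>x. x \<noteq> 100 \<longrightarrow> x \<noteq> 101 \<longrightarrow> reg s2 x = reg s1 x"
    "reg s2 101 = addr (reg s1 0) (reg s1 1) (b, nv i (reg s1), nv j (reg s1))"
    using exec_caddr[of 101 i j S s1 b] HR r1 by auto
  have rel2: "rel \<rho> f s2" by (rule rel_cong[OF rel1 s2(3)]) (use s2 in auto)
  have ij: "nv i (reg s1) = nv i \<rho>" "nv j (reg s1) = nv j \<rho>" using HR rel1 by (auto intro!: nv_rel)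
  have "rval (ex e 102) s2 = rv e \<rho> f"
    by (rule prepared_rval[OF s1(3) s2(3)]) (use s2(4) in auto)
  then have "exec (RAssign (NReg 101) (ex e 102)) s2 1
    (s2\<lparr>cell := (cell s2)(addr (\<rho> 0) (\<rho> 1) (b, nv i \<rho>, nv j \<rho>) := rv e \<rho> f)\<rparr>)" (is "exec _ _ _ ?s")
    using RAssign[of "NReg 101" "ex e 102" s2] s2(5) ij r1 by simp
  from exec.Seq[OF s1(1) exec.Seq[OF s2(1) this]] have "exec (compile (HR b i j e)) s (u1 + (u2 + 1)) ?s" by simp
  moreover have "u2 + 1 \<le> S ^ 6 + S ^ 0" using s2(2) by simp
  with pow_Suc_ge[of S 6 6 0] HR.prems have "u2 + 1 \<le> S ^ 7" by simp
  then have "u1 + (u2 + 1) \<le> S ^ texp (HR b i j e)"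
    using pow_Suc_ge[of S "pexp e" "max (pexp e) 7" 7] s1 HR.prems by simp
  ultimately show ?case using rel_upd[OF rel2 v(1)] Q by blast
next
  case (HSeq p q)
  have disj: "bnds p \<inter> asg p = {}" "bnds q \<inter> asg q = {}" "bnds q \<inter> asg p = {}" using HSeq.prems(7) by auto
  have a: "1 \<notin> asg p" if "wf_com p" for p using that by (induction p) auto
  from HSeq.prems(1) have "wp p (wp q Q) \<rho> f" by simp
  have "\<exists>t s' \<rho>' f'. exec (compile p) s t s' \<and> t \<le> S ^ texp p \<and> rel \<rho>' f' s' \<and>
      (wp q Q \<rho>' f' \<and> (\<forall>x. x \<notin> asg p \<longrightarrow> \<rho>' x = \<rho> x) \<and>
       (\<forall>b i j. b \<notin> blk p \<longrightarrow> f' (b, i, j) = f (b, i, j)))"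
    by (rule HSeq.IH(1)[OF wp_frame[OF \<open>wp p (wp q Q) \<rho> f\<close>] _ HSeq.prems(3)]) (use HSeq.prems disj in simp_all)
  then obtain t1 s1 \<rho>1 f1 where
    1: "exec (compile p) s t1 s1" "t1 \<le> S ^ texp p" "rel \<rho>1 f1 s1" "wp q Q \<rho>1 f1" "\<forall>x. x \<notin> asg p \<longrightarrow> \<rho>1 x = \<rho> x"
    by blast
  have "\<exists>t s' \<rho>' f'. exec (compile q) s1 t s' \<and> t \<le> S ^ texp q \<and> rel \<rho>' f' s' \<and> Q \<rho>' f'"
    by (rule HSeq.IH(2)[OF 1(4) _ 1(3)]) (use HSeq.prems disj 1(5) a[of p] in auto)
  then obtain t2 s2 \<rho>2 f2 where
    2: "exec (compile q) s1 t2 s2" "t2 \<le> S ^ texp q" "rel \<rho>2 f2 s2" "Q \<rho>2 f2" by blast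
  have "exec (compile (p ;; q)) s (t1 + t2) s2" using exec.Seq[OF 1(1) 2(1)] by simp
  moreover have "t1 + t2 \<le> S ^ texp (p ;; q)"
    using pow_Suc_ge[of S "texp p" "max (texp p) (texp q)" "texp q"] 1 2 HSeq.prems by simp
  ultimately show ?case using 2 by blast
next
  case (HIf c p q)
  from exec_preb[of c \<rho> f s S] HIf.prems obtain u s1 where s1: "exec (preb c) s u s1"
    "u \<le> S ^ pexpb c" "rel \<rho> f s1" "bval (exb c) s1 = bv c \<rho> f" by auto
  have disj: "bnds p \<inter> asg p = {}" "bnds q \<inter> asg q = {}" using HIf.prems(7) by auto
  have "\<exists>t s' \<rho>' f'. exec (Cond (exb c) (compile p) (compile q)) s1 t s' \<and> t \<le> S ^ (max (texp p) (texp q) + 1) \<and> rel \<rho>' f' s' \<and> Q \<rho>' f'"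
  proof (cases "bv c \<rho> f")
    case True
    with HIf.prems have "wp p Q \<rho> f" by simp
    have "\<exists>t s' \<rho>' f'. exec (compile p) s1 t s' \<and> t \<le> S ^ texp p \<and> rel \<rho>' f' s' \<and> Q \<rho>' f'"
      by (rule HIf.IH(1)[OF \<open>wp p Q \<rho> f\<close> _ s1(3)]) (use HIf.prems disj in simp_all)
    then obtain t s' \<rho>' f' where
      *: "exec (compile p) s1 t s'" "t \<le> S ^ texp p" "rel \<rho>' f' s'" "Q \<rho>' f'" by blast
    have "Suc t \<le> S ^ texp p + S ^ 0" using * by simp
    also have "\<dots> \<le> S ^ Suc (max (texp p) (texp q))" by (rule pow_Suc_ge) (use HIf.prems in auto)
    finally show ?thesis using * True s1(4) CondTrue[of "exb c" s1 "compile p" t s' "compile q"] by auto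
  next
    case False
    with HIf.prems have "wp q Q \<rho> f" by simp
    have "\<exists>t s' \<rho>' f'. exec (compile q) s1 t s' \<and> t \<le> S ^ texp q \<and> rel \<rho>' f' s' \<and> Q \<rho>' f'"
      by (rule HIf.IH(2)[OF \<open>wp q Q \<rho> f\<close> _ s1(3)]) (use HIf.prems disj in simp_all)
    then obtain t s' \<rho>' f' where
      *: "exec (compile q) s1 t s'" "t \<le> S ^ texp q" "rel \<rho>' f' s'" "Q \<rho>' f'" by blast
    have "Suc t \<le> S ^ texp q + S ^ 0" using * by simp
    also have "\<dots> \<le> S ^ Suc (max (texp p) (texp q))" by (rule pow_Suc_ge) (use HIf.prems in auto)
    finally show ?thesis using * False s1(4) CondFalse[of "exb c" s1 "compile q" t s' "compile p"] by auto
  qed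
  then obtain t s' \<rho>' f' where *: "exec (Cond (exb c) (compile p) (compile q)) s1 t s'"
    "t \<le> S ^ (max (texp p) (texp q) + 1)" "rel \<rho>' f' s'" "Q \<rho>' f'" by blast
  have "exec (compile (HIf c p q)) s (u + t) s'" using exec.Seq[OF s1(1) *(1)] by simp
  moreover have "u + t \<le> S ^ texp (HIf c p q)"
    using pow_Suc_ge[of S "pexpb c" "max (pexpb c) (max (texp p) (texp q) + 1)" "max (texp p) (texp q) + 1"] s1 * HIf.prems
    by (simp del: max_Suc_Suc)
  ultimately show ?case using * by blast
next
  case (HFor r b c)
  let ?F = "\<lambda>P. wp c (\<lambda>\<rho> f. P (inc r \<rho>) f)"
  let ?J = "\<lambda>i s'. \<exists>\<rho>' f'. rel \<rho>' f' s' \<and> (\<forall>x. x \<notin> asg c \<longrightarrow> x \<noteq> r \<longrightarrow> \<rho>' x = \<rho> x) \<and> \<rho>' r = i \<and> (?F ^^ (\<rho> b - i)) Q \<rho>' f'"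
  have wf: "r < 100" "b < 100" "r \<noteq> 0" "r \<noteq> 1" "r \<notin> asg c" "b \<notin> asg c" "r \<noteq> b" "wf_com c" using HFor.prems(2) by auto
  have a: "1 \<notin> asg p" "0 \<notin> asg p" if "wf_com p" for p using that by (induction p) auto
  have "\<exists>t s'. exec (for_com r b (compile c)) s t s' \<and> t \<le> \<rho> b * (S ^ texp c + 2) + 2 \<and> ?J (\<rho> b) s'"
  proof (rule exec_for_com[where J = ?J])
    show "reg s b = \<rho> b" using HFor.prems(3) wf by (simp add: rel_def)
    show "?J 0 (s\<lparr>reg := (reg s)(r := 0)\<rparr>)"
      using HFor.prems(1,3) wf by (intro exI[of _ "\<rho>(r := 0)"] exI[of _ f]) (auto simp: rel_def)
  next
    fix i and s' :: state
    assume i: "i < \<rho> b" "reg s' r = i" "reg s' b = \<rho> b" "?J i s'"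
    then obtain \<rho>' f' where J: "rel \<rho>' f' s'" "\<forall>x. x \<notin> asg c \<longrightarrow> x \<noteq> r \<longrightarrow> \<rho>' x = \<rho> x" "\<rho>' r = i"
      "(?F ^^ (\<rho> b - i)) Q \<rho>' f'" by blast
    have "\<rho> b - i = Suc (\<rho> b - Suc i)" using i by simp
    with J(4) have "wp c (\<lambda>\<rho>'' f''. (?F ^^ (\<rho> b - Suc i)) Q (inc r \<rho>'') f'') \<rho>' f'" by simp
    note wpf = wp_frame[OF this]
    have bd: "\<rho>' x \<le> S" if "x \<in> bnds c" for x
    proof -
      have "x \<in> bnds (HFor r b c)" using that by simp
      then have "x \<notin> insert r (asg c)" using HFor.prems(7) by auto
      then show ?thesis using J(2) HFor.prems(6) that by auto
    qed
    have "\<exists>t s'' \<rho>'' f''. exec (compile c) s' t s'' \<and> t \<le> S ^ texp c \<and> rel \<rho>'' f'' s'' \<and>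
       ((?F ^^ (\<rho> b - Suc i)) Q (inc r \<rho>'') f'' \<and> (\<forall>x. x \<notin> asg c \<longrightarrow> \<rho>'' x = \<rho>' x) \<and>
       (\<forall>b i j. b \<notin> blk c \<longrightarrow> f'' (b, i, j) = f' (b, i, j)))"
      by (rule HFor.IH[OF wpf _ J(1)]) (use HFor.prems wf J(2) a[of c] bd in auto)
    then obtain t s'' \<rho>'' f'' where *: "exec (compile c) s' t s''" "t \<le> S ^ texp c" "rel \<rho>'' f'' s''"
       "(?F ^^ (\<rho> b - Suc i)) Q (inc r \<rho>'') f''" "\<forall>x. x \<notin> asg c \<longrightarrow> \<rho>'' x = \<rho>' x" by blast
    have "\<rho>'' r = i" "\<rho>'' b = \<rho> b" using *(5) J(2,3) wf by auto
    then have **: "reg s'' r = i" "reg s'' b = \<rho> b" using *(3) wf by (auto simp: rel_def)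
    have "?J (Suc i) (s''\<lparr>reg := (reg s'')(r := Suc i)\<rparr>)"
    proof (intro exI conjI)
      show "rel (\<rho>''(r := Suc i)) f'' (s''\<lparr>reg := (reg s'')(r := Suc i)\<rparr>)"
        using *(3) wf by (auto simp: rel_def)
    qed (use * J \<open>\<rho>'' r = i\<close> in \<open>auto simp: inc_def\<close>)
    then show "\<exists>t s''. exec (compile c) s' t s'' \<and> t \<le> S ^ texp c \<and> reg s'' r = i \<and> reg s'' b = \<rho> b \<and>
      ?J (Suc i) (s''\<lparr>reg := (reg s'')(r := Suc i)\<rparr>)" using * ** by blast
  qed (use wf in auto)
  then obtain t s' where *: "exec (for_com r b (compile c)) s t s'" "t \<le> \<rho> b * (S ^ texp c + 2) + 2" "?J (\<rho> b) s'"
    by blast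
  have "t \<le> S ^ (texp c + 5)"
    using loop_time[of S "\<rho> b" "S ^ texp c" "texp c"] *(2) HFor.prems by simp
  then show ?case using * by auto
qed

section \<open>Sums, row updates and moments\<close>

declare One_nat_def [simp del] wp.simps(6) [simp del]

lemma wp_SeqI: "wp p (wp q Q) \<rho> f \<Longrightarrow> wp (p ;; q) Q \<rho> f"
  by simp

lemma wp_use:
  assumes "wp c R \<rho> f"
    and "\<And>\<rho>' f'. R \<rho>' f' \<Longrightarrow> (\<And>x. x \<notin> asg c \<Longrightarrow> \<rho>' x = \<rho> x) \<Longrightarrow>
      (\<And>b i j. b \<notin> blk c \<Longrightarrow> f' (b, i, j) = f (b, i, j)) \<Longrightarrow> Q \<rho>' f'"
  shows "wp c Q \<rho> f"
  by (rule wp_mono[OF wp_frame[OF assms(1)]]) (use assms(2) in blast)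

lemma rv_cong:
  "(\<And>b i j. b \<in> hblks e \<Longrightarrow> f (b, i, j) = f' (b, i, j)) \<Longrightarrow> rv e \<rho> f = rv e \<rho> f'"
  by (induction e) auto

abbreviation sc :: "nat \<Rightarrow> hexp" where "sc b \<equiv> HL b (NConst 0) (NConst 0)"
abbreviation vc :: "nat \<Rightarrow> nat \<Rightarrow> hexp" where "vc b r \<equiv> HL b (NConst 0) (NReg r)"
abbreviation mt :: "nat \<Rightarrow> nat \<Rightarrow> nat \<Rightarrow> hexp" where "mt b i r \<equiv> HL b (NReg i) (NReg r)"
abbreviation set_sc :: "nat \<Rightarrow> hexp \<Rightarrow> hcom" where "set_sc b e \<equiv> HR b (NConst 0) (NConst 0) e"

definition sum_com :: "nat \<Rightarrow> nat \<Rightarrow> nat \<Rightarrow> hexp \<Rightarrow> hcom" where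
  "sum_com acc r b e = set_sc acc (HC 0) ;; HFor r b (set_sc acc (HBin Plus (sc acc) e))"

definition vec_com :: "nat \<Rightarrow> nexp \<Rightarrow> nat \<Rightarrow> hexp \<Rightarrow> hcom" where
  "vec_com b i r e = HFor r 1 (HR b i (NReg r) e)"

definition setrow :: "nat \<Rightarrow> nat \<Rightarrow> nat \<Rightarrow> (nat \<Rightarrow> real) \<Rightarrow> store \<Rightarrow> store" where
  "setrow b i d g f = (\<lambda>(b', i', j). if b' = b \<and> i' = i \<and> j < d then g j else f (b', i', j))"

lemma setrow_apply [simp]:
  "setrow b i d g f (b', i', j) = (if b' = b \<and> i' = i \<and> j < d then g j else f (b', i', j))"
  by (simp add: setrow_def)

lemma asg_sum_com [simp]: "asg (sum_com acc r b e) = {r}"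
  and blk_sum_com [simp]: "blk (sum_com acc r b e) = {acc}"
  and bnds_sum_com [simp]: "bnds (sum_com acc r b e) = {b}"
  and asg_vec_com [simp]: "asg (vec_com b' i r e) = {r}"
  and blk_vec_com [simp]: "blk (vec_com b' i r e) = {b'}"
  and bnds_vec_com [simp]: "bnds (vec_com b' i r e) = {1}"
  by (auto simp: sum_com_def vec_com_def)

lemma wf_sum_com [simp]: "wf_com (sum_com acc r b e) \<longleftrightarrow> r < 100 \<and> r \<noteq> 0 \<and> r \<noteq> 1 \<and> b < 100 \<and> r \<noteq> b \<and> hregs e \<subseteq> {..<100}"
  and wf_vec_com [simp]: "wf_com (vec_com b' i r e) \<longleftrightarrow> r < 100 \<and> r \<noteq> 0 \<and> r \<noteq> 1 \<and> nregs i \<union> hregs e \<subseteq> {..<100}"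
  by (auto simp: sum_com_def vec_com_def)

lemma wp_sum_com:
  assumes r: "r \<noteq> 0" "r \<noteq> 1" "r \<noteq> b" and acc: "acc \<notin> hblks e" and d: "\<rho> 1 > 0"
    and vd: "\<And>i. i < \<rho> b \<Longrightarrow> vd e (\<rho>(r := i))"
    and Q: "Q (\<rho>(r := \<rho> b)) (f((acc, 0, 0) := (\<Sum>i<\<rho> b. rv e (\<rho>(r := i)) f)))"
  shows "wp (sum_com acc r b e) Q \<rho> f"
  unfolding sum_com_def
proof (rule wp_SeqI)
  let ?I = "\<lambda>i \<rho>' f'. f' = f((acc, 0, 0) := (\<Sum>j<i. rv e (\<rho>(r := j)) f))"
  have "wp (HFor r b (set_sc acc (HBin Plus (sc acc) e))) Q \<rho> (f((acc, 0, 0) := 0))"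
  proof (rule wp_For[where I = ?I])
    fix i \<rho>' f' assume *: "i < \<rho> b" "\<rho>' r = i" "\<And>x. x \<notin> insert r (asg (set_sc acc (HBin Plus (sc acc) e))) \<Longrightarrow> \<rho>' x = \<rho> x"
      "?I i \<rho>' f'"
    then have eq: "\<rho>' = \<rho>(r := i)" by auto
    have "rv e \<rho>' f' = rv e \<rho>' f" by (rule rv_cong) (use acc * in auto)
    then show "wp (set_sc acc (HBin Plus (sc acc) e)) (\<lambda>\<rho>'' f''. ?I (Suc i) \<rho>'' f'') \<rho>' f'"
      using *(1,4) vd[of i] r d unfolding eq by (simp add: valid_def add.commute)
  next
    fix \<rho>' f' assume *: "\<rho>' r = \<rho> b" "\<And>x. x \<notin> insert r (asg (set_sc acc (HBin Plus (sc acc) e))) \<Longrightarrow> \<rho>' x = \<rho> x"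
       "?I (\<rho> b) \<rho>' f'"
    then have "\<rho>' = \<rho>(r := \<rho> b)" by auto
    then show "Q \<rho>' f'" using * Q by simp
  qed (use r in \<open>auto simp: fun_eq_iff\<close>)
  then show "wp (set_sc acc (HC 0)) (wp (HFor r b (set_sc acc (HBin Plus (sc acc) e))) Q) \<rho> f"
    using d by (simp add: valid_def)
qed

text \<open>The row is updated in place: when column \<open>j\<close> is written, the store differs
  from \<open>f\<close> only in block \<open>b\<close> at columns below \<open>j\<close>, and
  \<open>indep\<close> says that the expression does not see this difference.\<close>

lemma wp_vec_com:
  assumes r: "r \<noteq> 0" "r \<noteq> 1" "r \<notin> nregs i"
    and indep: "\<And>j g. j < \<rho> 1 \<Longrightarrow> (\<And>b' i' j'. b' \<noteq> b \<or> j \<le> j' \<Longrightarrow> g (b', i', j') = f (b', i', j')) \<Longrightarrow>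
       rv e (\<rho>(r := j)) g = rv e (\<rho>(r := j)) f"
    and vd: "nv i \<rho> < \<rho> 0 + \<rho> 1" "\<And>j. j < \<rho> 1 \<Longrightarrow> vd e (\<rho>(r := j))"
    and Q: "Q (\<rho>(r := \<rho> 1)) (setrow b (nv i \<rho>) (\<rho> 1) (\<lambda>j. rv e (\<rho>(r := j)) f) f)"
  shows "wp (vec_com b i r e) Q \<rho> f"
  unfolding vec_com_def
proof -
  let ?c = "HR b i (NReg r) e"
  let ?I = "\<lambda>l \<rho>' f'. f' = setrow b (nv i \<rho>) l (\<lambda>j. rv e (\<rho>(r := j)) f) f"
  show "wp (HFor r 1 ?c) Q \<rho> f"
  proof (rule wp_For[where I = ?I])
    fix l \<rho>' f' assume *: "l < \<rho> 1" "\<rho>' r = l" "\<And>x. x \<notin> insert r (asg ?c) \<Longrightarrow> \<rho>' x = \<rho> x"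
      "?I l \<rho>' f'"
    then have eq: "\<rho>' = \<rho>(r := l)" by auto
    have "nv i \<rho>' = nv i \<rho>" by (rule nv_cong) (use r eq in auto)
    moreover have "rv e (\<rho>(r := l)) f' = rv e (\<rho>(r := l)) f"
      by (rule indep) (use * in auto)
    ultimately show "wp ?c (\<lambda>\<rho>'' f''. ?I (Suc l) \<rho>'' f'') \<rho>' f'"
      using *(1) vd(1) vd(2)[of l] r unfolding eq *(4) by (auto simp: valid_def setrow_def fun_eq_iff less_Suc_eq)
  next
    fix \<rho>' f' assume *: "\<rho>' r = \<rho> 1" "\<And>x. x \<notin> insert r (asg ?c) \<Longrightarrow> \<rho>' x = \<rho> x"
       "?I (\<rho> 1) \<rho>' f'"
    then have "\<rho>' = \<rho>(r := \<rho> 1)" by auto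
    then show "Q \<rho>' f'" using * Q by simp
  qed (use r in \<open>auto simp: fun_eq_iff\<close>)
qed

section \<open>Inner products and the second-moment matrix\<close>

definition ip :: "nat \<Rightarrow> (nat \<Rightarrow> real) \<Rightarrow> (nat \<Rightarrow> real) \<Rightarrow> real" where
  "ip d x y = (\<Sum>j<d. x j * y j)"

definition quad :: "nat \<Rightarrow> nat \<Rightarrow> (nat \<Rightarrow> nat \<Rightarrow> real) \<Rightarrow> (nat \<Rightarrow> real) \<Rightarrow> real" where
  "quad n d Z x = (\<Sum>i<n. (ip d (Z i) x)\<^sup>2)"

text \<open>The product of \<open>x\<close> with the matrix A that is the sum of z z^T over the rows
  z of \<open>Z\<close>; the matrix itself is never formed. \<open>quad\<close> is the quadratic
  form of A.\<close>

definition cov :: "nat \<Rightarrow> nat \<Rightarrow> (nat \<Rightarrow> nat \<Rightarrow> real) \<Rightarrow> (nat \<Rightarrow> real) \<Rightarrow> nat \<Rightarrow> real" where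
  "cov n d Z x = (\<lambda>j. \<Sum>i<n. ip d (Z i) x * Z i j)"

definition srow :: "store \<Rightarrow> nat \<Rightarrow> nat \<Rightarrow> nat \<Rightarrow> real" where
  "srow f b i = (\<lambda>j. f (b, i, j))"

lemma ip_cong: "(\<And>j. j < d \<Longrightarrow> x j = x' j) \<Longrightarrow> (\<And>j. j < d \<Longrightarrow> y j = y' j) \<Longrightarrow> ip d x y = ip d x' y'"
  by (simp add: ip_def)

lemma srow_apply [simp]: "srow f b i j = f (b, i, j)" by (simp add: srow_def)

text \<open>
  The blocks: \<open>0\<close> points, \<open>1\<close> centred and deflated points, \<open>2\<close> directions, \<open>3\<close> grid digits, \<open>4\<close> iterate
  of the power method, \<open>6\<close> best direction so far and \<open>11\<close> its Rayleigh quotient, \<open>7\<close> grid centre,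
  \<open>8\<close> best centre so far and \<open>16\<close> its squared radius, valid if \<open>19\<close> is positive, \<open>9\<close> the number of
  points to be covered, \<open>13\<close> the grid resolution \<open>k\<^sup>2\<close>, \<open>24\<close> the distance \<open>r\<close>; the others are
  temporary. Register \<open>3\<close> holds \<open>k\<close>.
\<close>

definition cov_com :: hcom where
  "cov_com =
    vec_com 5 (NConst 0) 9 (HC 0) ;;
    HFor 9 0
      (sum_com 10 10 1 (HBin Times (mt 1 9 10) (vc 4 10)) ;;
       vec_com 5 (NConst 0) 10 (HBin Plus (vc 5 10) (HBin Times (sc 10) (mt 1 9 10)))) ;;
    vec_com 4 (NConst 0) 9 (vc 5 9)"

lemma wp_cov_com:
  assumes d: "\<rho> 1 > 0"
  shows "wp cov_com (\<lambda>\<rho>' f'. \<forall>j<\<rho> 1. f' (4, 0, j) = cov (\<rho> 0) (\<rho> 1) (srow f 1) (srow f 4 0) j) \<rho> f"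
  unfolding cov_com_def
  apply (rule wp_SeqI)+
  apply (rule wp_vec_com; (simp add: d)?)
  apply (rule wp_For[where I = "\<lambda>i \<rho>' f'. \<forall>j<\<rho> 1. f' (5, 0, j) = (\<Sum>i<i. ip (\<rho> 1) (srow f 1 i) (srow f 4 0) * f (1, i, j))"];
    (simp; fail)?)
  subgoal for i \<rho>' f'
    apply (rule wp_SeqI)?
    apply (rule wp_sum_com; (simp add: d valid_def)?)
    apply (rule wp_vec_com; (simp add: d valid_def)?)
    apply (simp add: ip_def)
    done
  subgoal for \<rho>' f'
    apply (rule wp_vec_com; (simp add: d valid_def)?)
    apply (simp add: cov_def)
    done
  done

section \<open>Approximate eigenvectors\<close>

lemma cov_cong: "(\<And>i j. i < n \<Longrightarrow> j < d \<Longrightarrow> Z i j = Z' i j) \<Longrightarrow> (\<And>j. j < d \<Longrightarrow> x j = x' j) \<Longrightarrow> l < d \<Longrightarrow>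
  cov n d Z x l = cov n d Z' x' l"
  unfolding cov_def by (intro sum.cong refl arg_cong2[where f = "(*)"] ip_cong) auto

lemma quad_cong: "(\<And>i j. i < n \<Longrightarrow> j < d \<Longrightarrow> Z i j = Z' i j) \<Longrightarrow> (\<And>j. j < d \<Longrightarrow> x j = x' j) \<Longrightarrow>
  quad n d Z x = quad n d Z' x'"
  unfolding quad_def by (intro sum.cong refl arg_cong[where f = "\<lambda>x. x\<^sup>2"] ip_cong) auto

definition unit :: "nat \<Rightarrow> nat \<Rightarrow> real" where
  "unit j0 = (\<lambda>j. if j = j0 then 1 else 0)"

definition pw :: "nat \<Rightarrow> nat \<Rightarrow> (nat \<Rightarrow> nat \<Rightarrow> real) \<Rightarrow> nat \<Rightarrow> nat \<Rightarrow> real" where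
  "pw n d Z j0 = (cov n d Z ^^ d) (unit j0)"

definition pw_com :: hcom where
  "pw_com = vec_com 4 (NConst 0) 8 (HC 0) ;; HR 4 (NConst 0) (NReg 7) (HC 1) ;; HFor 8 1 cov_com"

lemma asg_cov_com: "asg cov_com = {9, 10}" and blk_cov_com: "blk cov_com = {4, 5, 10}"
  by (auto simp: cov_com_def)

lemma asg_pw_com: "asg pw_com = {8, 9, 10}" and blk_pw_com: "blk pw_com = {4, 5, 10}"
  by (auto simp: pw_com_def asg_cov_com blk_cov_com)

lemma wp_pw_com:
  assumes d: "\<rho> 7 < \<rho> 1"
  shows "wp pw_com (\<lambda>\<rho>' f'. \<forall>j<\<rho> 1. f' (4, 0, j) = pw (\<rho> 0) (\<rho> 1) (srow f 1) (\<rho> 7) j) \<rho> f"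
  unfolding pw_com_def
  apply (rule wp_SeqI)+
  apply (rule wp_vec_com; (simp add: d valid_def)?)
  using d apply simp
  using d apply (simp add: valid_def)
  apply (rule wp_For[where I = "\<lambda>i \<rho>' f'. \<forall>j<\<rho> 1. f' (4, 0, j) = (cov (\<rho> 0) (\<rho> 1) (srow f 1) ^^ i) (unit (\<rho> 7)) j"];
    (simp add: asg_cov_com blk_cov_com unit_def; fail)?)
  subgoal for i \<rho>' f'
    apply (rule wp_use[OF wp_cov_com])
     apply (simp add: asg_cov_com blk_cov_com)
    apply (simp add: asg_cov_com blk_cov_com)
    apply (intro allI impI cov_cong)
      apply auto
    done
  subgoal for \<rho>' f'
    by (simp add: pw_def)
  done

definition quot_com :: hcom where
  "quot_com = sum_com 14 8 1 (HBin Times (vc 4 8) (vc 4 8)) ;;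
    set_sc 15 (HC 0) ;;
    HFor 8 0 (sum_com 10 9 1 (HBin Times (mt 1 8 9) (vc 4 9)) ;;
      set_sc 15 (HBin Plus (sc 15) (HBin Times (sc 10) (sc 10)))) ;;
    set_sc 15 (HBin Divide (sc 15) (sc 14))"

lemma asg_quot_com: "asg quot_com = {8, 9}" and blk_quot_com: "blk quot_com = {10, 14, 15}"
  by (auto simp: quot_com_def)

lemma wp_quot_com:
  fixes f :: store
  assumes d: "\<rho> 1 > 0"
  defines "x \<equiv> srow f 4 0"
  shows "wp quot_com (\<lambda>\<rho>' f'. f' (14, 0, 0) = ip (\<rho> 1) x x \<and>
     f' (15, 0, 0) = quad (\<rho> 0) (\<rho> 1) (srow f 1) x / ip (\<rho> 1) x x) \<rho> f"
  unfolding quot_com_def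
  apply (rule wp_SeqI)+
  apply (rule wp_sum_com; (simp add: d valid_def)?)
  apply (rule wp_For[where I = "\<lambda>i \<rho>' f'. f' (14, 0, 0) = ip (\<rho> 1) x x \<and> f' (15, 0, 0) = (\<Sum>i<i. (ip (\<rho> 1) (srow f 1 i) x)\<^sup>2)"];
    (simp add: x_def ip_def; fail)?)
  subgoal for i \<rho>' f'
    apply (rule wp_SeqI)?
    apply (rule wp_sum_com; (simp add: d valid_def)?)
    apply (simp add: ip_def x_def power2_eq_square)
    done
  subgoal for \<rho>' f'
    by (simp add: valid_def d quad_def)
  done

definition upd_com :: hcom where
  "upd_com = HIf (HRLess (sc 11) (sc 15))
     (set_sc 11 (sc 15) ;; set_sc 14 (HSqrt (sc 14)) ;; vec_com 6 (NConst 0) 8 (HBin Divide (vc 4 8) (sc 14)))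
     HSkip"

lemma asg_upd_com: "asg upd_com = {8}" and blk_upd_com: "blk upd_com = {6, 11, 14}"
  by (auto simp: upd_com_def)

lemma wp_upd_com:
  assumes d: "\<rho> 1 > 0"
  shows "wp upd_com (\<lambda>\<rho>' f'. if f (11, 0, 0) < f (15, 0, 0)
     then f' (11, 0, 0) = f (15, 0, 0) \<and> (\<forall>j<\<rho> 1. f' (6, 0, j) = f (4, 0, j) / sqrt (f (14, 0, 0)))
     else f' = f) \<rho> f"
  unfolding upd_com_def
  apply (simp add: valid_def d)
  apply (intro impI)
  apply (rule wp_vec_com; (simp add: d valid_def)?)
  done

definition find_com :: hcom where
  "find_com = set_sc 11 (HC 0) ;; vec_com 6 (NConst 0) 7 (HC 0) ;; HFor 7 1 (pw_com ;; quot_com ;; upd_com)"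

text \<open>\<open>\<beta>\<close> is the largest Rayleigh quotient among the first \<open>l\<close>
  power iterates and \<open>b\<close> the normalised maximiser. The comparison is written without
  division so that it covers zero iterates; if no quotient is positive, \<open>b\<close> is the zero
  vector.\<close>

definition best_dir :: "nat \<Rightarrow> nat \<Rightarrow> (nat \<Rightarrow> nat \<Rightarrow> real) \<Rightarrow> nat \<Rightarrow> (nat \<Rightarrow> real) \<Rightarrow> real \<Rightarrow> bool" where
  "best_dir n d Z l b \<beta> \<longleftrightarrow> 0 \<le> \<beta> \<and>
    (\<forall>j<l. quad n d Z (pw n d Z j) \<le> \<beta> * ip d (pw n d Z j) (pw n d Z j)) \<and>
    (\<beta> = 0 \<and> (\<forall>j<d. b j = 0) \<or>
     (\<exists>j0. let x = pw n d Z j0 in ip d x x > 0 \<and> \<beta> = quad n d Z x / ip d x x \<and> (\<forall>j<d. b j = x j / sqrt (ip d x x))))"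

lemma ip_nonneg: "0 \<le> ip d x x"
  by (auto simp: ip_def intro!: sum_nonneg)

lemma ip_eq_0: "ip d x x = 0 \<Longrightarrow> j < d \<Longrightarrow> x j = 0"
  unfolding ip_def by (subst (asm) sum_nonneg_eq_0_iff) auto

lemma quad_eq_0: "ip d x x = 0 \<Longrightarrow> quad n d Z x = 0"
  using ip_eq_0[of d x] by (simp add: quad_def ip_def)

lemma best_dir_step:
  assumes "best_dir n d Z l b \<beta>"
  defines "x \<equiv> pw n d Z l"
  shows "best_dir n d Z (Suc l) (if \<beta> < quad n d Z x / ip d x x then (\<lambda>j. x j / sqrt (ip d x x)) else b)
     (if \<beta> < quad n d Z x / ip d x x then quad n d Z x / ip d x x else \<beta>)"
proof (cases "\<beta> < quad n d Z x / ip d x x")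
  case True
  \<comment> \<open>Division by zero gives \<open>0\<close>, so a zero iterate has quotient
    \<open>0\<close> and cannot exceed \<open>\<beta> \<ge> 0\<close>.\<close>
  with assms(1) have "ip d x x \<noteq> 0" by (auto simp: best_dir_def)
  with ip_nonneg[of d x] have pos: "ip d x x > 0" by linarith
  have "quad n d Z (pw n d Z j) \<le> quad n d Z x / ip d x x * ip d (pw n d Z j) (pw n d Z j)" if "j < Suc l" for j
  proof (cases "j = l")
    case True then show ?thesis using pos by (simp add: x_def)
  next
    case False
    then have "quad n d Z (pw n d Z j) \<le> \<beta> * ip d (pw n d Z j) (pw n d Z j)"
      using assms(1) that by (auto simp: best_dir_def)
    also have "\<dots> \<le> quad n d Z x / ip d x x * ip d (pw n d Z j) (pw n d Z j)"
      using True by (intro mult_right_mono ip_nonneg) simp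
    finally show ?thesis .
  qed
  then show ?thesis using True pos assms(1) unfolding best_dir_def Let_def x_def by auto
next
  case False
  have "quad n d Z x \<le> \<beta> * ip d x x"
  proof (cases "ip d x x = 0")
    case True then show ?thesis using quad_eq_0[of d x n Z] by simp
  next
    case False': False
    with ip_nonneg[of d x] have pos: "ip d x x > 0" by linarith
    then show ?thesis using False by (simp add: not_less divide_le_eq)
  qed
  then show ?thesis using False assms(1) by (auto simp: best_dir_def x_def less_Suc_eq)
qed

lemma ip_unit: "j0 < d \<Longrightarrow> ip d (unit j0) y = y j0"
  unfolding ip_def unit_def by (simp add: if_distrib[of "\<lambda>x. x * _"] cong: if_cong)

lemma cov_pow_cong:
  assumes "\<And>i j. i < n \<Longrightarrow> j < d \<Longrightarrow> Z i j = Z' i j"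
  shows "j < d \<Longrightarrow> (cov n d Z ^^ m) x j = (cov n d Z' ^^ m) x j"
proof (induction m arbitrary: j)
  case (Suc m)
  then show ?case by (simp, intro cov_cong) (use assms in auto)
qed simp

lemma best_dir_cong:
  assumes Z: "\<And>i j. i < n \<Longrightarrow> j < d \<Longrightarrow> Z i j = Z' i j" and b: "\<And>j. j < d \<Longrightarrow> b j = b' j" and "best_dir n d Z l b \<beta>"
  shows "best_dir n d Z' l b' \<beta>"
proof -
  have pw: "pw n d Z j0 j = pw n d Z' j0 j" if "j < d" for j0 j
    unfolding pw_def using Z that by (rule cov_pow_cong)
  have "ip d (pw n d Z j) (pw n d Z j) = ip d (pw n d Z' j) (pw n d Z' j)" for j
    by (intro ip_cong pw)
  moreover have "quad n d Z (pw n d Z j) = quad n d Z' (pw n d Z' j)" for j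
    by (intro quad_cong pw Z)
  ultimately show ?thesis using assms(3) b pw unfolding best_dir_def Let_def by simp
qed

lemma asg_find_com: "asg find_com = {7, 8, 9, 10}" and blk_find_com: "blk find_com = {4, 5, 6, 10, 11, 14, 15}"
  by (auto simp: find_com_def asg_pw_com asg_quot_com asg_upd_com blk_pw_com blk_quot_com blk_upd_com)

lemma wp_find_com:
  assumes d: "\<rho> 1 > 0"
  shows "wp find_com (\<lambda>\<rho>' f'. best_dir (\<rho> 0) (\<rho> 1) (srow f 1) (\<rho> 1) (srow f' 6 0) (f' (11, 0, 0))) \<rho> f"
proof -
  let ?c = "pw_com ;; quot_com ;; upd_com"
  let ?n = "\<rho> 0" and ?d = "\<rho> 1" and ?Z = "srow f 1"
  note fr = asg_pw_com asg_quot_com asg_upd_com blk_pw_com blk_quot_com blk_upd_com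
  let ?f = "setrow 6 0 (\<rho> 1) (\<lambda>j. 0) (f((11, 0, 0) := 0))"
  have "wp (HFor 7 1 ?c) (\<lambda>\<rho>' f'. best_dir ?n ?d ?Z ?d (srow f' 6 0) (f' (11, 0, 0))) (\<rho>(7 := ?d)) ?f"
  proof (rule wp_For[where I = "\<lambda>l \<rho>' f'. best_dir ?n ?d ?Z l (srow f' 6 0) (f' (11, 0, 0))"])
    fix l \<rho>' f'
    assume l: "l < (\<rho>(7 := ?d)) 1" "\<rho>' 7 = l" and \<rho>': "\<And>x. x \<notin> insert 7 (asg ?c) \<Longrightarrow> \<rho>' x = (\<rho>(7 := ?d)) x"
      and f': "\<And>b i j. b \<notin> blk ?c \<Longrightarrow> f' (b, i, j) = ?f (b, i, j)"
      and I: "best_dir ?n ?d ?Z l (srow f' 6 0) (f' (11, 0, 0))"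
    have r: "\<rho>' 0 = ?n" "\<rho>' 1 = ?d" using \<rho>' by (auto simp: fr)
    have Z: "srow f' 1 = ?Z" using f' by (auto simp: fr fun_eq_iff)
    let ?x = "pw ?n ?d ?Z l"
    show "wp ?c (\<lambda>\<rho>'' f''. best_dir ?n ?d ?Z (Suc l) (srow f'' 6 0) (f'' (11, 0, 0))) \<rho>' f'"
    proof (rule wp_SeqI, rule wp_use[OF wp_pw_com])
      show "\<rho>' 7 < \<rho>' 1" using l r by simp
      fix \<rho>1 f1 assume 1: "\<forall>j<\<rho>' 1. f1 (4, 0, j) = pw (\<rho>' 0) (\<rho>' 1) (srow f' 1) (\<rho>' 7) j"
        and r1: "\<And>x. x \<notin> asg pw_com \<Longrightarrow> \<rho>1 x = \<rho>' x" and f1: "\<And>b i j. b \<notin> blk pw_com \<Longrightarrow> f1 (b, i, j) = f' (b, i, j)"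
      have r1': "\<rho>1 0 = ?n" "\<rho>1 1 = ?d" using r1 r by (auto simp: fr)
      have Z1: "srow f1 1 = ?Z" using f1 Z by (auto simp: fr fun_eq_iff)
      have x: "srow f1 4 0 j = ?x j" if "j < ?d" for j using 1 r Z l that by simp
      have q: "ip ?d (srow f1 4 0) (srow f1 4 0) = ip ?d ?x ?x" "quad ?n ?d ?Z (srow f1 4 0) = quad ?n ?d ?Z ?x"
        by (intro ip_cong x quad_cong refl; assumption)+
      show "wp (quot_com ;; upd_com) (\<lambda>\<rho>'' f''. best_dir ?n ?d ?Z (Suc l) (srow f'' 6 0) (f'' (11, 0, 0))) \<rho>1 f1"
      proof (rule wp_SeqI, rule wp_use[OF wp_quot_com])
        show "\<rho>1 1 > 0" using r1' d by simp
        fix \<rho>2 f2 assume 2: "f2 (14, 0, 0) = ip (\<rho>1 1) (srow f1 4 0) (srow f1 4 0) \<and>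
            f2 (15, 0, 0) = quad (\<rho>1 0) (\<rho>1 1) (srow f1 1) (srow f1 4 0) / ip (\<rho>1 1) (srow f1 4 0) (srow f1 4 0)"
          and r2: "\<And>x. x \<notin> asg quot_com \<Longrightarrow> \<rho>2 x = \<rho>1 x" and f2: "\<And>b i j. b \<notin> blk quot_com \<Longrightarrow> f2 (b, i, j) = f1 (b, i, j)"
        have r2': "\<rho>2 0 = ?n" "\<rho>2 1 = ?d" using r2 r1' by (auto simp: fr)
        have f2': "f2 (14, 0, 0) = ip ?d ?x ?x" "f2 (15, 0, 0) = quad ?n ?d ?Z ?x / ip ?d ?x ?x"
          "f2 (11, 0, 0) = f' (11, 0, 0)" "\<And>j. f2 (4, 0, j) = f1 (4, 0, j)" "\<And>j. f2 (6, 0, j) = f' (6, 0, j)"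
          using 2 r1' Z1 q f2 f1 by (auto simp: fr)
        show "wp upd_com (\<lambda>\<rho>'' f''. best_dir ?n ?d ?Z (Suc l) (srow f'' 6 0) (f'' (11, 0, 0))) \<rho>2 f2"
        proof (rule wp_use[OF wp_upd_com])
          show "\<rho>2 1 > 0" using r2' d by simp
          fix \<rho>3 f3 assume 3: "if f2 (11, 0, 0) < f2 (15, 0, 0)
             then f3 (11, 0, 0) = f2 (15, 0, 0) \<and> (\<forall>j<\<rho>2 1. f3 (6, 0, j) = f2 (4, 0, j) / sqrt (f2 (14, 0, 0)))
             else f3 = f2"
          show "best_dir ?n ?d ?Z (Suc l) (srow f3 6 0) (f3 (11, 0, 0))"
          proof (cases "f' (11, 0, 0) < quad ?n ?d ?Z ?x / ip ?d ?x ?x")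
            case True
            with 3 f2' have e: "f3 (11, 0, 0) = quad ?n ?d ?Z ?x / ip ?d ?x ?x"
              "\<forall>j<?d. f3 (6, 0, j) = f2 (4, 0, j) / sqrt (ip ?d ?x ?x)" using r2' by auto
            have "best_dir ?n ?d ?Z (Suc l) (\<lambda>j. ?x j / sqrt (ip ?d ?x ?x)) (quad ?n ?d ?Z ?x / ip ?d ?x ?x)"
              using best_dir_step[OF I] True by simp
            then show ?thesis unfolding e(1)
              by (rule best_dir_cong[rotated 2]) (use e(2) f2'(4) x in auto)
          next
            case False
            with 3 f2' have "f3 = f2" by auto
            moreover have "srow f2 6 0 = srow f' 6 0" using f2'(5) by (simp add: fun_eq_iff)
            ultimately show ?thesis using best_dir_step[OF I] False f2'(3) by simp
          qed
        qed
      qed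
    qed
  qed (use d in \<open>auto simp: fr best_dir_def\<close>)
  then show ?thesis unfolding find_com_def
    apply (intro wp_SeqI)
    apply (simp add: valid_def d)
    apply (rule wp_vec_com; simp add: valid_def d)
    done
qed

section \<open>Moments of the second-moment matrix and power iteration\<close>

lemma ip_commute: "ip d x y = ip d y x"
  by (simp add: ip_def mult.commute)

lemma ip_Cauchy: "(ip d x y)\<^sup>2 \<le> ip d x x * ip d y y"
  using Cauchy_Schwarz_ineq_sum[of x y "{..<d}"] by (simp add: ip_def power2_eq_square)

lemma ip_scale_left: "ip d (\<lambda>j. x j / c) y = ip d x y / c"
  by (simp add: ip_def sum_divide_distrib)

lemma ip_diff_scale_left: "ip d (\<lambda>j. x j - c * z j) y = ip d x y - c * ip d z y"
  by (simp add: ip_def sum_subtractf sum_distrib_left algebra_simps)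

lemma ip_cov: "ip d (cov n d Z x) y = (\<Sum>i<n. ip d (Z i) x * ip d (Z i) y)"
proof -
  have "ip d (cov n d Z x) y = (\<Sum>j<d. \<Sum>i<n. ip d (Z i) x * Z i j * y j)"
    unfolding ip_def[of d "cov n d Z x"] unfolding cov_def by (simp add: sum_distrib_right)
  also have "\<dots> = (\<Sum>i<n. \<Sum>j<d. ip d (Z i) x * Z i j * y j)" by (rule sum.swap)
  also have "\<dots> = (\<Sum>i<n. ip d (Z i) x * ip d (Z i) y)"
    by (simp add: ip_def[of d _ y] sum_distrib_left mult.assoc)
  finally show ?thesis .
qed

lemma ip_cov_self: "ip d (cov n d Z x) x = quad n d Z x"
  by (simp add: ip_cov quad_def power2_eq_square)

lemma ip_cov_swap: "ip d (cov n d Z x) y = ip d x (cov n d Z y)"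
  by (subst ip_commute[of d x]) (simp add: ip_cov mult.commute)

lemma ip_cov_pow_swap: "ip d ((cov n d Z ^^ m) x) y = ip d x ((cov n d Z ^^ m) y)"
proof (induction m arbitrary: y)
  case (Suc m)
  have "ip d ((cov n d Z ^^ Suc m) x) y = ip d ((cov n d Z ^^ m) x) (cov n d Z y)"
    by (simp add: ip_cov_swap)
  also have "\<dots> = ip d x ((cov n d Z ^^ m) (cov n d Z y))" by (rule Suc.IH)
  finally show ?case by (simp only: funpow_Suc_right o_apply)
qed simp

definition moment :: "nat \<Rightarrow> nat \<Rightarrow> (nat \<Rightarrow> nat \<Rightarrow> real) \<Rightarrow> (nat \<Rightarrow> real) \<Rightarrow> nat \<Rightarrow> real" where
  "moment n d Z x r = ip d x ((cov n d Z ^^ r) x)"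

lemma moment_add: "ip d ((cov n d Z ^^ a) x) ((cov n d Z ^^ b) x) = moment n d Z x (a + b)"
  by (simp add: moment_def ip_cov_pow_swap funpow_add)

lemma moment_even: "moment n d Z x (2 * a) = ip d ((cov n d Z ^^ a) x) ((cov n d Z ^^ a) x)"
  by (simp add: moment_add mult_2)

lemma moment_odd: "moment n d Z x (2 * a + 1) = quad n d Z ((cov n d Z ^^ a) x)"
  using moment_add[where a = "Suc a" and b = a and x = x and d = d and n = n and Z = Z]
    ip_cov_self[of d n Z "(cov n d Z ^^ a) x"] by (simp add: mult_2 One_nat_def)

lemma moment_nonneg: "0 \<le> moment n d Z x r"
proof (cases "even r")
  case True
  then show ?thesis by (auto elim!: evenE simp: moment_even ip_nonneg)
next
  case False
  then show ?thesis by (auto elim!: oddE simp: moment_odd quad_def sum_nonneg)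
qed

text \<open>Cauchy-Schwarz twice: for even \<open>r\<close> in the standard inner product, for odd
  \<open>r\<close> in the semidefinite one given by the matrix.\<close>

lemma moment_log_convex: "(moment n d Z x (Suc r))\<^sup>2 \<le> moment n d Z x r * moment n d Z x (Suc (Suc r))"
proof (cases "even r")
  case True
  then obtain a where r: "r = 2 * a" by (elim evenE)
  have "moment n d Z x (Suc r) = ip d ((cov n d Z ^^ a) x) ((cov n d Z ^^ Suc a) x)"
    unfolding moment_add r by (simp add: mult_2)
  moreover have "moment n d Z x (Suc (Suc r)) = ip d ((cov n d Z ^^ Suc a) x) ((cov n d Z ^^ Suc a) x)"
    unfolding moment_add r by (simp add: mult_2)
  ultimately show ?thesis unfolding r moment_even using ip_Cauchy by metis
next
  case False
  then obtain a where r: "r = 2 * a + 1" by (elim oddE)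
  let ?u = "(cov n d Z ^^ a) x" and ?v = "(cov n d Z ^^ Suc a) x"
  have "moment n d Z x (Suc r) = ip d (cov n d Z ?u) ?v"
    using moment_add[where a = "Suc a" and b = "Suc a" and x = x and d = d and n = n and Z = Z] by (simp add: r mult_2 One_nat_def)
  then have 1: "moment n d Z x (Suc r) = (\<Sum>i<n. ip d (Z i) ?u * ip d (Z i) ?v)" by (simp only: ip_cov)
  have 2: "moment n d Z x (Suc (Suc r)) = quad n d Z ?v"
    using moment_odd[of n d Z x "Suc a"] by (simp add: r One_nat_def)
  show ?thesis unfolding 1 2 unfolding r moment_odd quad_def
    by (rule Cauchy_Schwarz_ineq_sum)
qed

text \<open>By log-convexity the ratios of consecutive moments are nondecreasing, so a bound on a
  late ratio bounds all earlier ones.\<close>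

lemma moment_ratio_down:
  assumes "\<beta> \<ge> 0" "moment n d Z x (Suc q) \<le> \<beta> * moment n d Z x q" "s \<le> q"
  shows "moment n d Z x (Suc s) \<le> \<beta> * moment n d Z x s"
  using assms(3)
proof (induction s rule: inc_induct)
  case (step s)
  let ?m = "moment n d Z x"
  show ?case
  proof (cases "?m (Suc s) = 0")
    case True
    then show ?thesis using assms(1) moment_nonneg by simp
  next
    case False
    with moment_nonneg have pos: "?m (Suc s) > 0" by (metis less_eq_real_def)
    have "?m (Suc s) * ?m (Suc s) \<le> ?m s * ?m (Suc (Suc s))"
      using moment_log_convex[of n d Z x s] by (simp add: power2_eq_square)
    also have "\<dots> \<le> ?m s * (\<beta> * ?m (Suc s))"
      using step.IH moment_nonneg by (intro mult_left_mono)
    finally have "?m (Suc s) * ?m (Suc s) \<le> (\<beta> * ?m s) * ?m (Suc s)" by (simp add: mult_ac)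
    then show ?thesis using pos by (rule mult_right_le_imp_le)
  qed
qed (use assms in simp)

lemma moment_le_power:
  assumes "\<beta> \<ge> 0" "moment n d Z x (Suc q) \<le> \<beta> * moment n d Z x q" "s \<le> Suc q"
  shows "moment n d Z x s \<le> \<beta> ^ s * moment n d Z x 0"
  using assms(3)
proof (induction s)
  case (Suc s)
  have "moment n d Z x (Suc s) \<le> \<beta> * moment n d Z x s"
    by (rule moment_ratio_down[OF assms(1,2)]) (use Suc.prems in simp)
  also have "\<dots> \<le> \<beta> * (\<beta> ^ s * moment n d Z x 0)"
    using Suc assms(1) by (intro mult_left_mono) auto
  finally show ?case by (simp add: mult_ac)
qed simp

text \<open>The same monotonicity upwards: all ratios are at least the first one, the Rayleigh
  quotient \<open>\<kappa>\<close>. Positivity is carried along to allow cancelling.\<close>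

lemma moment_ge_power:
  assumes "\<kappa> > 0" "moment n d Z x 1 = \<kappa> * moment n d Z x 0" "moment n d Z x 0 > 0"
  shows "moment n d Z x s > 0 \<and> moment n d Z x (Suc s) \<ge> \<kappa> * moment n d Z x s
     \<and> moment n d Z x s \<ge> \<kappa> ^ s * moment n d Z x 0"
proof (induction s)
  case 0
  then show ?case using assms by (simp add: One_nat_def)
next
  case (Suc s)
  let ?m = "moment n d Z x"
  have pos: "?m (Suc s) > 0" using Suc assms(1) by (meson less_le_trans mult_pos_pos)
  have "?m s * (\<kappa> * ?m (Suc s)) \<le> ?m (Suc s) * ?m (Suc s)"
    using Suc pos by (simp add: mult_right_mono mult.assoc[symmetric] mult.commute[of "?m s"])
  also have "\<dots> \<le> ?m s * ?m (Suc (Suc s))"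
    using moment_log_convex[of n d Z x s] by (simp add: power2_eq_square)
  finally have "\<kappa> * ?m (Suc s) \<le> ?m (Suc (Suc s))" using Suc by (simp add: mult_le_cancel_left_pos)
  moreover have "\<kappa> ^ Suc s * ?m 0 \<le> \<kappa> * ?m s"
    using Suc assms(1) by (simp add: mult.assoc)
  ultimately show ?case using pos Suc by linarith
qed

text \<open>
  Power iteration from all unit vectors, \<open>d\<close> steps each. Moments are log-convex, so the hypothesis
  bounds the \<open>2 * d\<close>-th moment of a unit vector by \<open>\<beta> ^ (2 * d)\<close>; a direction violating the
  conclusion would have its own \<open>2 * d\<close>-th moment too large, as \<open>d < 4 ^ d\<close>.
\<close>

lemma power_iteration:
  assumes \<beta>: "\<beta> \<ge> 0" and d: "d > 0"
    and pw: "\<And>j. j < d \<Longrightarrow> quad n d Z (pw n d Z j) \<le> \<beta> * ip d (pw n d Z j) (pw n d Z j)"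
  shows "quad n d Z w \<le> 2 * \<beta> * ip d w w"
proof (rule ccontr)
  assume neg: "\<not> ?thesis"
  let ?m = "moment n d Z w" and ?A = "cov n d Z"
  have m: "?m 0 = ip d w w" "?m 1 = quad n d Z w"
    using moment_odd[of n d Z w 0] by (simp_all add: moment_def)
  have "ip d w w \<noteq> 0" using neg quad_eq_0[of d w n Z] by auto
  with ip_nonneg[of d w] have w: "ip d w w > 0" by linarith
  define \<kappa> where "\<kappa> = quad n d Z w / ip d w w"
  have \<kappa>: "\<kappa> > 2 * \<beta>" using neg w by (simp add: \<kappa>_def field_simps)
  then have "\<kappa> > 0" using \<beta> by linarith
  moreover have "?m 1 = \<kappa> * ?m 0" using w by (simp add: m \<kappa>_def)
  ultimately have lower: "\<kappa> ^ (2 * d) * ip d w w \<le> ?m (2 * d)"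
    using moment_ge_power[of \<kappa> n d Z w "2 * d"] w m(1) by simp
  have upper: "?m (2 * d) \<le> real d * (\<beta> ^ (2 * d) * ip d w w)"
  proof -
    have "?m (2 * d) = (\<Sum>j<d. ((?A ^^ d) w j)\<^sup>2)"
      by (simp add: moment_even ip_def power2_eq_square)
    also have "\<dots> \<le> (\<Sum>j<d. \<beta> ^ (2 * d) * ip d w w)"
    proof (rule sum_mono)
      fix j assume "j \<in> {..<d}"
      then have j: "j < d" by simp
      let ?x = "pw n d Z j"
      \<comment> \<open>Symmetry of the matrix moves its \<open>d\<close> applications from
        \<open>w\<close> to the unit vector, so that a coordinate of the unknown vector is
        controlled by an iterate that has been computed.\<close>
      have "(?A ^^ d) w j = ip d (unit j) ((?A ^^ d) w)" using j by (simp add: ip_unit)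
      also have "\<dots> = ip d ?x w" by (simp add: pw_def ip_cov_pow_swap)
      finally have "((?A ^^ d) w j)\<^sup>2 \<le> ip d ?x ?x * ip d w w" using ip_Cauchy by simp
      also have "ip d ?x ?x = moment n d Z (unit j) (2 * d)" by (simp add: pw_def moment_even)
      also have "\<dots> \<le> \<beta> ^ (2 * d) * moment n d Z (unit j) 0"
      proof (rule moment_le_power[OF \<beta>, of _ _ _ _ "2 * d"])
        show "moment n d Z (unit j) (Suc (2 * d)) \<le> \<beta> * moment n d Z (unit j) (2 * d)"
          using pw[OF j] moment_odd[of n d Z "unit j" d] by (simp add: moment_even pw_def del: One_nat_def add: Suc_eq_plus1)
      qed simp
      also have "moment n d Z (unit j) 0 = 1" using j by (simp add: moment_def ip_unit) (simp add: unit_def)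
      finally show "((?A ^^ d) w j)\<^sup>2 \<le> \<beta> ^ (2 * d) * ip d w w"
        using w by (simp add: mult_right_mono)
    qed
    finally show ?thesis by simp
  qed
  from lower upper have "\<kappa> ^ (2 * d) * ip d w w \<le> (real d * \<beta> ^ (2 * d)) * ip d w w"
    by (simp add: mult.assoc)
  then have "\<kappa> ^ (2 * d) \<le> real d * \<beta> ^ (2 * d)" using w by (rule mult_right_le_imp_le)
  also have "\<dots> \<le> 4 ^ d * \<beta> ^ (2 * d)"
  proof (rule mult_right_mono)
    have "d < 2 ^ d" by (rule less_exp)
    also have "(2::nat) ^ d \<le> 4 ^ d" by (rule power_mono) auto
    finally have "real d < real (4 ^ d)" by (simp only: of_nat_less_iff)
    then show "real d \<le> 4 ^ d" by simp
  qed (use \<beta> in simp)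
  also have "\<dots> = (2 * \<beta>) ^ (2 * d)" by (simp add: power_mult_distrib power_mult)
  also have "\<dots> < \<kappa> ^ (2 * d)" using \<kappa> \<beta> d by (intro power_strict_mono) auto
  finally show False by simp
qed

section \<open>Deflation and the trace as a potential\<close>

definition tr :: "nat \<Rightarrow> nat \<Rightarrow> (nat \<Rightarrow> nat \<Rightarrow> real) \<Rightarrow> real" where
  "tr n d Z = (\<Sum>i<n. ip d (Z i) (Z i))"

lemma best_dir_unit:
  assumes "best_dir n d Z l b \<beta>"
  shows "ip d b b = 1 \<and> quad n d Z b = \<beta> \<or> (\<forall>j<d. b j = 0) \<and> \<beta> = 0"
proof -
  { fix j0
    let ?x = "pw n d Z j0"
    assume *: "ip d ?x ?x > 0" "\<beta> = quad n d Z ?x / ip d ?x ?x" "\<forall>j<d. b j = ?x j / sqrt (ip d ?x ?x)"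
    have "ip d b y = ip d ?x y / sqrt (ip d ?x ?x)" for y
      using ip_cong[of d b "\<lambda>j. ?x j / sqrt (ip d ?x ?x)" y y] *(3) by (simp add: ip_scale_left)
    note b = this this[THEN trans[OF ip_commute]]
    have "ip d b b = 1" using *(1) by (simp add: b)
    moreover have "quad n d Z b = \<beta>" using *(1) by (simp add: quad_def b(2) *(2) power_divide sum_divide_distrib ip_commute[of d ?x "Z _"])
    ultimately have ?thesis by simp }
  with assms show ?thesis unfolding best_dir_def Let_def by blast
qed

text \<open>For \<open>d > 0\<close> a power iterate lies in the image of the matrix, that is, in
  the span of the rows of \<open>Z\<close>. As deflated rows are orthogonal to all earlier
  directions, a new direction needs no orthogonalisation.\<close>

lemma best_dir_orth:
  assumes "best_dir n d Z l b \<beta>" "d > 0" "\<And>i. i < n \<Longrightarrow> ip d (Z i) v = 0"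
  shows "ip d b v = 0"
proof -
  { fix j0
    let ?x = "pw n d Z j0"
    assume *: "\<forall>j<d. b j = ?x j / sqrt (ip d ?x ?x)"
    obtain d' where "d = Suc d'" using assms(2) by (cases d) auto
    then have "?x = cov n d Z ((cov n d Z ^^ d') (unit j0))" by (simp add: pw_def)
    then have "ip d ?x v = 0" by (simp only: ip_cov) (simp add: assms(3))
    moreover have "ip d b v = ip d ?x v / sqrt (ip d ?x ?x)"
      using ip_cong[of d b "\<lambda>j. ?x j / sqrt (ip d ?x ?x)" v v] * by (simp add: ip_scale_left)
    ultimately have ?thesis by simp }
  moreover have "(\<forall>j<d. b j = 0) \<Longrightarrow> ?thesis" by (simp add: ip_def)
  ultimately show ?thesis using assms(1) unfolding best_dir_def Let_def by blast
qed

text \<open>\<open>Z\<close> consists of the rows of \<open>Y\<close> projected orthogonally to the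
  first \<open>t\<close> directions, some of which may be zero. The last clause is a potential
  argument: what has been taken from the trace pays for the quadratic form on the
  complement.\<close>

definition dirs :: "nat \<Rightarrow> nat \<Rightarrow> (nat \<Rightarrow> nat \<Rightarrow> real) \<Rightarrow> (nat \<Rightarrow> nat \<Rightarrow> real) \<Rightarrow> nat \<Rightarrow> (nat \<Rightarrow> nat \<Rightarrow> real) \<Rightarrow> bool" where
  "dirs n d Y V t Z \<longleftrightarrow>
    (\<forall>s<t. ip d (V s) (V s) = 0 \<or> ip d (V s) (V s) = 1) \<and>
    (\<forall>s<t. \<forall>s'<s. ip d (V s) (V s') = 0) \<and>
    (\<forall>i<n. \<forall>s<t. ip d (Z i) (V s) = 0) \<and>
    (\<forall>w. (\<forall>s<t. ip d w (V s) = 0) \<longrightarrow> (\<forall>i<n. ip d (Z i) w = ip d (Y i) w)) \<and>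
    (\<forall>w. (\<forall>s<t. ip d w (V s) = 0) \<longrightarrow> real t * quad n d Y w \<le> 2 * (tr n d Y - tr n d Z) * ip d w w)"

lemma dirs_0: "dirs n d Y V 0 Y"
  by (simp add: dirs_def)

text \<open>The trace drops by exactly \<open>\<beta>\<close>, and \<open>power_iteration\<close>
  bounds the form of \<open>Z\<close>, which equals that of \<open>Y\<close> on the complement, by
  \<open>2 * \<beta>\<close>; adding this to the old inequality raises \<open>t\<close> by
  one.\<close>

lemma dirs_Suc:
  assumes dirs: "dirs n d Y V t Z" and b: "best_dir n d Z d b \<beta>" and d: "d > 0"
    and V: "\<And>s j. s < t \<Longrightarrow> j < d \<Longrightarrow> V' s j = V s j" "\<And>j. j < d \<Longrightarrow> V' t j = b j"
    and Z': "\<And>i j. i < n \<Longrightarrow> j < d \<Longrightarrow> Z' i j = Z i j - ip d (Z i) b * b j"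
  shows "dirs n d Y V' (Suc t) Z'"
proof -
  have ipV: "ip d w (V' s) = ip d w (V s)" "ip d (V' s) w = ip d (V s) w" if "s < t" for s w
    using that V(1) by (auto intro!: ip_cong)
  have ipVt: "ip d w (V' t) = ip d w b" "ip d (V' t) w = ip d b w" for w
    using V(2) by (auto intro!: ip_cong)
  have ipZ: "ip d (Z' i) w = ip d (Z i) w - ip d (Z i) b * ip d b w" if "i < n" for i w
    using ip_cong[of d "Z' i" "\<lambda>j. Z i j - ip d (Z i) b * b j" w w] Z' that
    by (simp add: ip_diff_scale_left)
  have cases_b: "ip d b b = 1 \<and> quad n d Z b = \<beta> \<or> (\<forall>w. ip d b w = 0) \<and> (\<forall>w. ip d w b = 0) \<and> \<beta> = 0"
    using best_dir_unit[OF b] by (auto simp: ip_def)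
  have orth: "ip d b (V s) = 0" if "s < t" for s
    by (rule best_dir_orth[OF b d]) (use dirs that in \<open>simp add: dirs_def\<close>)
  have trZ: "tr n d Z' = tr n d Z - \<beta>"
  proof -
    have "ip d (Z' i) (Z' i) = ip d (Z i) (Z i) - (ip d (Z i) b)\<^sup>2" if "i < n" for i
    proof -
      have "ip d (Z' i) (Z' i) = ip d (Z i) (Z' i) - ip d (Z i) b * ip d b (Z' i)" using ipZ that by simp
      also have "ip d (Z i) (Z' i) = ip d (Z i) (Z i) - ip d (Z i) b * ip d b (Z i)"
        using ipZ[OF that, of "Z i"] by (simp add: ip_commute)
      also have "ip d b (Z' i) = ip d (Z i) b - ip d (Z i) b * ip d b b"
        using ipZ[OF that, of b] by (simp add: ip_commute)
      finally show ?thesis using cases_b by (auto simp: power2_eq_square ip_commute[of d b "Z i"])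
    qed
    then have "tr n d Z' = tr n d Z - quad n d Z b" by (simp add: tr_def quad_def sum_subtractf)
    moreover have "quad n d Z b = \<beta>" using cases_b by (auto simp: quad_def)
    ultimately show ?thesis by simp
  qed
  have main: "real (Suc t) * quad n d Y w \<le> 2 * (tr n d Y - tr n d Z') * ip d w w"
    if w: "\<forall>s<Suc t. ip d w (V' s) = 0" for w
  proof -
    have w': "\<forall>s<t. ip d w (V s) = 0" using w ipV by (auto simp: less_Suc_eq)
    then have "quad n d Y w = quad n d Z w" using dirs by (simp add: quad_def dirs_def)
    moreover have "quad n d Z w \<le> 2 * \<beta> * ip d w w"
      by (rule power_iteration[OF _ d]) (use b in \<open>auto simp: best_dir_def\<close>)
    moreover have "real t * quad n d Y w \<le> 2 * (tr n d Y - tr n d Z) * ip d w w"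
      using dirs w' by (simp add: dirs_def)
    ultimately show ?thesis by (simp add: trZ algebra_simps)
  qed
  show ?thesis
    unfolding dirs_def
  proof (intro conjI allI impI)
    fix s assume "s < Suc t"
    then show "ip d (V' s) (V' s) = 0 \<or> ip d (V' s) (V' s) = 1"
      using cases_b dirs ipV ipVt by (auto simp: less_Suc_eq dirs_def)
  next
    fix s s' assume "s < Suc t" "s' < s"
    then show "ip d (V' s) (V' s') = 0"
      using orth dirs ipV ipVt by (auto simp: less_Suc_eq dirs_def)
  next
    fix i s assume i: "i < n" and s: "s < Suc t"
    show "ip d (Z' i) (V' s) = 0"
    proof (cases "s = t")
      case True
      then show ?thesis using cases_b ipZ[OF i, of b] by (auto simp: ipVt)
    next
      case False
      with s have "s < t" by simp
      then show ?thesis using ipZ[OF i, of "V s"] orth dirs i by (simp add: ipV dirs_def)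
    qed
  next
    fix w i assume w: "\<forall>s<Suc t. ip d w (V' s) = 0" and i: "i < n"
    then have "ip d b w = 0" using ipVt(1)[of w] by (simp add: ip_commute[of d b w])
    moreover have "\<forall>s<t. ip d w (V s) = 0" using w ipV by (auto simp: less_Suc_eq)
    ultimately show "ip d (Z' i) w = ip d (Y i) w"
      using ipZ[OF i, of w] dirs i by (simp add: dirs_def)
  qed (rule main)
qed

section \<open>Deflation and grid centres\<close>

definition deflate_com :: hcom where
  "deflate_com = vec_com 2 (NReg 6) 7 (vc 6 7) ;;
    HFor 7 0 (sum_com 10 8 1 (HBin Times (mt 1 7 8) (vc 6 8)) ;;
      vec_com 1 (NReg 7) 8 (HBin Minus (mt 1 7 8) (HBin Times (sc 10) (vc 6 8))))"

lemma asg_deflate_com: "asg deflate_com = {7, 8}" and blk_deflate_com: "blk deflate_com = {1, 2, 10}"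
  by (auto simp: deflate_com_def)

lemma wp_deflate_com:
  fixes f :: store
  assumes d: "\<rho> 1 > 0" "\<rho> 6 < \<rho> 1"
  shows "wp deflate_com (\<lambda>\<rho>' f'. (\<forall>j<\<rho> 1. f' (2, \<rho> 6, j) = f (6, 0, j)) \<and>
     (\<forall>s j. s \<noteq> \<rho> 6 \<longrightarrow> f' (2, s, j) = f (2, s, j)) \<and>
     (\<forall>i<\<rho> 0. \<forall>j<\<rho> 1. f' (1, i, j) = f (1, i, j) - ip (\<rho> 1) (srow f 1 i) (srow f 6 0) * f (6, 0, j))) \<rho> f"
proof -
  let ?I = "\<lambda>l \<rho>' f'. \<forall>i j. j < \<rho> 1 \<longrightarrow> f' (1, i, j) = (if i < l then f (1, i, j) - ip (\<rho> 1) (srow f 1 i) (srow f 6 0) * f (6, 0, j) else f (1, i, j))"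
  show ?thesis
    unfolding deflate_com_def
    apply (rule wp_SeqI)
    apply (rule wp_vec_com; (simp add: d valid_def)?)
    using d apply simp
    apply (rule wp_For[where I = ?I]; (simp; fail)?)
    subgoal for i \<rho>' f'
      apply (rule wp_SeqI)?
      apply (rule wp_sum_com; (simp add: d valid_def)?)
      apply (rule wp_vec_com; (simp add: d valid_def)?)
      apply (simp add: ip_def)
      done
    done
qed

definition basis_com :: hcom where
  "basis_com = HFor 6 3 (find_com ;; deflate_com)"

lemma asg_basis_com: "asg basis_com = {6, 7, 8, 9, 10}" and blk_basis_com: "blk basis_com = {1, 2, 4, 5, 6, 10, 11, 14, 15}"
  by (auto simp: basis_com_def asg_find_com asg_deflate_com blk_find_com blk_deflate_com)

lemma wp_basis_com:
  assumes d: "\<rho> 1 > 0" "\<rho> 3 \<le> \<rho> 1"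
  shows "wp basis_com (\<lambda>\<rho>' f'. dirs (\<rho> 0) (\<rho> 1) (srow f 1) (srow f' 2) (\<rho> 3) (srow f' 1)) \<rho> f"
  unfolding basis_com_def
proof (rule wp_For[where I = "\<lambda>t \<rho>' f'. dirs (\<rho> 0) (\<rho> 1) (srow f 1) (srow f' 2) t (srow f' 1)"])
  let ?c = "find_com ;; deflate_com"
  note fr = asg_find_com asg_deflate_com blk_find_com blk_deflate_com
  fix t \<rho>' and f' :: store
  assume t: "t < \<rho> 3" "\<rho>' 6 = t" and \<rho>': "\<And>x. x \<notin> insert 6 (asg ?c) \<Longrightarrow> \<rho>' x = \<rho> x"
    and I: "dirs (\<rho> 0) (\<rho> 1) (srow f 1) (srow f' 2) t (srow f' 1)"
  have r: "\<rho>' 0 = \<rho> 0" "\<rho>' 1 = \<rho> 1" using \<rho>' by (auto simp: fr)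
  show "wp ?c (\<lambda>\<rho>'' f''. dirs (\<rho> 0) (\<rho> 1) (srow f 1) (srow f'' 2) (Suc t) (srow f'' 1)) \<rho>' f'"
  proof (rule wp_SeqI, rule wp_use[OF wp_find_com])
    show "0 < \<rho>' 1" using r d by simp
    fix \<rho>1 and f1 :: store assume 1: "best_dir (\<rho>' 0) (\<rho>' 1) (srow f' 1) (\<rho>' 1) (srow f1 6 0) (f1 (11, 0, 0))"
      and r1: "\<And>x. x \<notin> asg find_com \<Longrightarrow> \<rho>1 x = \<rho>' x" and f1: "\<And>b i j. b \<notin> blk find_com \<Longrightarrow> f1 (b, i, j) = f' (b, i, j)"
    have r1': "\<rho>1 0 = \<rho> 0" "\<rho>1 1 = \<rho> 1" "\<rho>1 6 = t" using r1 r t by (auto simp: fr)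
    have f1': "srow f1 1 = srow f' 1" "srow f1 2 = srow f' 2" using f1 by (auto simp: fr fun_eq_iff)
    show "wp deflate_com (\<lambda>\<rho>'' f''. dirs (\<rho> 0) (\<rho> 1) (srow f 1) (srow f'' 2) (Suc t) (srow f'' 1)) \<rho>1 f1"
    proof (rule wp_use[OF wp_deflate_com])
      fix \<rho>2 :: "nat \<Rightarrow> nat" and f2 :: store assume 2: "(\<forall>j<\<rho>1 1. f2 (2, \<rho>1 6, j) = f1 (6, 0, j)) \<and>
         (\<forall>s j. s \<noteq> \<rho>1 6 \<longrightarrow> f2 (2, s, j) = f1 (2, s, j)) \<and>
         (\<forall>i<\<rho>1 0. \<forall>j<\<rho>1 1. f2 (1, i, j) = f1 (1, i, j) - ip (\<rho>1 1) (srow f1 1 i) (srow f1 6 0) * f1 (6, 0, j))"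
      have e: "f1 (1, i, j) = f' (1, i, j)" "f1 (2, i, j) = f' (2, i, j)" for i j using f1 by (auto simp: fr)
      show "dirs (\<rho> 0) (\<rho> 1) (srow f 1) (srow f2 2) (Suc t) (srow f2 1)"
        by (rule dirs_Suc[OF I, of "srow f1 6 0" "f1 (11, 0, 0)"])
          (use 1 2 r r1' e f1' d in auto)
    qed (use r1' t d in auto)
  qed
qed (use d in \<open>auto simp: dirs_0 asg_find_com asg_deflate_com\<close>)

definition sqd :: "nat \<Rightarrow> (nat \<Rightarrow> real) \<Rightarrow> (nat \<Rightarrow> real) \<Rightarrow> real" where
  "sqd d x y = (\<Sum>j<d. (x j - y j)\<^sup>2)"

abbreviation sq_diff :: "hexp \<Rightarrow> hexp \<Rightarrow> hexp" where
  "sq_diff a b \<equiv> HBin Times (HBin Minus a b) (HBin Minus a b)"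

definition prep_com :: hcom where
  "prep_com = sum_com 12 6 1 (sq_diff (mt 0 4 6) (mt 0 5 6)) ;;
    set_sc 24 (HSqrt (sc 12)) ;;
    HFor 6 0 (sum_com 10 7 1 (sq_diff (mt 0 6 7) (mt 0 4 7)) ;;
      HIf (HRLess (sc 12) (sc 10))
        (vec_com 1 (NReg 6) 7 (HC 0))
        (vec_com 1 (NReg 6) 7 (HBin Minus (mt 0 6 7) (mt 0 4 7))))"

lemma asg_prep_com: "asg prep_com = {6, 7}" and blk_prep_com: "blk prep_com = {1, 10, 12, 24}"
  by (auto simp: prep_com_def)

text \<open>Points that are too far away become zero rows instead of being removed: they contribute
  nothing to the moments, and the number of rows stays \<open>n\<close>.\<close>

definition centred :: "nat \<Rightarrow> (nat \<Rightarrow> nat \<Rightarrow> real) \<Rightarrow> nat \<Rightarrow> nat \<Rightarrow> nat \<Rightarrow> nat \<Rightarrow> real" where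
  "centred d P i0 i1 i j = (if sqd d (P i) (P i0) \<le> sqd d (P i0) (P i1) then P i j - P i0 j else 0)"

lemma wp_prep_com:
  fixes f :: store
  assumes d: "\<rho> 1 > 0" "\<rho> 4 < \<rho> 0" "\<rho> 5 < \<rho> 0"
  shows "wp prep_com (\<lambda>\<rho>' f'. f' (24, 0, 0) = sqrt (sqd (\<rho> 1) (srow f 0 (\<rho> 4)) (srow f 0 (\<rho> 5))) \<and>
     (\<forall>i<\<rho> 0. \<forall>j<\<rho> 1. f' (1, i, j) = centred (\<rho> 1) (srow f 0) (\<rho> 4) (\<rho> 5) i j)) \<rho> f"
proof -
  let ?I = "\<lambda>l \<rho>' f'. f' (12, 0, 0) = sqd (\<rho> 1) (srow f 0 (\<rho> 4)) (srow f 0 (\<rho> 5)) \<and>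
    f' (24, 0, 0) = sqrt (sqd (\<rho> 1) (srow f 0 (\<rho> 4)) (srow f 0 (\<rho> 5))) \<and>
    (\<forall>i<l. \<forall>j<\<rho> 1. f' (1, i, j) = centred (\<rho> 1) (srow f 0) (\<rho> 4) (\<rho> 5) i j)"
  show ?thesis
    unfolding prep_com_def
    apply (rule wp_SeqI)+
    apply (rule wp_sum_com; (simp add: d valid_def trans_less_add1)?)
    apply (rule wp_For[where I = ?I]; (simp add: sqd_def power2_eq_square; fail)?)
    subgoal for i \<rho>' f'
      apply (rule wp_SeqI)?
      apply (rule wp_sum_com; (simp add: d valid_def trans_less_add1)?)
      apply (intro conjI impI)
       apply (rule wp_vec_com; (simp add: d valid_def trans_less_add1)?)
       apply (simp add: centred_def sqd_def power2_eq_square less_Suc_eq)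
      apply (rule wp_vec_com; (simp add: d valid_def trans_less_add1)?)
      apply (simp add: centred_def sqd_def power2_eq_square less_Suc_eq)
      done
    done
qed

definition centre_com :: hcom where
  "centre_com = vec_com 7 (NConst 0) 7 (mt 0 4 7) ;;
    HFor 7 3 (vec_com 7 (NConst 0) 8
      (HBin Plus (vc 7 8) (HBin Times (HBin Divide (HBin Times (sc 24) (HBin Minus (vc 3 7) (sc 13))) (sc 13)) (mt 2 7 8))))"

lemma asg_centre_com: "asg centre_com = {7, 8}" and blk_centre_com: "blk centre_com = {7}"
  by (auto simp: centre_com_def)

text \<open>A digit \<open>D\<close> in \<open>{0..2 * h}\<close> stands for the coefficient
  \<open>r * (D - h) / h\<close> between \<open>- r\<close> and \<open>r\<close>, so the digit
  \<open>h\<close> stands for \<open>0\<close>.\<close>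

definition grid_centre :: "(nat \<Rightarrow> real) \<Rightarrow> real \<Rightarrow> real \<Rightarrow> nat \<Rightarrow> (nat \<Rightarrow> nat \<Rightarrow> real) \<Rightarrow> (nat \<Rightarrow> real) \<Rightarrow> nat \<Rightarrow> real" where
  "grid_centre p r h k V D j = p j + (\<Sum>t<k. r * (D t - h) / h * V t j)"

lemma wp_centre_com:
  fixes f :: store
  assumes d: "\<rho> 1 > 0" "\<rho> 4 < \<rho> 0" "\<rho> 3 \<le> \<rho> 1"
  shows "wp centre_com (\<lambda>\<rho>' f'. \<forall>j<\<rho> 1. f' (7, 0, j) =
     grid_centre (srow f 0 (\<rho> 4)) (f (24, 0, 0)) (f (13, 0, 0)) (\<rho> 3) (srow f 2) (srow f 3 0) j) \<rho> f"
proof -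
  let ?I = "\<lambda>l \<rho>' f'. \<forall>j<\<rho> 1. f' (7, 0, j) =
     grid_centre (srow f 0 (\<rho> 4)) (f (24, 0, 0)) (f (13, 0, 0)) l (srow f 2) (srow f 3 0) j"
  show ?thesis
    unfolding centre_com_def
    apply (rule wp_SeqI)+
    apply (rule wp_vec_com; (simp add: d valid_def trans_less_add1)?)
    apply (rule wp_For[where I = ?I]; (simp add: grid_centre_def; fail)?)
    subgoal premises prems for i \<rho>' f'
    proof -
      have i: "i < \<rho> 1" "i < \<rho> 0 + \<rho> 1" using prems(1) d by auto
      show ?thesis
        apply (rule wp_vec_com; (simp add: d valid_def trans_less_add1 i prems; fail)?)
        using prems apply (simp add: grid_centre_def)
        done
    qed
    done
qed

section \<open>Enumeration of the grid\<close>

text \<open>Adding one affects digit \<open>l\<close> exactly if a carry reaches it, which happens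
  exactly if \<open>g ^ l\<close> divides \<open>Suc m\<close>; \<open>carry_Suc\<close> says how
  this condition passes on to the next position.\<close>

lemma digit_Suc:
  fixes g :: nat
  assumes g: "g > 0"
  shows "(Suc m div g ^ l) mod g =
    (if g ^ l dvd Suc m then (if (m div g ^ l) mod g = g - 1 then 0 else Suc ((m div g ^ l) mod g)) else (m div g ^ l) mod g)"
proof -
  have "Suc m div g ^ l = (if g ^ l dvd Suc m then Suc (m div g ^ l) else m div g ^ l)"
    by (simp add: div_Suc dvd_eq_mod_eq_0)
  then show ?thesis using g by (auto simp: mod_Suc)
qed

lemma carry_Suc:
  fixes g :: nat
  assumes g: "g > 0"
  shows "g ^ Suc l dvd Suc m \<longleftrightarrow> g ^ l dvd Suc m \<and> (m div g ^ l) mod g = g - 1"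
proof (cases "g ^ l dvd Suc m")
  case True
  then have "Suc m mod g ^ l = 0" by (simp add: dvd_eq_mod_eq_0)
  then have "Suc m mod (g ^ l * g) = g ^ l * ((Suc m div g ^ l) mod g)" by (simp add: mod_mult2_eq)
  moreover have "Suc m div g ^ l = Suc (m div g ^ l)" using True by (simp add: div_Suc dvd_eq_mod_eq_0)
  ultimately have "g ^ Suc l dvd Suc m \<longleftrightarrow> Suc (m div g ^ l) mod g = 0"
    using g by (simp add: dvd_eq_mod_eq_0 mult.commute)
  then show ?thesis using True g by (auto simp: mod_Suc)
next
  case False
  moreover have "g ^ Suc l dvd Suc m \<Longrightarrow> g ^ l dvd Suc m" by (rule power_le_dvd) auto
  ultimately show ?thesis by blast
qed

lemma digits_surj:
  fixes g :: nat
  assumes g: "g > 0" and dig: "\<And>t. t < k \<Longrightarrow> dig t < g"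
  shows "\<exists>m<g ^ k. \<forall>t<k. (m div g ^ t) mod g = dig t"
  using dig
proof (induction k)
  case (Suc k)
  then obtain m where m: "m < g ^ k" "\<forall>t<k. (m div g ^ t) mod g = dig t" by auto
  let ?m = "m + dig k * g ^ k"
  have "?m < Suc (dig k) * g ^ k" using m(1) by simp
  also have "\<dots> \<le> g ^ Suc k" using Suc.prems[of k] by (simp add: mult_right_mono del: mult_Suc)
  finally have "?m < g ^ Suc k" .
  moreover have "(?m div g ^ t) mod g = dig t" if "t < Suc k" for t
  proof (cases "t = k")
    case True
    then show ?thesis using m(1) g Suc.prems[of k] by simp
  next
    case False
    with that have t: "t < k" by simp
    then have "g ^ k = g ^ t * (g * g ^ (k - Suc t))"
      by (simp add: power_add[symmetric] flip: power_Suc)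
    then have "?m = m + (dig k * g * g ^ (k - Suc t)) * g ^ t" by simp
    then have "?m div g ^ t = (m + (dig k * g * g ^ (k - Suc t)) * g ^ t) div g ^ t" by (rule arg_cong)
    also have "\<dots> = m div g ^ t + dig k * g * g ^ (k - Suc t)" using g by (subst div_mult_self1) auto
    finally have "?m div g ^ t = m div g ^ t + dig k * g * g ^ (k - Suc t)" .
    then have "(?m div g ^ t) mod g = (m div g ^ t + (dig k * g ^ (k - Suc t)) * g) mod g" by (simp add: mult_ac)
    also have "\<dots> = dig t" using m(2) t by simp
    finally show ?thesis .
  qed
  ultimately show ?case by blast
qed simp

text \<open>A counter in base \<open>2 * h + 1\<close>, with the carry in block \<open>15\<close>.
  Its digits are real cells because \<open>h\<close> is a square, which registers cannot compute by
  multiplication; hence the largest digit \<open>2 * h\<close> is recognised by a comparison of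
  reals.\<close>

definition incr_com :: hcom where
  "incr_com = set_sc 15 (HC 1) ;;
    HFor 7 3 (HIf (HRLess (HC 0) (sc 15))
      (HIf (HRLess (vc 3 7) (HBin Times (HC 2) (sc 13)))
        (HR 3 (NConst 0) (NReg 7) (HBin Plus (vc 3 7) (HC 1)) ;; set_sc 15 (HC 0))
        (HR 3 (NConst 0) (NReg 7) (HC 0)))
      HSkip)"

lemma asg_incr_com: "asg incr_com = {7}" and blk_incr_com: "blk incr_com = {3, 15}"
  by (auto simp: incr_com_def)

lemma wp_incr_com:
  fixes f :: store
  assumes d: "\<rho> 1 > 0" "\<rho> 3 \<le> \<rho> 1" and h: "f (13, 0, 0) = real h"
  defines "g \<equiv> 2 * h + 1"
  assumes D: "\<And>t. t < \<rho> 3 \<Longrightarrow> f (3, 0, t) = real ((m div g ^ t) mod g)"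
  shows "wp incr_com (\<lambda>\<rho>' f'. \<forall>t<\<rho> 3. f' (3, 0, t) = real ((Suc m div g ^ t) mod g)) \<rho> f"
proof -
  let ?I = "\<lambda>l \<rho>' f'. (\<forall>t<\<rho> 3. f' (3, 0, t) = (if t < l then real ((Suc m div g ^ t) mod g) else real ((m div g ^ t) mod g)))
    \<and> f' (15, 0, 0) = (if g ^ l dvd Suc m then 1 else 0)"
  have g: "g > 0" by (simp add: g_def)
  have less: "real ((m div g ^ t) mod g) < 2 * real h \<longleftrightarrow> (m div g ^ t) mod g \<noteq> g - 1" for t
  proof -
    have "(m div g ^ t) mod g < g" using g by simp
    moreover have "real ((m div g ^ t) mod g) < 2 * real h \<longleftrightarrow> (m div g ^ t) mod g < 2 * h"
      using of_nat_less_iff[of "(m div g ^ t) mod g" "2 * h", where 'a = real] by simp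
    ultimately show ?thesis unfolding g_def by linarith
  qed
  show ?thesis
    unfolding incr_com_def
    apply (rule wp_SeqI)
    apply (simp add: valid_def d)
    apply (rule wp_For[where I = ?I]; (simp add: D; fail)?)
    subgoal for i \<rho>' f'
      using d by (simp add: valid_def less_Suc_eq carry_Suc[OF g] digit_Suc[OF g] h less del: power_Suc)
    done
qed

section \<open>Candidate radii and the best ball so far\<close>

definition cnt :: "nat \<Rightarrow> nat \<Rightarrow> (nat \<Rightarrow> nat \<Rightarrow> real) \<Rightarrow> (nat \<Rightarrow> real) \<Rightarrow> real \<Rightarrow> nat" where
  "cnt n d P c r = card {i. i < n \<and> sqd d (P i) c \<le> r}"

lemma sqd_cong: "(\<And>j. j < d \<Longrightarrow> x j = x' j) \<Longrightarrow> (\<And>j. j < d \<Longrightarrow> y j = y' j) \<Longrightarrow> sqd d x y = sqd d x' y'"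
  by (simp add: sqd_def)

lemma cnt_cong: "(\<And>j. j < d \<Longrightarrow> c j = c' j) \<Longrightarrow> cnt n d P c r = cnt n d P c' r"
  unfolding cnt_def using sqd_cong[of d _ _ c c'] by metis

text \<open>Around a fixed centre the smallest sufficient radius is attained at an input point, so
  finitely many squared distances suffice.\<close>

definition cand :: "real \<Rightarrow> nat \<Rightarrow> nat \<Rightarrow> (nat \<Rightarrow> nat \<Rightarrow> real) \<Rightarrow> (nat \<Rightarrow> real) \<Rightarrow> nat \<Rightarrow> real set" where
  "cand th n d P c l = {sqd d (P i) c |i. i < l \<and> th \<le> real (cnt n d P c (sqd d (P i) c))}"

lemma cand_cong: "(\<And>j. j < d \<Longrightarrow> c j = c' j) \<Longrightarrow> cand th n d P c l = cand th n d P c' l"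
  unfolding cand_def using sqd_cong[of d _ _ c c'] cnt_cong[of d c c'] by (metis (no_types, lifting))

text \<open>\<open>X\<close> is a ghost set of the squared radii met so far, none of which may beat
  the recorded one. The flag in block \<open>19\<close> replaces an infinite initial radius.\<close>

definition best_inv :: "real \<Rightarrow> nat \<Rightarrow> nat \<Rightarrow> (nat \<Rightarrow> nat \<Rightarrow> real) \<Rightarrow> real set \<Rightarrow> store \<Rightarrow> bool" where
  "best_inv th n d P X f \<longleftrightarrow>
    (f (19, 0, 0) > 0 \<longrightarrow> f (16, 0, 0) \<ge> 0 \<and> th \<le> real (cnt n d P (srow f 8 0) (f (16, 0, 0)))) \<and>
    (\<forall>r\<in>X. f (19, 0, 0) > 0 \<and> f (16, 0, 0) \<le> r)"

definition rec_com :: hcom where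
  "rec_com = set_sc 16 (sc 18) ;; set_sc 19 (HC 1) ;; vec_com 8 (NConst 0) 8 (vc 7 8)"

definition commit_com :: hcom where
  "commit_com = HIf (HRLess (sc 17) (sc 9)) HSkip
      (HIf (HRLess (HC 0) (sc 19)) (HIf (HRLess (sc 18) (sc 16)) rec_com HSkip) rec_com)"

definition eval_com :: hcom where
  "eval_com = HFor 7 0 (
    sum_com 18 8 1 (sq_diff (mt 0 7 8) (vc 7 8)) ;;
    set_sc 17 (HC 0) ;;
    HFor 8 0 (sum_com 10 9 1 (sq_diff (mt 0 8 9) (vc 7 9)) ;;
      HIf (HRLess (sc 18) (sc 10)) HSkip (set_sc 17 (HBin Plus (sc 17) (HC 1)))) ;;
    commit_com)"

lemma asg_rec_com: "asg rec_com = {8}" and blk_rec_com: "blk rec_com = {8, 16, 19}"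
  by (auto simp: rec_com_def)

lemma asg_commit_com: "asg commit_com = {8}" and blk_commit_com: "blk commit_com = {8, 16, 19}"
  by (auto simp: commit_com_def asg_rec_com blk_rec_com)

lemma asg_eval_com: "asg eval_com = {7, 8, 9}" and blk_eval_com: "blk eval_com = {8, 10, 16, 17, 18, 19}"
  by (auto simp: eval_com_def asg_commit_com blk_commit_com)

lemma sqd_nonneg: "0 \<le> sqd d x y"
  by (simp add: sqd_def sum_nonneg)

lemma cnt_Suc_set: "card {j. j < Suc i \<and> Q j} = card {j. j < i \<and> Q j} + (if Q i then 1 else 0)"
proof -
  have "{j. j < Suc i \<and> Q j} = (if Q i then insert i {j. j < i \<and> Q j} else {j. j < i \<and> Q j})"
    by (auto simp: less_Suc_eq)
  then show ?thesis by simp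
qed

lemma wp_rec_com:
  fixes f :: store
  assumes d: "\<rho> 1 > 0"
  shows "wp rec_com (\<lambda>\<rho>' f'. f' (16, 0, 0) = f (18, 0, 0) \<and> f' (19, 0, 0) = 1 \<and> (\<forall>j<\<rho> 1. f' (8, 0, j) = f (7, 0, j))) \<rho> f"
  unfolding rec_com_def
  apply (rule wp_SeqI)+
  apply (simp add: valid_def d)
  apply (rule wp_vec_com; (simp add: d valid_def)?)
  done

lemma wp_eval_com:
  fixes f :: store
  assumes d: "\<rho> 1 > 0"
    and inv: "best_inv (f (9, 0, 0)) (\<rho> 0) (\<rho> 1) (srow f 0) X f"
  shows "wp eval_com (\<lambda>\<rho>' f'. best_inv (f (9, 0, 0)) (\<rho> 0) (\<rho> 1) (srow f 0)
    (X \<union> cand (f (9, 0, 0)) (\<rho> 0) (\<rho> 1) (srow f 0) (srow f 7 0) (\<rho> 0)) f') \<rho> f"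
  unfolding eval_com_def
proof (rule wp_For[where I = "\<lambda>l \<rho>' f'. best_inv (f (9, 0, 0)) (\<rho> 0) (\<rho> 1) (srow f 0)
    (X \<union> cand (f (9, 0, 0)) (\<rho> 0) (\<rho> 1) (srow f 0) (srow f 7 0) l) f'"], goal_cases)
  case (5 l \<rho>' f')
  let ?n = "\<rho> 0" and ?d = "\<rho> 1" and ?P = "srow f 0" and ?c = "srow f 7 0" and ?th = "f (9, 0, 0)"
  let ?r = "sqd ?d (?P l) ?c"
  have r: "\<rho>' 0 = ?n" "\<rho>' 1 = ?d" "\<rho>' 7 = l" "l < ?n" using 5(1-3) by (auto simp: asg_commit_com)
  have e: "f' (0, i, j) = f (0, i, j)" "f' (7, i, j) = f (7, i, j)" "f' (9, i, j) = f (9, i, j)" for i j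
    using 5(4) by (auto simp: blk_commit_com)
  have cand_Suc: "cand ?th ?n ?d ?P ?c (Suc l) = (if ?th \<le> real (cnt ?n ?d ?P ?c ?r) then insert ?r (cand ?th ?n ?d ?P ?c l) else cand ?th ?n ?d ?P ?c l)"
    by (auto simp: cand_def less_Suc_eq)
  let ?Inv = "\<lambda>l. best_inv ?th ?n ?d ?P (X \<union> cand ?th ?n ?d ?P ?c l)"
  note I = 5(5)
  have step: "?Inv (Suc l) f2"
    if f2: "f2 (16, 0, 0) = ?r" "f2 (19, 0, 0) = 1" "\<forall>j<?d. f2 (8, 0, j) = f (7, 0, j)"
      and th: "?th \<le> real (cnt ?n ?d ?P ?c ?r)" and less: "f' (19, 0, 0) > 0 \<Longrightarrow> ?r < f' (16, 0, 0)" for f2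
  proof -
    have "cnt ?n ?d ?P (srow f2 8 0) ?r = cnt ?n ?d ?P ?c ?r" by (rule cnt_cong) (use f2 in simp)
    moreover have "?r \<le> x" if "x \<in> X \<union> cand ?th ?n ?d ?P ?c l" for x
      using I that less unfolding best_inv_def by force
    ultimately show ?thesis using f2 th by (auto simp: best_inv_def cand_Suc sqd_nonneg)
  qed
  let ?J = "\<lambda>i \<rho>'' f''. f'' (18, 0, 0) = ?r \<and> f'' (17, 0, 0) = real (card {j. j < i \<and> sqd ?d (?P j) ?c \<le> ?r})"
  show ?case
    apply (rule wp_SeqI)
    apply (rule wp_sum_com; (simp add: d valid_def r e trans_less_add1)?)
    apply (rule wp_SeqI)?
    apply (rule wp_For[where I = ?J]; (simp add: sqd_def power2_eq_square r e; fail)?)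
    subgoal for i \<rho>1 f1
      apply (rule wp_SeqI)?
      apply (rule wp_sum_com; (simp add: d valid_def r e trans_less_add1)?)
      apply (simp add: cnt_Suc_set d r valid_def sqd_def power2_eq_square)
      done
    subgoal for \<rho>1 f1
    proof goal_cases
      case 1
      then have r1: "\<rho>1 0 = ?n" "\<rho>1 1 = ?d" by (auto simp: r)
      have f1: "f1 (9, 0, 0) = ?th" "f1 (19, 0, 0) = f' (19, 0, 0)" "f1 (16, 0, 0) = f' (16, 0, 0)"
        "\<And>j. f1 (7, 0, j) = f (7, 0, j)" "\<And>j. f1 (8, 0, j) = f' (8, 0, j)"
        using 1 by (auto simp: e)
      have f1': "f1 (18, 0, 0) = ?r" "f1 (17, 0, 0) = real (cnt ?n ?d ?P ?c ?r)" using 1 by (auto simp: cnt_def r)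
      have rec: "wp rec_com (\<lambda>\<rho>'. ?Inv (Suc l)) \<rho>1 f1"
        if "?th \<le> real (cnt ?n ?d ?P ?c ?r)" "f' (19, 0, 0) > 0 \<Longrightarrow> ?r < f' (16, 0, 0)"
        by (rule wp_use[OF wp_rec_com]) (use that r1 d f1 f1' in \<open>auto intro!: step\<close>)
      have "srow f1 8 0 = srow f' 8 0" using f1 by (simp add: fun_eq_iff)
      then have same: "?Inv l f1" using I f1 by (simp add: best_inv_def)
      have same': "?Inv (Suc l) f1" if "f' (19, 0, 0) > 0" "\<not> ?r < f' (16, 0, 0)"
        using same that f1 by (auto simp: best_inv_def cand_Suc)
      show ?case
        unfolding commit_com_def using rec same same' f1 f1' r1 d by (auto simp: valid_def cand_Suc)
    qed
    done
qed (use inv in \<open>auto simp: cand_def asg_commit_com\<close>)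

definition body_com :: hcom where
  "body_com = prep_com ;; basis_com ;; vec_com 3 (NConst 0) 6 (HC 0) ;;
    HFor 6 1 (centre_com ;; eval_com ;; incr_com)"

lemma asg_body_com: "asg body_com = {6, 7, 8, 9, 10}"
  and blk_body_com: "blk body_com = {1, 2, 3, 4, 5, 6, 7, 8, 10, 11, 12, 14, 15, 16, 17, 18, 19, 24}"
  by (auto simp: body_com_def asg_prep_com asg_basis_com asg_centre_com asg_eval_com asg_incr_com
    blk_prep_com blk_basis_com blk_centre_com blk_eval_com blk_incr_com)

lemma dirs_cong:
  assumes "\<And>i j. i < n \<Longrightarrow> j < d \<Longrightarrow> Y i j = Y' i j" "dirs n d Y V t Z"
  shows "dirs n d Y' V t Z"
proof -
  have "ip d (Y i) w = ip d (Y' i) w" if "i < n" for i w by (rule ip_cong) (use assms(1) that in auto)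
  moreover have "quad n d Y w = quad n d Y' w" for w by (rule quad_cong) (use assms(1) in auto)
  moreover have "tr n d Y = tr n d Y'" unfolding tr_def by (intro sum.cong ip_cong) (use assms(1) in auto)
  ultimately show ?thesis using assms(2) by (simp add: dirs_def)
qed

text \<open>The counter runs up to \<open>d\<close>, not up to the number of grid points. Once the
  grid is exhausted the digits repeat, so all grid points are met as soon as there are at most
  \<open>d\<close> of them.\<close>

definition explored :: "real \<Rightarrow> nat \<Rightarrow> nat \<Rightarrow> (nat \<Rightarrow> nat \<Rightarrow> real) \<Rightarrow> nat \<Rightarrow> nat \<Rightarrow> real set \<Rightarrow> nat \<Rightarrow> nat \<Rightarrow> bool" where
  "explored th n d P h k X i0 i1 \<longleftrightarrow> (\<exists>V Z. dirs n d (centred d P i0 i1) V k Z \<and>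
    (\<forall>m<d. cand th n d P (grid_centre (P i0) (sqrt (sqd d (P i0) (P i1))) (real h) k V
       (\<lambda>t. real ((m div (2 * h + 1) ^ t) mod (2 * h + 1)))) n \<subseteq> X))"

lemma explored_mono: "explored th n d P h k X i0 i1 \<Longrightarrow> X \<subseteq> X' \<Longrightarrow> explored th n d P h k X' i0 i1"
  unfolding explored_def by (meson order_trans)

lemma wp_body_com:
  fixes f :: store
  assumes d: "\<rho> 1 > 0" "\<rho> 3 \<le> \<rho> 1" "\<rho> 4 < \<rho> 0" "\<rho> 5 < \<rho> 0"
    and h: "f (13, 0, 0) = real h"
    and inv: "best_inv (f (9, 0, 0)) (\<rho> 0) (\<rho> 1) (srow f 0) X f"
  shows "wp body_com (\<lambda>\<rho>' f'. \<exists>X'. X \<subseteq> X' \<and> best_inv (f (9, 0, 0)) (\<rho> 0) (\<rho> 1) (srow f 0) X' f' \<and>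
    explored (f (9, 0, 0)) (\<rho> 0) (\<rho> 1) (srow f 0) h (\<rho> 3) X' (\<rho> 4) (\<rho> 5)) \<rho> f"
proof -
  let ?n = "\<rho> 0" and ?d = "\<rho> 1" and ?k = "\<rho> 3" and ?P = "srow f 0" and ?th = "f (9, 0, 0)"
  let ?p = "srow f 0 (\<rho> 4)" and ?g = "2 * h + 1"
  let ?r = "sqrt (sqd ?d (?P (\<rho> 4)) (?P (\<rho> 5)))"
  let ?c = "centre_com ;; eval_com ;; incr_com"
  let ?Q = "\<lambda>\<rho>' f'. \<exists>X'. X \<subseteq> X' \<and> best_inv ?th ?n ?d ?P X' f' \<and> explored ?th ?n ?d ?P h ?k X' (\<rho> 4) (\<rho> 5)"
  note fr = asg_prep_com asg_basis_com asg_centre_com asg_eval_com asg_incr_com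
    blk_prep_com blk_basis_com blk_centre_com blk_eval_com blk_incr_com
  have loop: "wp (HFor 6 1 ?c) ?Q \<rho>0 f0"
    if r0: "\<And>x. x < 6 \<Longrightarrow> \<rho>0 x = \<rho> x"
      and f0: "\<And>b i j. b \<in> {0, 8, 9, 13, 16, 19} \<Longrightarrow> f0 (b, i, j) = f (b, i, j)"
      and dirs: "dirs ?n ?d (centred ?d ?P (\<rho> 4) (\<rho> 5)) (srow f0 2) ?k Z"
      and rad: "f0 (24, 0, 0) = ?r" and D: "\<And>t. t < ?d \<Longrightarrow> f0 (3, 0, t) = 0"
    for \<rho>0 f0 Z
  proof -
    let ?D = "\<lambda>m t. real ((m div ?g ^ t) mod ?g)"
    let ?C = "\<lambda>m. cand ?th ?n ?d ?P (grid_centre ?p ?r (real h) ?k (srow f0 2) (?D m)) ?n"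
    let ?I = "\<lambda>m \<rho>' f'. (\<forall>t<?k. f' (3, 0, t) = ?D m t) \<and> best_inv ?th ?n ?d ?P (X \<union> (\<Union>m'<m. ?C m')) f'"
    show ?thesis
    proof (rule wp_For[where I = ?I], goal_cases)
      case 4
      have "srow f0 8 0 = srow f 8 0" using f0 by (simp add: fun_eq_iff)
      then show ?case using D d inv f0 by (simp add: best_inv_def)
    next
      case (5 m \<rho>1 f1)
      have r1: "\<And>x. x < 6 \<Longrightarrow> \<rho>1 x = \<rho> x" using 5(3) r0 by (simp add: fr)
      have rr: "\<rho>1 0 = ?n" "\<rho>1 1 = ?d" "\<rho>1 3 = ?k" "\<rho>1 4 = \<rho> 4" using r1 by auto
      have e: "f1 (0, i, j) = f (0, i, j)" "f1 (9, i, j) = f (9, i, j)" "f1 (13, i, j) = f (13, i, j)"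
        "f1 (2, i, j) = f0 (2, i, j)" "f1 (24, 0, 0) = ?r" for i j
        using 5(4) f0 rad by (auto simp: fr)
      have re: "srow f1 0 = srow f 0" "srow f1 2 = srow f0 2" using e by (auto simp: fun_eq_iff)
      show ?case
      proof (rule wp_SeqI, rule wp_use[OF wp_centre_com], goal_cases)
        case (4 \<rho>2 f2)
        have r2: "\<rho>2 0 = ?n" "\<rho>2 1 = ?d" "\<rho>2 3 = ?k" "\<rho>2 4 = \<rho> 4" using 4(2) rr by (auto simp: fr)
        have e2: "f2 (b, i, j) = f1 (b, i, j)" if "b \<noteq> 7" for b i j using 4(3) that by (simp add: fr)
        have re2: "srow f2 0 = srow f 0" "srow f2 8 0 = srow f1 8 0" using e2 e by (auto simp: fun_eq_iff)
        have inv2: "best_inv (f2 (9, 0, 0)) (\<rho>2 0) (\<rho>2 1) (srow f2 0) (X \<union> (\<Union>m'<m. ?C m')) f2"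
          using 5(5) e2 e r2 re2 by (simp add: best_inv_def)
        have c: "f2 (7, 0, j) = grid_centre ?p ?r (real h) ?k (srow f0 2) (?D m) j" if "j < ?d" for j
        proof -
          have "f2 (7, 0, j) = grid_centre ?p ?r (real h) ?k (srow f0 2) (srow f1 3 0) j"
            using 4(1) that rr e re h by simp
          also have "\<dots> = grid_centre ?p ?r (real h) ?k (srow f0 2) (?D m) j"
            unfolding grid_centre_def using 5(5) by simp
          finally show ?thesis .
        qed
        then have C: "cand ?th ?n ?d ?P (srow f2 7 0) ?n = ?C m" by (intro cand_cong) simp
        show ?case
        proof (rule wp_SeqI, rule wp_use[OF wp_eval_com[OF _ inv2]], goal_cases)
          case 1
          then show ?case using d r2 by simp
        next
          case (2 \<rho>3 f3)
          have r3: "\<rho>3 0 = ?n" "\<rho>3 1 = ?d" "\<rho>3 3 = ?k" using 2(2) r2 by (auto simp: fr)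
          have e3: "f3 (3, 0, t) = f1 (3, 0, t)" "f3 (13, 0, 0) = real h" for t
            using 2(3) e2 e h by (auto simp: fr)
          show ?case
          proof (rule wp_use[OF wp_incr_com[where m = m and h = h]], goal_cases)
            case (5 \<rho>4 f4)
            have "f4 (b, i, j) = f3 (b, i, j)" if "b \<noteq> 3" "b \<noteq> 15" for b i j using 5(3) that by (simp add: fr)
            then have "srow f4 8 0 = srow f3 8 0" "f4 (16, 0, 0) = f3 (16, 0, 0)" "f4 (19, 0, 0) = f3 (19, 0, 0)"
              by (auto simp: fun_eq_iff)
            moreover have "X \<union> (\<Union>m'<m. ?C m') \<union> ?C m = X \<union> (\<Union>m'<Suc m. ?C m')"
              by (auto simp: less_Suc_eq)
            then have "best_inv ?th ?n ?d ?P (X \<union> (\<Union>m'<Suc m. ?C m')) f3"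
              using 2(1) e2 e r2 re2 C by simp
            ultimately show ?case using 5(1) r3 by (simp add: best_inv_def)
          qed (use d r3 e3 \<open>?I m \<rho>1 f1\<close> in auto)
        qed
      qed (use rr d in auto)
    next
      case (7 \<rho>' f')
      have b1: "\<rho>0 1 = ?d" using r0 by simp
      let ?X = "X \<union> (\<Union>m'<?d. ?C m')"
      have "explored ?th ?n ?d ?P h ?k ?X (\<rho> 4) (\<rho> 5)"
        unfolding explored_def using dirs by (intro exI[of _ "srow f0 2"] exI[of _ Z]) auto
      then show ?case using 7(4) unfolding b1 by (intro exI[of _ ?X]) auto
    qed (auto simp: fr)
  qed
  show ?thesis
    unfolding body_com_def
  proof (rule wp_SeqI, rule wp_use[OF wp_prep_com], goal_cases)
    case (4 \<rho>1 f1)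
    have r1: "\<And>x. x < 6 \<Longrightarrow> \<rho>1 x = \<rho> x" using 4(2) by (simp add: fr)
    then have rr: "\<rho>1 0 = ?n" "\<rho>1 1 = ?d" "\<rho>1 3 = ?k" by auto
    show ?case
    proof (rule wp_SeqI, rule wp_use[OF wp_basis_com], goal_cases)
      case (3 \<rho>2 f2)
      have "dirs ?n ?d (srow f1 1) (srow f2 2) ?k (srow f2 1)" using 3(1) rr by simp
      then have dirs: "dirs ?n ?d (centred ?d ?P (\<rho> 4) (\<rho> 5)) (srow f2 2) ?k (srow f2 1)"
        by (rule dirs_cong[rotated]) (use 4(1) in simp)
      have r2: "\<And>x. x < 6 \<Longrightarrow> \<rho>2 x = \<rho> x" using 3(2) r1 by (simp add: fr)
      have e: "f2 (b, i, j) = f (b, i, j)" if "b \<in> {0, 8, 9, 13, 16, 19}" for b i j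
        using 3(3) 4(3) that by (auto simp: fr)
      have "f2 (24, 0, 0) = ?r" using 3(3) 4(1) by (simp add: fr)
      have rowset: "srow (setrow 3 i l u f2) 2 = srow f2 2" for i l u by (simp add: fun_eq_iff)
      show ?case
        apply (rule wp_SeqI)
        apply (rule wp_vec_com; (simp add: r2 d valid_def; fail)?)
        apply (rule loop[rotated 2])
            apply (subst rowset, rule dirs)
        subgoal using \<open>f2 (24, 0, 0) = ?r\<close> by simp
        subgoal by (simp add: r2)
        subgoal by (simp add: r2)
        subgoal using e by auto
        done
    qed (use rr d in auto)
  qed (use d in auto)
qed

definition main_com :: hcom where
  "main_com = HFor 4 0 (HFor 5 0 body_com)"

lemma wp_main_com:
  fixes f :: store
  assumes d: "\<rho> 1 > 0" "\<rho> 3 \<le> \<rho> 1"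
    and h: "f (13, 0, 0) = real h"
    and inv: "best_inv (f (9, 0, 0)) (\<rho> 0) (\<rho> 1) (srow f 0) X f"
  shows "wp main_com (\<lambda>\<rho>' f'. \<exists>X'. X \<subseteq> X' \<and> best_inv (f (9, 0, 0)) (\<rho> 0) (\<rho> 1) (srow f 0) X' f' \<and>
    (\<forall>i0<\<rho> 0. \<forall>i1<\<rho> 0. explored (f (9, 0, 0)) (\<rho> 0) (\<rho> 1) (srow f 0) h (\<rho> 3) X' i0 i1)) \<rho> f"
proof -
  let ?n = "\<rho> 0" and ?d = "\<rho> 1" and ?k = "\<rho> 3" and ?P = "srow f 0" and ?th = "f (9, 0, 0)"
  let ?ex = "\<lambda>X' i0 i1. explored ?th ?n ?d ?P h ?k X' i0 i1"
  let ?I = "\<lambda>i \<rho>' f'. \<exists>X'. X \<subseteq> X' \<and> best_inv ?th ?n ?d ?P X' f' \<and> (\<forall>i0<i. \<forall>i1<?n. ?ex X' i0 i1)"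
  note fr = asg_body_com blk_body_com
  show ?thesis
    unfolding main_com_def
  proof (rule wp_For[where I = ?I], goal_cases)
    case (5 i \<rho>1 f1)
    have rr: "\<rho>1 0 = ?n" "\<rho>1 1 = ?d" "\<rho>1 3 = ?k" "\<rho>1 4 = i" "i < ?n" using 5(1-3) by (auto simp: fr)
    have e: "f1 (b, l, j) = f (b, l, j)" if "b \<in> {0, 9, 13}" for b l j using 5(4) that by (auto simp: fr)
    let ?J = "\<lambda>l \<rho>' f'. \<exists>X'. X \<subseteq> X' \<and> best_inv ?th ?n ?d ?P X' f' \<and> (\<forall>i0<i. \<forall>i1<?n. ?ex X' i0 i1) \<and> (\<forall>i1<l. ?ex X' i i1)"
    show ?case
    proof (rule wp_For[where I = ?J], goal_cases)
      case 4
      show ?case using 5(5) by simp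
    next
      case (5 l \<rho>2 f2)
      have rr2: "\<rho>2 0 = ?n" "\<rho>2 1 = ?d" "\<rho>2 3 = ?k" "\<rho>2 4 = i" "\<rho>2 5 = l" "l < ?n"
        using 5(1-3) rr by (auto simp: fr)
      have e2: "f2 (b, l, j) = f (b, l, j)" if "b \<in> {0, 9, 13}" for b l j using 5(4) e that by (auto simp: fr)
      have re2: "srow f2 0 = srow f 0" using e2 by (simp add: fun_eq_iff)
      from 5(5) obtain X1 where X1: "X \<subseteq> X1" "best_inv ?th ?n ?d ?P X1 f2"
        "\<forall>i0<i. \<forall>i1<?n. ?ex X1 i0 i1" "\<forall>i1<l. ?ex X1 i i1" by blast
      show ?case
      proof (rule wp_use[OF wp_body_com[where X = X1 and h = h]], goal_cases)
        case (7 \<rho>3 f3)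
        then obtain X2 where X2: "X1 \<subseteq> X2" "best_inv ?th ?n ?d ?P X2 f3" "?ex X2 i l"
          using rr2 e2 re2 by auto
        show ?case
        proof (rule exI[of _ X2], intro conjI allI impI)
          show "X \<subseteq> X2" using X1(1) X2(1) by blast
          show "best_inv ?th ?n ?d ?P X2 f3" by (rule X2(2))
          show "?ex X2 i0 i1" if "i0 < i" "i1 < ?n" for i0 i1
            using X1(3) X2(1) that explored_mono by blast
          show "?ex X2 i i1" if "i1 < Suc l" for i1
            using X1(4) X2(1,3) that explored_mono[of _ _ _ _ _ _ X1 _ _ X2] by (cases "i1 = l") auto
        qed
      qed (use rr2 d rr e2 re2 h X1 in auto)
    next
      case (7 \<rho>2 f2)
      then obtain X1 where X1: "X \<subseteq> X1" "best_inv ?th ?n ?d ?P X1 f2"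
        "\<forall>i0<i. \<forall>i1<?n. ?ex X1 i0 i1" "\<forall>i1<?n. ?ex X1 i i1" using rr(1) by auto
      then show ?case by (intro exI[of _ X1]) (auto simp: less_Suc_eq)
    qed (auto simp: fr)
  next
    case 4
    show ?case using inv by auto
  qed (auto simp: fr)
qed

section \<open>The complete program\<close>

definition admissible :: "nat \<Rightarrow> nat \<Rightarrow> bool" where
  "admissible d k \<longleftrightarrow> (2 * k\<^sup>2 + 1) ^ k \<le> d"

text \<open>No expression turns a register into a real, so \<open>d\<close> and \<open>m\<close> are
  counted up in blocks \<open>20\<close> and \<open>21\<close>. The candidates
  \<open>1, ..., d\<close> for \<open>k\<close> are tried in turn, each power being formed by
  repeated multiplication, and register \<open>3\<close> keeps the last admissible one.\<close>

definition setup_com :: hcom where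
  "setup_com =
    HFor 5 1 (set_sc 20 (HBin Plus (sc 20) (HC 1))) ;;
    HFor 5 0 (HIf (HNLess (NReg 5) (NReg 2)) (set_sc 21 (HBin Plus (sc 21) (HC 1))) HSkip) ;;
    set_sc 9 (HBin Times (HBin Minus (HC 1) (sc 9)) (sc 21)) ;;
    HIf (HRLess (HC 0) (sc 9)) HSkip (set_sc 19 (HC 1)) ;;
    HFor 4 1 (
      set_sc 22 (HBin Plus (sc 22) (HC 1)) ;;
      set_sc 14 (HBin Plus (HBin Times (HC 2) (HBin Times (sc 22) (sc 22))) (HC 1)) ;;
      set_sc 23 (HC 1) ;;
      HFor 5 1 (HIf (HNLess (NReg 4) (NReg 5)) HSkip (set_sc 23 (HBin Times (sc 23) (sc 14)))) ;;
      HIf (HRLess (sc 20) (sc 23)) HSkip (HN 3 (NAdd (NReg 4) (NConst 1)) ;; set_sc 13 (HBin Times (sc 22) (sc 22))))"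

lemma asg_setup_com: "asg setup_com = {3, 4, 5}" and blk_setup_com: "blk setup_com = {9, 13, 14, 19, 20, 21, 22, 23}"
  by (auto simp: setup_com_def)

text \<open>If the target \<open>th\<close> is not positive, the ball of radius \<open>0\<close>
  that the zero cells describe already covers enough points; the flag is then raised at once, and
  \<open>0\<close> enters the set of radii. The start value \<open>k = 0\<close> is admissible
  because \<open>d > 0\<close>.\<close>

lemma wp_setup_com:
  fixes f :: store
  assumes d: "\<rho> 1 > 0" and m: "\<rho> 2 \<le> \<rho> 0" and r3: "\<rho> 3 = 0"
    and z: "\<And>b. b \<in> {13, 16, 19, 20, 21, 22} \<Longrightarrow> f (b, 0, 0) = 0"
  defines "th \<equiv> (1 - f (9, 0, 0)) * real (\<rho> 2)"
  shows "wp setup_com (\<lambda>\<rho>' f'. f' (9, 0, 0) = th \<and> f' (13, 0, 0) = real ((\<rho>' 3)\<^sup>2) \<and>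
     \<rho>' 3 \<le> \<rho> 1 \<and> admissible (\<rho> 1) (\<rho>' 3) \<and> (\<forall>k. \<rho>' 3 < k \<longrightarrow> k \<le> \<rho> 1 \<longrightarrow> \<not> admissible (\<rho> 1) k) \<and>
     best_inv th (\<rho> 0) (\<rho> 1) (srow f 0) {r. th \<le> 0 \<and> r = 0} f') \<rho> f"
proof -
  let ?d = "\<rho> 1"
  let ?body = "set_sc 22 (HBin Plus (sc 22) (HC 1)) ;;
      set_sc 14 (HBin Plus (HBin Times (HC 2) (HBin Times (sc 22) (sc 22))) (HC 1)) ;;
      set_sc 23 (HC 1) ;;
      HFor 5 1 (HIf (HNLess (NReg 4) (NReg 5)) HSkip (set_sc 23 (HBin Times (sc 23) (sc 14)))) ;;
      HIf (HRLess (sc 20) (sc 23)) HSkip (HN 3 (NAdd (NReg 4) (NConst 1)) ;; set_sc 13 (HBin Times (sc 22) (sc 22)))"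
  let ?K = "\<lambda>l \<rho>' f'. f' (9, 0, 0) = th \<and> f' (20, 0, 0) = real ?d \<and> f' (22, 0, 0) = real l \<and> f' (13, 0, 0) = real ((\<rho>' 3)\<^sup>2) \<and>
     f' (16, 0, 0) = 0 \<and> f' (19, 0, 0) = (if th \<le> 0 then 1 else 0) \<and>
     \<rho>' 3 \<le> l \<and> admissible ?d (\<rho>' 3) \<and> (\<forall>k. \<rho>' 3 < k \<longrightarrow> k \<le> l \<longrightarrow> \<not> admissible ?d k)"
  have step: "wp ?body (\<lambda>\<rho>'' f''. ?K (Suc l) \<rho>'' f'') \<rho>' f'"
    if K: "?K l \<rho>' f'" and r: "\<rho>' 1 = ?d" "\<rho>' 4 = l" "l < ?d" for l \<rho>' f'
  proof -
    let ?g = "2 * (Suc l)\<^sup>2 + 1"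
    let ?f = "f'((22, 0, 0) := real (Suc l), (14, 0, 0) := real ?g, (23, 0, 0) := 1)"
    \<comment> \<open>The loop makes \<open>d\<close> passes but multiplies only in the first
      \<open>Suc l\<close> of them, hence the minimum.\<close>
    let ?J = "\<lambda>i \<rho>'' f''. f'' (23, 0, 0) = real (?g ^ min i (Suc l))"
    have adm: "real ?d < real (?g ^ Suc l) \<longleftrightarrow> \<not> admissible ?d (Suc l)"
      unfolding of_nat_less_iff admissible_def not_le by simp
    define R where "R = wp (HFor 5 1 (HIf (HNLess (NReg 4) (NReg 5)) HSkip (set_sc 23 (HBin Times (sc 23) (sc 14)))))
      (wp (HIf (HRLess (sc 20) (sc 23)) HSkip (HN 3 (NAdd (NReg 4) (NConst 1)) ;; set_sc 13 (HBin Times (sc 22) (sc 22)))) (?K (Suc l)))"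
    have "wp (HFor 5 1 (HIf (HNLess (NReg 4) (NReg 5)) HSkip (set_sc 23 (HBin Times (sc 23) (sc 14)))))
      (wp (HIf (HRLess (sc 20) (sc 23)) HSkip (HN 3 (NAdd (NReg 4) (NConst 1)) ;; set_sc 13 (HBin Times (sc 22) (sc 22)))) (?K (Suc l)))
      \<rho>' ?f"
    proof (rule wp_For[where I = ?J], goal_cases)
      case (5 i \<rho>1 f1)
      then have "min (Suc i) (Suc l) = (if l < i then min i (Suc l) else Suc (min i (Suc l)))" by auto
      then show ?case using 5 d r by (simp add: valid_def mult.commute)
    next
      case (7 \<rho>1 f1)
      then have p: "f1 (23, 0, 0) = real (?g ^ Suc l)" using r by (simp add: min_absorb2)
      have e: "f1 (20, 0, 0) = real ?d" "f1 (22, 0, 0) = real (Suc l)" "f1 (9, 0, 0) = th" "f1 (16, 0, 0) = 0"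
        "f1 (19, 0, 0) = (if th \<le> 0 then 1 else 0)" "f1 (13, 0, 0) = real ((\<rho>1 3)\<^sup>2)"
        and r1: "\<rho>1 3 = \<rho>' 3" "\<rho>1 1 = ?d" "\<rho>1 4 = l"
        using 7(2,3) K r by auto
      have c: "f1 (20, 0, 0) < f1 (23, 0, 0) \<longleftrightarrow> \<not> admissible ?d (Suc l)"
        unfolding e p adm ..
      show ?case
      proof (cases "admissible ?d (Suc l)")
        case True
        then show ?thesis using c e r1 K d
          by (simp add: valid_def power2_eq_square Suc_eq_plus1[symmetric] del: of_nat_Suc)
      next
        case False
        then show ?thesis using c e r1 K d by (auto simp: valid_def le_Suc_eq)
      qed
    qed auto
    then have "R \<rho>' ?f" unfolding R_def .
    then show ?thesis
      unfolding wp.simps(4) R_def[symmetric] using K r d by (simp add: valid_def power2_eq_square algebra_simps)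
  qed
  have fin: "wp (HFor 4 1 ?body) (\<lambda>\<rho>' f'. f' (9, 0, 0) = th \<and> f' (13, 0, 0) = real ((\<rho>' 3)\<^sup>2) \<and>
     \<rho>' 3 \<le> \<rho> 1 \<and> admissible (\<rho> 1) (\<rho>' 3) \<and> (\<forall>k. \<rho>' 3 < k \<longrightarrow> k \<le> \<rho> 1 \<longrightarrow> \<not> admissible (\<rho> 1) k) \<and>
     best_inv th (\<rho> 0) (\<rho> 1) (srow f 0) {r. th \<le> 0 \<and> r = 0} f') \<rho>0 f0"
    if K0: "?K 0 \<rho>0 f0" and r0: "\<rho>0 1 = ?d" for \<rho>0 f0
  proof (rule wp_For[where I = ?K], goal_cases)
    case (5 l \<rho>' f')
    show ?case by (rule step) (use 5 r0 in auto)
  next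
    case (7 \<rho>' f')
    then show ?case by (auto simp: best_inv_def r0)
  qed (use K0 in auto)
  define W where "W = wp (HFor 4 1 ?body) (\<lambda>\<rho>' f'. f' (9, 0, 0) = th \<and> f' (13, 0, 0) = real ((\<rho>' 3)\<^sup>2) \<and>
     \<rho>' 3 \<le> \<rho> 1 \<and> admissible (\<rho> 1) (\<rho>' 3) \<and> (\<forall>k. \<rho>' 3 < k \<longrightarrow> k \<le> \<rho> 1 \<longrightarrow> \<not> admissible (\<rho> 1) k) \<and>
     best_inv th (\<rho> 0) (\<rho> 1) (srow f 0) {r. th \<le> 0 \<and> r = 0} f')"
  have W: "W \<rho>0 f0" if "?K 0 \<rho>0 f0" "\<rho>0 1 = ?d" for \<rho>0 f0
    unfolding W_def using that by (rule fin)
  show ?thesis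
    unfolding setup_com_def
  proof (rule wp_SeqI, rule wp_For[where I = "\<lambda>l \<rho>' f'. f' (20, 0, 0) = real l"], goal_cases)
    case (7 \<rho>1 f1)
    have r1: "\<rho>1 x = \<rho> x" if "x \<noteq> 5" for x using 7(2) that by simp
    have f1: "f1 (20, 0, 0) = real ?d" "\<And>b i j. b \<noteq> 20 \<Longrightarrow> f1 (b, i, j) = f (b, i, j)" using 7(3,4) by auto
    show ?case
    proof (rule wp_SeqI, rule wp_For[where I = "\<lambda>l \<rho>' f'. f' (21, 0, 0) = real (min l (\<rho> 2))"], goal_cases)
      case (7 \<rho>2 f2)
      have r2: "\<rho>2 x = \<rho> x" if "x \<noteq> 5" for x using 7(2) r1 that by simp
      have f2: "f2 (20, 0, 0) = real ?d" "f2 (21, 0, 0) = real (\<rho> 2)" "\<And>b i j. b \<noteq> 20 \<Longrightarrow> b \<noteq> 21 \<Longrightarrow> f2 (b, i, j) = f (b, i, j)"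
        using 7(3,4) f1 m r1 by (auto simp: min_absorb2)
      let ?f = "f2((9, 0, 0) := th)"
      have 1: "W \<rho>2 ((f2((9, 0, 0) := th))((19, 0, 0) := 1))" if "th \<le> 0"
        by (rule W) (use that f2 r2 z r3 d in \<open>simp_all add: admissible_def\<close>)
      have 2: "W \<rho>2 (f2((9, 0, 0) := th))" if "\<not> th \<le> 0"
        by (rule W) (use that f2 r2 z r3 d in \<open>simp_all add: admissible_def\<close>)
      have "f2 (9, 0, 0) = f (9, 0, 0)" using f2 by simp
      then show ?case
        unfolding wp.simps(4) W_def[symmetric] using 1 2 f2(2) r2 d
        by (simp add: valid_def th_def[symmetric] not_less)
    qed (use m d r1 f1 z in \<open>auto simp: valid_def\<close>)
  qed (use d z in \<open>auto simp: valid_def\<close>)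
qed

section \<open>Output and the run of the whole program\<close>

definition output_com :: com where
  "output_com = Seq (caddr 101 8 (NConst 0) (NConst 0)) (Seq (caddr 102 16 (NConst 0) (NConst 0))
    (Seq (RAssign (NConst 0) (RSqrt (RCell (NReg 102))))
      (for_com 20 1 (RAssign (NAdd (NConst 1) (NReg 20)) (RCell (NAdd (NReg 101) (NReg 20)))))))"

lemma exec_output_com:
  assumes rel: "rel \<rho> f s" and d: "\<rho> 1 > 0" and S: "S \<ge> 2" "\<rho> 1 \<le> S"
  shows "\<exists>t s'. exec output_com s t s' \<and> t \<le> S ^ 9 \<and> cell s' 0 = sqrt (f (16, 0, 0)) \<and>
    (\<forall>j<\<rho> 1. cell s' (1 + j) = f (8, 0, j))"
proof -
  let ?n = "\<rho> 0" and ?d = "\<rho> 1"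
  let ?A = "addr ?n ?d (8, 0, 0)" and ?B = "addr ?n ?d (16, 0, 0)"
  have r: "reg s 0 = ?n" "reg s 1 = ?d" using rel by (auto simp: rel_def)
  obtain t1 s1 where s1: "exec (caddr 101 8 (NConst 0) (NConst 0)) s t1 s1" "t1 \<le> S ^ 6" "cell s1 = cell s"
    "\<forall>x. x \<noteq> 100 \<longrightarrow> x \<noteq> 101 \<longrightarrow> reg s1 x = reg s x" "reg s1 101 = ?A"
    using exec_caddr[of 101 "NConst 0" "NConst 0" S s 8] S r by auto
  have r1: "reg s1 0 = ?n" "reg s1 1 = ?d" using s1(4) r by auto
  obtain t2 s2 where s2: "exec (caddr 102 16 (NConst 0) (NConst 0)) s1 t2 s2" "t2 \<le> S ^ 6" "cell s2 = cell s1"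
    "\<forall>x. x \<noteq> 100 \<longrightarrow> x \<noteq> 102 \<longrightarrow> reg s2 x = reg s1 x" "reg s2 102 = ?B"
    using exec_caddr[of 102 "NConst 0" "NConst 0" S s1 16] S r1 by auto
  have r2: "reg s2 1 = ?d" "reg s2 101 = ?A" using s2(4) r1 s1(5) by auto
  have cells: "cell s2 (addr ?n ?d (b, i, j)) = f (b, i, j)" if "i < ?n + ?d" "j < ?d" for b i j
    using rel that s1(3) s2(3) by (simp add: rel_def)
  let ?s3 = "s2\<lparr>cell := (cell s2)(0 := sqrt (f (16, 0, 0)))\<rparr>"
  have s3: "exec (RAssign (NConst 0) (RSqrt (RCell (NReg 102)))) s2 1 ?s3"
    using RAssign[of "NConst 0" "RSqrt (RCell (NReg 102))" s2] s2(5) cells[of 0 0 16] d by simp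
  \<comment> \<open>The output occupies cells \<open>0\<close> to \<open>d\<close>. Block
    \<open>8\<close> lies beyond them, so the centre is not overwritten while it is copied.\<close>
  have Ad: "?A \<ge> 2 + ?d"
  proof -
    have "1 * ?d \<le> (8 * (?n + ?d)) * ?d" by (rule mult_le_mono1) (use d in simp)
    then show ?thesis by (simp add: addr_def)
  qed
  have Aj: "cell s2 (?A + j) = f (8, 0, j)" if "j < ?d" for j
    using cells[of 0 j 8] that by (simp add: addr_def)
  let ?J = "\<lambda>l (s' :: state). cell s' 0 = sqrt (f (16, 0, 0)) \<and> (\<forall>j<l. cell s' (1 + j) = f (8, 0, j)) \<and>
    (\<forall>j<?d. cell s' (?A + j) = f (8, 0, j)) \<and> reg s' 101 = ?A"
  let ?c = "RAssign (NAdd (NConst 1) (NReg 20)) (RCell (NAdd (NReg 101) (NReg 20)))"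
  have "\<exists>t s'. exec (for_com 20 1 ?c) ?s3 t s' \<and> t \<le> ?d * (1 + 2) + 2 \<and> ?J ?d s'"
  proof (rule exec_for_com[where J = ?J])
    show "?J 0 (?s3\<lparr>reg := (reg ?s3)(20 := 0)\<rparr>)"
      using r2 d Ad Aj by simp
  next
    fix l and s' :: state
    assume l: "l < ?d" "reg s' 20 = l" "reg s' 1 = ?d" "?J l s'"
    let ?s = "s'\<lparr>cell := (cell s')(1 + l := f (8, 0, l))\<rparr>"
    have "exec ?c s' 1 ?s"
      using RAssign[of "NAdd (NConst 1) (NReg 20)" "RCell (NAdd (NReg 101) (NReg 20))" s'] l by simp
    moreover have "?J (Suc l) (?s\<lparr>reg := (reg ?s)(20 := Suc l)\<rparr>)"
      using l Ad by (auto simp: less_Suc_eq)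
    ultimately show "\<exists>t s''. exec ?c s' t s'' \<and> t \<le> 1 \<and> reg s'' 20 = l \<and> reg s'' 1 = ?d \<and>
      ?J (Suc l) (s''\<lparr>reg := (reg s'')(20 := Suc l)\<rparr>)"
      using l(2,3) by (intro exI[of _ "1::nat"] exI[of _ ?s]) simp
  qed (use r2 in simp_all)
  then obtain t3 s4 where s4: "exec (for_com 20 1 ?c) ?s3 t3 s4" "t3 \<le> ?d * (1 + 2) + 2" "?J ?d s4" by blast
  have "exec output_com s (t1 + (t2 + (1 + t3))) s4"
    unfolding output_com_def by (intro exec.Seq[OF s1(1)] exec.Seq[OF s2(1)] exec.Seq[OF s3 s4(1)])
  moreover have "t1 + (t2 + (1 + t3)) \<le> S ^ 9"
  proof -
    have "t3 \<le> S ^ 5" using loop_time[of S ?d 1 0] s4(2) S by simp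
    then have "1 + t3 \<le> S ^ 6" using pow_Suc_ge[of S 0 5 5] S by simp
    then have "t2 + (1 + t3) \<le> S ^ 7" using pow_Suc_ge[of S 6 6 6] S s2(2) by simp
    then have "t1 + (t2 + (1 + t3)) \<le> S ^ 8" using pow_Suc_ge[of S 6 7 7] S s1(2) by simp
    also have "\<dots> \<le> S ^ 9" by (rule power_increasing) (use S in auto)
    finally show ?thesis .
  qed
  ultimately show ?thesis using s4(3) by blast
qed

text \<open>\<open>\<gamma>\<close> is first copied into block \<open>9\<close>, since cell
  \<open>1\<close> belongs to no block. Setup and main part are compiled separately: register
  \<open>3\<close> is assigned in the one and a loop bound in the other, and
  \<open>compile_correct\<close> applies only to programs that assign none of their loop
  bounds.\<close>

definition ball_prog :: com where
  "ball_prog = Seq (Seq (caddr 101 9 (NConst 0) (NConst 0)) (RAssign (NReg 101) (RCell (NConst 1))))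
    (Seq (compile setup_com) (Seq (compile main_com) output_com))"

definition ball_exp :: nat where
  "ball_exp = Suc (Suc (Suc (max (texp setup_com) (max (texp main_com) 9))))"

lemma wf_setup_com: "wf_com setup_com" and bnds_setup_com: "bnds setup_com = {0, 1}"
  by (auto simp: setup_com_def)

lemma wf_main_com: "wf_com main_com" and bnds_main_com: "bnds main_com = {0, 1, 3}"
  and asg_main_com: "asg main_com = {4, 5, 6, 7, 8, 9, 10}"
  by (auto simp: main_com_def body_com_def prep_com_def basis_com_def find_com_def deflate_com_def
      pw_com_def quot_com_def upd_com_def cov_com_def centre_com_def eval_com_def incr_com_def
      commit_com_def rec_com_def)

lemma exec_ball_prog:
  fixes \<gamma> :: real
  assumes d: "d \<ge> 1" and n: "length ys = n" and m: "m \<le> n" and S: "S = n + d + 2"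
  defines "th \<equiv> (1 - \<gamma>) * real m"
  shows "\<exists>t s k P X f. exec ball_prog (input d ys \<delta> \<gamma> m) t s \<and> t \<le> S ^ ball_exp \<and>
    (\<forall>i<n. \<forall>j<d. P i j = (ys ! i) j) \<and>
    admissible d k \<and> (\<forall>k'. k < k' \<longrightarrow> k' \<le> d \<longrightarrow> \<not> admissible d k') \<and>
    (th \<le> 0 \<longrightarrow> 0 \<in> X) \<and> best_inv th n d P X f \<and>
    (\<forall>i0<n. \<forall>i1<n. explored th n d P (k\<^sup>2) k X i0 i1) \<and>
    cell s 0 = sqrt (f (16, 0, 0)) \<and> (\<forall>j<d. cell s (1 + j) = f (8, 0, j))"
proof -
  let ?s = "input d ys \<delta> \<gamma> m"
  have S2: "S \<ge> 2" "d \<le> S" "n \<le> S" using S by auto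
  have r: "reg ?s 0 = n" "reg ?s 1 = d" "reg ?s 2 = m" "reg ?s 3 = 0" using n by (auto simp: input_def)
  let ?f = "\<lambda>l. cell ?s (addr n d l)"
  have P: "?f (0, i, j) = (ys ! i) j" if "i < n" "j < d" for i j
  proof -
    have "i * d + j < n * d"
    proof -
      have "i * d + j < Suc i * d" using that by simp
      also have "\<dots> \<le> n * d" by (rule mult_le_mono1) (use that in simp)
      finally show ?thesis .
    qed
    then show ?thesis using that n by (simp add: input_def addr_def)
  qed
  \<comment> \<open>The input ends before block \<open>1\<close> begins, and all further cells are
    initially \<open>0\<close>.\<close>
  have zero: "?f (b, 0, 0) = 0" if "b > 0" for b
  proof -
    have "n * d \<le> (b * (n + d)) * d" by (rule mult_le_mono1) (use that in \<open>cases b; simp\<close>)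
    then have "2 + n * d \<le> addr n d (b, 0, 0)" by (simp add: addr_def)
    then show ?thesis using n by (simp add: input_def)
  qed
  obtain t1 s1 where s1: "exec (caddr 101 9 (NConst 0) (NConst 0)) ?s t1 s1" "t1 \<le> S ^ 6" "cell s1 = cell ?s"
    "\<forall>x. x \<noteq> 100 \<longrightarrow> x \<noteq> 101 \<longrightarrow> reg s1 x = reg ?s x" "reg s1 101 = addr n d (9, 0, 0)"
    using exec_caddr[of 101 "NConst 0" "NConst 0" S ?s 9] S2 r by auto
  let ?s2 = "s1\<lparr>cell := (cell s1)(addr n d (9, 0, 0) := \<gamma>)\<rparr>"
  let ?f2 = "?f((9, 0, 0) := \<gamma>)" and ?r = "reg ?s"
  have s2: "exec (RAssign (NReg 101) (RCell (NConst 1))) s1 1 ?s2"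
    using RAssign[of "NReg 101" "RCell (NConst 1)" s1] s1(3,5) by (simp add: input_def)
  have rel1: "rel ?r ?f s1" using s1(3,4) r by (auto simp: rel_def)
  have rel2: "rel ?r ?f2 ?s2"
    using rel_upd[OF rel1, of "NConst 0" "NConst 0" 9 \<gamma>] r d by (simp add: valid_def)
  let ?P = "srow ?f2 0"
  have "wp setup_com (\<lambda>\<rho>' f'. f' (9, 0, 0) = th \<and> f' (13, 0, 0) = real ((\<rho>' 3)\<^sup>2) \<and>
     \<rho>' 3 \<le> d \<and> admissible d (\<rho>' 3) \<and> (\<forall>k. \<rho>' 3 < k \<longrightarrow> k \<le> d \<longrightarrow> \<not> admissible d k) \<and>
     best_inv th n d ?P {r. th \<le> 0 \<and> r = 0} f') ?r ?f2"
  proof -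
    have 1: "?r 1 > 0" "?r 2 \<le> ?r 0" "?r 3 = 0" "\<And>b. b \<in> {13, 16, 19, 20, 21, 22} \<Longrightarrow> ?f2 (b, 0, 0) = 0"
      using d m r zero by auto
    have "?f2 (9, 0, 0) = \<gamma>" by simp
    from wp_setup_com[of ?r ?f2, OF 1, unfolded r this] show ?thesis unfolding th_def .
  qed
  note wp_setup = this
  have "\<exists>t s' \<rho>' f'. exec (compile setup_com) ?s2 t s' \<and> t \<le> S ^ texp setup_com \<and> rel \<rho>' f' s' \<and>
     ((f' (9, 0, 0) = th \<and> f' (13, 0, 0) = real ((\<rho>' 3)\<^sup>2) \<and>
     \<rho>' 3 \<le> d \<and> admissible d (\<rho>' 3) \<and> (\<forall>k. \<rho>' 3 < k \<longrightarrow> k \<le> d \<longrightarrow> \<not> admissible d k) \<and>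
     best_inv th n d ?P {r. th \<le> 0 \<and> r = 0} f') \<and> (\<forall>x. x \<notin> asg setup_com \<longrightarrow> \<rho>' x = ?r x) \<and>
     (\<forall>b i j. b \<notin> blk setup_com \<longrightarrow> f' (b, i, j) = ?f2 (b, i, j)))"
    by (rule compile_correct[OF wp_frame[OF wp_setup] wf_setup_com rel2 S2(1)]) (use S2 r in \<open>auto simp: bnds_setup_com asg_setup_com\<close>)
  then obtain t3 s3 \<rho>3 f3 where s3: "exec (compile setup_com) ?s2 t3 s3" "t3 \<le> S ^ texp setup_com"
    "rel \<rho>3 f3 s3" "f3 (9, 0, 0) = th" "f3 (13, 0, 0) = real ((\<rho>3 3)\<^sup>2)"
    "\<rho>3 3 \<le> d" "admissible d (\<rho>3 3)" "\<forall>k. \<rho>3 3 < k \<longrightarrow> k \<le> d \<longrightarrow> \<not> admissible d k"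
    "best_inv th n d ?P {r. th \<le> 0 \<and> r = 0} f3"
    "\<forall>x. x \<notin> asg setup_com \<longrightarrow> \<rho>3 x = ?r x" "\<forall>b i j. b \<notin> blk setup_com \<longrightarrow> f3 (b, i, j) = ?f2 (b, i, j)"
    by blast
  have r3: "\<rho>3 0 = n" "\<rho>3 1 = d" using s3(10) r by (auto simp: asg_setup_com)
  have P3: "srow f3 0 = ?P" using s3(11) by (auto simp: blk_setup_com fun_eq_iff)
  let ?X = "{r. th \<le> 0 \<and> r = 0}" and ?k = "\<rho>3 3"
  have "wp main_com (\<lambda>\<rho>' f'. \<exists>X'. ?X \<subseteq> X' \<and> best_inv th n d ?P X' f' \<and>
    (\<forall>i0<n. \<forall>i1<n. explored th n d ?P (?k\<^sup>2) ?k X' i0 i1)) \<rho>3 f3"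
    using wp_main_com[of \<rho>3 f3 "?k\<^sup>2" ?X] r3 d s3(4-6,9) P3 by simp
  note wp_main = this
  have "\<exists>t s' \<rho>' f'. exec (compile main_com) s3 t s' \<and> t \<le> S ^ texp main_com \<and> rel \<rho>' f' s' \<and>
     ((\<exists>X'. ?X \<subseteq> X' \<and> best_inv th n d ?P X' f' \<and>
       (\<forall>i0<n. \<forall>i1<n. explored th n d ?P (?k\<^sup>2) ?k X' i0 i1)) \<and> (\<forall>x. x \<notin> asg main_com \<longrightarrow> \<rho>' x = \<rho>3 x) \<and>
     (\<forall>b i j. b \<notin> blk main_com \<longrightarrow> f' (b, i, j) = f3 (b, i, j)))"
    by (rule compile_correct[OF wp_frame[OF wp_main] wf_main_com s3(3) S2(1)]) (use S2 r3 s3(6) in \<open>auto simp: bnds_main_com asg_main_com\<close>)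
  then obtain t4 s4 \<rho>4 f4 where s4: "exec (compile main_com) s3 t4 s4" "t4 \<le> S ^ texp main_com"
    "rel \<rho>4 f4 s4" "\<exists>X'. ?X \<subseteq> X' \<and> best_inv th n d ?P X' f4 \<and>
    (\<forall>i0<n. \<forall>i1<n. explored th n d ?P (?k\<^sup>2) ?k X' i0 i1)"
    "\<forall>x. x \<notin> asg main_com \<longrightarrow> \<rho>4 x = \<rho>3 x"
    by blast
  have r4: "\<rho>4 0 = n" "\<rho>4 1 = d" using s4(5) r3 by (auto simp: asg_main_com)
  from s4(4) obtain X where X: "?X \<subseteq> X" "best_inv th n d ?P X f4"
    "\<forall>i0<n. \<forall>i1<n. explored th n d ?P (?k\<^sup>2) ?k X i0 i1" by blast
  obtain t5 s5 where s5: "exec output_com s4 t5 s5" "t5 \<le> S ^ 9" "cell s5 0 = sqrt (f4 (16, 0, 0))"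
    "\<forall>j<d. cell s5 (1 + j) = f4 (8, 0, j)"
    using exec_output_com[OF s4(3), of S] r4 d S2 by auto
  let ?t = "(t1 + 1) + (t3 + (t4 + t5))" and ?M = "max (texp setup_com) (max (texp main_com) 9)"
  have "exec ball_prog ?s ?t s5"
    unfolding ball_prog_def by (intro exec.Seq[OF exec.Seq[OF s1(1) s2]] exec.Seq[OF s3(1)] exec.Seq[OF s4(1) s5(1)])
  moreover have "?t \<le> S ^ ball_exp"
  proof -
    define M where "M = ?M"
    have M: "texp setup_com \<le> M" "texp main_com \<le> M" "9 \<le> M" by (auto simp: M_def)
    have "S ^ texp main_com + S ^ 9 \<le> S ^ Suc M" by (rule pow_Suc_ge) (use S2 M in auto)
    then have "t4 + t5 \<le> S ^ Suc M" using s4(2) s5(2) by linarith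
    moreover have "S ^ texp setup_com + S ^ Suc M \<le> S ^ Suc (Suc M)" by (rule pow_Suc_ge) (use S2 M in auto)
    ultimately have "t3 + (t4 + t5) \<le> S ^ Suc (Suc M)" using s3(2) by linarith
    moreover have "S ^ 6 + S ^ 0 \<le> S ^ Suc 6" by (rule pow_Suc_ge) (use S2 in auto)
    then have "t1 + 1 \<le> S ^ Suc 6" using s1(2) by simp
    moreover have "S ^ Suc 6 + S ^ Suc (Suc M) \<le> S ^ Suc (Suc (Suc M))" by (rule pow_Suc_ge) (use S2 M in auto)
    ultimately have "t1 + 1 + (t3 + (t4 + t5)) \<le> S ^ Suc (Suc (Suc M))" by linarith
    then show ?thesis unfolding ball_exp_def M_def .
  qed
  moreover have "\<forall>i<n. \<forall>j<d. ?P i j = (ys ! i) j" using P by simp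
  moreover have "th \<le> 0 \<longrightarrow> 0 \<in> X" using X(1) by auto
  ultimately show ?thesis using s3(7,8) X(2,3) s5(3,4) by blast
qed

section \<open>Quality of the ball\<close>

definition nrm :: "nat \<Rightarrow> (nat \<Rightarrow> real) \<Rightarrow> real" where
  "nrm d x = sqrt (ip d x x)"

lemma nrm_L2_set: "nrm d x = L2_set x {..<d}"
  by (simp add: nrm_def ip_def L2_set_def power2_eq_square)

lemma nrm_nonneg [simp]: "0 \<le> nrm d x"
  by (simp add: nrm_def ip_nonneg)

lemma nrm_sq: "(nrm d x)\<^sup>2 = ip d x x"
  by (simp add: nrm_def ip_nonneg)

lemma nrm_add: "nrm d (\<lambda>j. x j + y j) \<le> nrm d x + nrm d y"
  unfolding nrm_L2_set by (rule L2_set_triangle_ineq)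

lemma nrm_scale: "nrm d (\<lambda>j. a * x j) = \<bar>a\<bar> * nrm d x"
proof -
  have "ip d (\<lambda>j. a * x j) (\<lambda>j. a * x j) = a\<^sup>2 * ip d x x"
    by (simp add: ip_def sum_distrib_left power2_eq_square mult_ac)
  then show ?thesis by (simp add: nrm_def real_sqrt_mult)
qed

lemma nrm_sum:
  fixes x :: "'i \<Rightarrow> nat \<Rightarrow> real"
  shows "finite S \<Longrightarrow> nrm d (\<lambda>j. \<Sum>t\<in>S. x t j) \<le> (\<Sum>t\<in>S. nrm d (x t))"
proof (induction S rule: finite_induct)
  case empty
  then show ?case by (simp add: nrm_def ip_def)
next
  case (insert a S)
  then show ?case using nrm_add[of d "x a" "\<lambda>j. \<Sum>t\<in>S. x t j"] by simp
qed

lemma nrm_cong: "(\<And>j. j < d \<Longrightarrow> x j = y j) \<Longrightarrow> nrm d x = nrm d y"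
  using ip_cong[of d x y x y] by (simp add: nrm_def)

lemma abs_ip_le: "\<bar>ip d x y\<bar> \<le> nrm d x * nrm d y"
proof (rule power2_le_imp_le)
  show "\<bar>ip d x y\<bar>\<^sup>2 \<le> (nrm d x * nrm d y)\<^sup>2"
    using ip_Cauchy[of d x y] by (simp add: power_mult_distrib nrm_sq)
qed simp

lemma sqd_nrm: "sqd d x y = (nrm d (\<lambda>j. x j - y j))\<^sup>2"
  unfolding sqd_def nrm_sq ip_def by (simp add: power2_eq_square)

lemma sqd_commute: "sqd d x y = sqd d y x"
  by (simp add: sqd_def power2_commute)

lemma ip_add_left: "ip d (\<lambda>j. x j + z j) y = ip d x y + ip d z y"
  and ip_diff_left: "ip d (\<lambda>j. x j - z j) y = ip d x y - ip d z y"
  by (simp_all add: ip_def algebra_simps sum.distrib sum_subtractf)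

lemma ip_sum_left: "ip d (\<lambda>j. \<Sum>t\<in>S. a t * x t j) y = (\<Sum>t\<in>S. a t * ip d (x t) y)"
proof -
  have "ip d (\<lambda>j. \<Sum>t\<in>S. a t * x t j) y = (\<Sum>j<d. \<Sum>t\<in>S. a t * (x t j * y j))"
    by (simp add: ip_def sum_distrib_right mult.assoc)
  also have "\<dots> = (\<Sum>t\<in>S. \<Sum>j<d. a t * (x t j * y j))" by (rule sum.swap)
  finally show ?thesis by (simp add: ip_def sum_distrib_left)
qed

section \<open>Rounding to the grid and covering radii\<close>

lemma grid_round:
  fixes a r :: real
  assumes "\<bar>a\<bar> \<le> r" "r > 0" "h \<ge> 1"
  shows "\<exists>D<2 * h + 1. \<bar>r * (real D - real h) / real h - a\<bar> \<le> r / real h"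
proof -
  let ?x = "a * real h / r"
  define z where "z = \<lfloor>?x\<rfloor>"
  have "\<bar>?x\<bar> \<le> real h" using assms by (simp add: abs_mult field_simps)
  then have "- real h \<le> ?x" "?x \<le> real h" by linarith+
  then have z: "- int h \<le> z" "z \<le> int h" unfolding z_def by (simp_all add: le_floor_iff floor_le_iff)
  define D where "D = nat (z + int h)"
  have D: "real D - real h = of_int z" using z by (simp add: D_def)
  have "\<bar>of_int z - ?x\<bar> \<le> 1" unfolding z_def by linarith
  then have "\<bar>of_int z - ?x\<bar> * (r / real h) \<le> 1 * (r / real h)"
    using assms by (intro mult_right_mono) auto
  moreover have "\<bar>of_int z - ?x\<bar> * (r / real h) = \<bar>r * (real D - real h) / real h - a\<bar>"
  proof -
    have "\<bar>of_int z - ?x\<bar> * (r / real h) = \<bar>(of_int z - ?x) * (r / real h)\<bar>"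
      using assms by (simp add: abs_mult)
    also have "(of_int z - ?x) * (r / real h) = r * (real D - real h) / real h - a"
      unfolding D using assms by (simp add: field_simps)
    finally show ?thesis .
  qed
  moreover have "D < 2 * h + 1" using z by (simp add: D_def)
  ultimately show ?thesis by (intro exI[of _ D]) simp
qed

text \<open>The largest squared distance within \<open>G\<close> is attained at an input point and
  covers all of \<open>G\<close>, so it is itself a candidate.\<close>

lemma cand_ball:
  assumes G: "G \<subseteq> {..<n}" "th \<le> real (card G)" "G \<noteq> {}" and near: "\<And>i. i \<in> G \<Longrightarrow> sqd d (P i) c \<le> b"
  shows "\<exists>r\<in>cand th n d P c n. r \<le> b"
proof -
  have fin: "finite G" using G(1) finite_subset by blast
  define M where "M = Max ((\<lambda>i. sqd d (P i) c) ` G)"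
  have "M \<in> (\<lambda>i. sqd d (P i) c) ` G" unfolding M_def using fin G(3) by (intro Max_in) auto
  then obtain i where i: "i \<in> G" "M = sqd d (P i) c" by auto
  have "G \<subseteq> {j. j < n \<and> sqd d (P j) c \<le> M}" using G(1) fin by (auto simp: M_def)
  then have "card G \<le> cnt n d P c M" unfolding cnt_def by (rule card_mono[rotated]) simp
  then have "th \<le> real (cnt n d P c M)" using G(2) by simp
  then have "M \<in> cand th n d P c n" using i G(1) by (auto simp: cand_def)
  then show ?thesis using near i by auto
qed

lemma orth_residual:
  fixes u :: "nat \<Rightarrow> real"
  assumes dirs: "dirs n d Y V k Z" and s: "s < k"
  defines "w \<equiv> (\<lambda>j. u j - (\<Sum>t<k. ip d u (V t) * V t j))"
  shows "ip d w (V s) = 0"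
proof -
  have "ip d (V t) (V s) = 0" if "t < k" "t \<noteq> s" for t
  proof (cases "t < s")
    case True
    then have "ip d (V s) (V t) = 0" using dirs s by (simp add: dirs_def)
    then show ?thesis by (simp only: ip_commute[of d "V t"])
  next
    case False
    then show ?thesis using dirs that by (simp add: dirs_def)
  qed
  then have "(\<Sum>t<k. ip d u (V t) * ip d (V t) (V s)) = (\<Sum>t<k. if t = s then ip d u (V s) * ip d (V s) (V s) else 0)"
    by (intro sum.cong) auto
  also have "\<dots> = ip d u (V s) * ip d (V s) (V s)" using s by simp
  finally have "ip d w (V s) = ip d u (V s) - ip d u (V s) * ip d (V s) (V s)"
    unfolding w_def ip_diff_left ip_sum_left by simp
  \<comment> \<open>A direction that is not a unit vector is zero, and then the coefficient along it
    vanishes as well.\<close>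
  moreover have "ip d (V s) (V s) = 1 \<or> ip d u (V s) = 0"
  proof (cases "ip d (V s) (V s) = 0")
    case True
    then have "\<forall>j<d. V s j = 0" using ip_eq_0 by blast
    then show ?thesis by (simp add: ip_def[of d u])
  next
    case False
    then show ?thesis using dirs s by (auto simp: dirs_def)
  qed
  ultimately show ?thesis by (elim disjE) simp_all
qed

lemma nrm_dir_le: "dirs n d Y V k Z \<Longrightarrow> t < k \<Longrightarrow> nrm d (V t) \<le> 1"
  by (auto simp: dirs_def nrm_def)

lemma centred_le: "ip d (centred d P i0 i1 i) (centred d P i0 i1 i) \<le> sqd d (P i0) (P i1)"
proof (cases "sqd d (P i) (P i0) \<le> sqd d (P i0) (P i1)")
  case True
  then have "centred d P i0 i1 i = (\<lambda>j. P i j - P i0 j)" by (simp add: centred_def fun_eq_iff)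
  then show ?thesis using True by (simp add: sqd_nrm nrm_sq)
next
  case False
  then have "centred d P i0 i1 i = (\<lambda>j. 0)" by (simp add: centred_def fun_eq_iff)
  then show ?thesis by (simp add: sqd_nonneg ip_def[of d "\<lambda>j. 0"])
qed

text \<open>Each of the \<open>k\<close> coefficients is rounded with error at most
  \<open>r / h\<close>, along a direction of norm at most one; the errors add up by the triangle
  inequality. For \<open>h = k\<^sup>2\<close> the total is \<open>r / k\<close>.\<close>

lemma grid_centre_dist:
  assumes h: "h \<ge> 1" and r: "r > 0" and dirs: "dirs n d Y V k Z" and u: "nrm d u \<le> r"
  shows "\<exists>m<(2 * h + 1) ^ k. nrm d (\<lambda>j. p j + (\<Sum>t<k. ip d u (V t) * V t j)
      - grid_centre p r (real h) k V (\<lambda>t. real ((m div (2 * h + 1) ^ t) mod (2 * h + 1))) j) \<le> real k * (r / real h)"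
proof -
  let ?a = "\<lambda>t. ip d u (V t)" and ?g = "2 * h + 1"
  have "\<bar>?a t\<bar> \<le> r" if "t < k" for t
  proof -
    have "\<bar>?a t\<bar> \<le> nrm d u * nrm d (V t)" by (rule abs_ip_le)
    also have "\<dots> \<le> r * 1" using u nrm_dir_le[OF dirs that] r by (intro mult_mono) auto
    finally show ?thesis by simp
  qed
  then have "\<forall>t. \<exists>D<?g. t < k \<longrightarrow> \<bar>r * (real D - real h) / real h - ?a t\<bar> \<le> r / real h"
    using grid_round[OF _ r h] by (metis zero_less_Suc Suc_eq_plus1)
  then obtain D where D: "\<And>t. D t < ?g" "\<And>t. t < k \<Longrightarrow> \<bar>r * (real (D t) - real h) / real h - ?a t\<bar> \<le> r / real h"
    by metis
  obtain m where m: "m < ?g ^ k" "\<forall>t<k. (m div ?g ^ t) mod ?g = D t"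
    using digits_surj[of ?g k D] D(1) by auto
  let ?b = "\<lambda>t. r * (real (D t) - real h) / real h"
  have "nrm d (\<lambda>j. p j + (\<Sum>t<k. ?a t * V t j)
      - grid_centre p r (real h) k V (\<lambda>t. real ((m div ?g ^ t) mod ?g)) j) = nrm d (\<lambda>j. \<Sum>t<k. (?a t - ?b t) * V t j)"
    using m(2) by (intro nrm_cong) (simp add: grid_centre_def sum_subtractf[symmetric] left_diff_distrib)
  also have "\<dots> \<le> (\<Sum>t<k. nrm d (\<lambda>j. (?a t - ?b t) * V t j))" by (rule nrm_sum) simp
  also have "\<dots> \<le> (\<Sum>t<k. r / real h)"
  proof (rule sum_mono)
    fix t assume "t \<in> {..<k}"
    then have t: "t < k" by simp
    have "\<bar>?a t - ?b t\<bar> * nrm d (V t) \<le> (r / real h) * 1"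
      using D(2)[OF t] nrm_dir_le[OF dirs t] r h by (intro mult_mono) (auto simp: abs_minus_commute)
    then show "nrm d (\<lambda>j. (?a t - ?b t) * V t j) \<le> r / real h" by (simp add: nrm_scale)
  qed
  finally show ?thesis using m(1) by auto
qed

section \<open>Volume of Euclidean balls\<close>

lemma emeasure_lborel_shift:
  fixes c :: real
  assumes "A \<in> sets lborel"
  shows "emeasure lborel ((\<lambda>x. x + c) -` A) = emeasure lborel A"
proof -
  have "lborel = distr lborel borel ((+) c)" by (rule lborel_distr_plus[symmetric])
  then have "emeasure lborel A = emeasure (distr lborel borel ((+) c)) A" by simp
  also have "\<dots> = emeasure lborel ((+) c -` A \<inter> space lborel)"
    using assms by (intro emeasure_distr) auto
  also have "(+) c -` A \<inter> space lborel = (\<lambda>x. x + c) -` A" by (auto simp: add.commute)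
  finally show ?thesis by simp
qed

text \<open>The product measure is determined by its values on boxes, where invariance reduces to a
  translation in each coordinate. It moves balls to the origin.\<close>

lemma PiM_lborel_translate:
  fixes c :: "nat \<Rightarrow> real"
  assumes fin: "finite I"
  shows "distr (Pi\<^sub>M I (\<lambda>_. lborel)) (Pi\<^sub>M I (\<lambda>_. lborel)) (\<lambda>f. \<lambda>i\<in>I. f i + c i) = Pi\<^sub>M I (\<lambda>_. lborel)"
proof -
  interpret product_sigma_finite "\<lambda>_::nat. lborel :: real measure"
    by unfold_locales
  have meas [measurable]: "(\<lambda>f. \<lambda>i\<in>I. f i + c i) \<in> measurable (Pi\<^sub>M I (\<lambda>_. lborel)) (Pi\<^sub>M I (\<lambda>_. lborel))"
    by measurable
  show ?thesis
  proof (rule PiM_eqI[OF fin])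
    fix A assume A: "\<And>i. i \<in> I \<Longrightarrow> A i \<in> sets (lborel :: real measure)"
    have box: "Pi\<^sub>E I A \<in> sets (Pi\<^sub>M I (\<lambda>_. lborel))" using A fin by (intro sets_PiM_I_finite) auto
    have "emeasure (distr (Pi\<^sub>M I (\<lambda>_. lborel)) (Pi\<^sub>M I (\<lambda>_. lborel)) (\<lambda>f. \<lambda>i\<in>I. f i + c i)) (Pi\<^sub>E I A)
        = emeasure (Pi\<^sub>M I (\<lambda>_. lborel)) ((\<lambda>f. \<lambda>i\<in>I. f i + c i) -` Pi\<^sub>E I A \<inter> space (Pi\<^sub>M I (\<lambda>_. lborel)))"
      by (rule emeasure_distr[OF meas box])
    also have "(\<lambda>f. \<lambda>i\<in>I. f i + c i) -` Pi\<^sub>E I A \<inter> space (Pi\<^sub>M I (\<lambda>_. lborel)) = Pi\<^sub>E I (\<lambda>i. (\<lambda>x. x + c i) -` A i)"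
      by (auto simp: space_PiM PiE_iff)
    also have "emeasure (Pi\<^sub>M I (\<lambda>_. lborel)) \<dots> = (\<Prod>i\<in>I. emeasure lborel ((\<lambda>x. x + c i) -` A i))"
    proof (rule emeasure_PiM[OF fin])
      fix i assume "i \<in> I"
      have "(\<lambda>x. x + c i) \<in> measurable lborel lborel" by simp
      from measurable_sets[OF this A[OF \<open>i \<in> I\<close>]]
      show "(\<lambda>x. x + c i) -` A i \<in> sets lborel" by simp
    qed
    also have "\<dots> = (\<Prod>i\<in>I. emeasure lborel (A i))"
      by (rule prod.cong[OF refl]) (rule emeasure_lborel_shift[OF A])
    finally show "emeasure (distr (Pi\<^sub>M I (\<lambda>_. lborel)) (Pi\<^sub>M I (\<lambda>_. lborel)) (\<lambda>f. \<lambda>i\<in>I. f i + c i)) (Pi\<^sub>E I A)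
      = (\<Prod>i\<in>I. emeasure lborel (A i))" .
  qed (rule sets_distr)
qed

text \<open>For \<open>R = 0\<close> the ball is a point, that is, a box with sides of measure zero;
  for \<open>R > 0\<close> it is a translate of the centred ball.\<close>

lemma vol_eucl_ball:
  assumes d: "d > 0" and R: "R \<ge> 0"
  shows "vol d (eucl_ball d c R) = unit_ball_vol (real d) * R ^ d"
proof (cases "R = 0")
  case True
  interpret product_sigma_finite "\<lambda>_::nat. lborel :: real measure"
    by unfold_locales
  have "L2_set f {..<d} \<le> 0 \<longleftrightarrow> (\<forall>i<d. f i = 0)" for f
  proof -
    have "L2_set f {..<d} \<le> 0 \<longleftrightarrow> L2_set f {..<d} = 0" using L2_set_nonneg[of f "{..<d}"] by linarith
    then show ?thesis by (auto simp: L2_set_eq_0_iff)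
  qed
  then have "eucl_ball d c 0 = (\<Pi>\<^sub>E i\<in>{..<d}. {c i})"
    unfolding eucl_ball_def Rd_def PiE_iff by (intro set_eqI) (simp add: PiE_iff, blast)
  then have "emeasure (Pi\<^sub>M {..<d} (\<lambda>_. lborel)) (eucl_ball d c 0) = (\<Prod>i<d. emeasure lborel {c i})"
    by (simp add: emeasure_PiM)
  also have "\<dots> = 0" using d by (auto intro!: prod_zero)
  finally show ?thesis using True d by (simp add: vol_def measure_def)
next
  case False
  let ?M = "Pi\<^sub>M {..<d} (\<lambda>_. lborel :: real measure)"
  let ?T = "\<lambda>f. \<lambda>i\<in>{..<d}. f i + (- c i)"
  let ?B = "{f. sqrt (\<Sum>i<d. (f i)\<^sup>2) \<le> R} \<inter> space ?M"
  have meas: "?T \<in> measurable ?M ?M" by measurable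
  have B: "?B \<in> sets ?M"
  proof -
    have "(\<lambda>f. sqrt (\<Sum>i<d. (f i)\<^sup>2)) \<in> borel_measurable ?M" by measurable
    from measurable_sets[OF this, of "{..R}"] show ?thesis by (simp add: vimage_def Int_def conj_commute)
  qed
  have L2: "sqrt (\<Sum>i<d. (?T y i)\<^sup>2) = L2_set (\<lambda>i. y i - c i) {..<d}" for y
    by (simp add: L2_set_def)
  have T: "?T y \<in> Rd d" for y by (simp add: Rd_def)
  have "eucl_ball d c R = ?T -` ?B \<inter> space ?M"
    unfolding eucl_ball_def space_PiM_lborel_eq_Rd
    by (intro set_eqI) (simp only: vimage_eq Int_iff mem_Collect_eq L2 T simp_thms conj_commute)
  then have "emeasure ?M (eucl_ball d c R) = emeasure (distr ?M ?M ?T) ?B"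
    using emeasure_distr[OF meas B] by simp
  also have "\<dots> = emeasure ?M ?B" by (subst PiM_lborel_translate) auto
  also have "\<dots> = ennreal (unit_ball_vol (real d) * R ^ d)"
    using emeasure_cball_aux[of "{..<d}" R] False R by simp
  finally show ?thesis using R by (simp add: vol_def measure_def)
qed

lemma vol_eucl_ball_root:
  assumes d: "d > 0" and R: "R \<ge> 0"
  shows "vol d (eucl_ball d c R) powr (1 / real d) = unit_ball_vol (real d) powr (1 / real d) * R"
proof -
  have "(R ^ d) powr (1 / real d) = R"
    using d R by (cases "R = 0") (simp_all add: powr_realpow[symmetric] powr_powr)
  then show ?thesis using R by (simp add: vol_eucl_ball[OF assms] powr_mult)
qed

section \<open>Moving the centre and the radius bound\<close>

lemma residual_markov:
  assumes I: "I \<subseteq> {..<n}" and q: "quad n d Y w \<le> \<tau> * a * ip d w w" and \<tau>: "\<tau> > 0" and a: "a \<ge> 0"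
  shows "real (card {i \<in> I. \<tau> * ip d w w < (ip d (Y i) w)\<^sup>2}) \<le> a"
proof (cases "ip d w w = 0")
  case True
  \<comment> \<open>There are no exceptions at all in this case, because the inequality that defines
    them is strict.\<close>
  have "ip d (Y i) w = 0" for i using ip_eq_0[OF True] by (simp add: ip_def)
  then show ?thesis using True a by simp
next
  case False
  with ip_nonneg[of d w] have w: "ip d w w > 0" by linarith
  let ?B = "{i \<in> I. \<tau> * ip d w w < (ip d (Y i) w)\<^sup>2}"
  have "real (card ?B) * (\<tau> * ip d w w) = (\<Sum>i\<in>?B. \<tau> * ip d w w)" by simp
  also have "\<dots> \<le> (\<Sum>i\<in>?B. (ip d (Y i) w)\<^sup>2)" by (rule sum_mono) auto
  also have "\<dots> \<le> quad n d Y w" unfolding quad_def using I by (intro sum_mono2) auto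
  also have "\<dots> \<le> a * (\<tau> * ip d w w)" using q by (simp add: mult_ac)
  finally show ?thesis using w \<tau> by (simp add: mult_le_cancel_right_pos)
qed

text \<open>As \<open>u\<close> has component \<open>w\<close> along \<open>w\<close>, expanding the
  square adds \<open>2 * ip d y w - ip d w w\<close>. By the inequality of arithmetic and geometric
  means, \<open>2 * ip d y w\<close> is at most \<open>\<tau> + ip d w w\<close>, so the norm of
  \<open>w\<close> cancels and only \<open>\<tau>\<close> remains.\<close>

lemma shifted_dist:
  assumes "(ip d y w)\<^sup>2 \<le> \<tau> * ip d w w" "\<tau> \<ge> 0" "ip d u w = ip d w w"
  shows "ip d (\<lambda>j. y j - u j + w j) (\<lambda>j. y j - u j + w j) \<le> ip d (\<lambda>j. y j - u j) (\<lambda>j. y j - u j) + \<tau>"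
proof -
  let ?z = "\<lambda>j. y j - u j" and ?q = "ip d w w"
  have "ip d (\<lambda>j. ?z j + w j) (\<lambda>j. ?z j + w j) = ip d ?z (\<lambda>j. ?z j + w j) + ip d w (\<lambda>j. ?z j + w j)"
    by (rule ip_add_left)
  also have "\<dots> = ip d ?z ?z + 2 * ip d ?z w + ?q"
    by (simp add: ip_commute[of d _ "\<lambda>j. ?z j + w j"] ip_add_left ip_commute[of d w ?z])
  also have "ip d ?z w = ip d y w - ?q" using assms(3) by (simp add: ip_diff_left)
  finally have e: "ip d (\<lambda>j. ?z j + w j) (\<lambda>j. ?z j + w j) = ip d ?z ?z + (2 * ip d y w - ?q)" by simp
  have "(2 * ip d y w)\<^sup>2 \<le> (\<tau> + ?q)\<^sup>2"
  proof -
    have "(2 * ip d y w)\<^sup>2 \<le> 4 * (\<tau> * ?q)" using assms(1) by (simp add: power_mult_distrib)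
    also have "\<dots> \<le> (\<tau> + ?q)\<^sup>2" using zero_le_power2[of "\<tau> - ?q"] by (simp add: power2_eq_square algebra_simps)
    finally show ?thesis .
  qed
  then have "2 * ip d y w \<le> \<tau> + ?q"
    by (rule power2_le_imp_le) (use assms(2) ip_nonneg[of d w] in simp)
  then show ?thesis unfolding e by simp
qed

text \<open>The grid point with all digits equal to \<open>k\<^sup>2\<close> has zero coefficients,
  so it is \<open>P i0\<close> itself.\<close>

lemma explored_point:
  assumes ex: "explored th n d P (k\<^sup>2) k X i0 i1" and adm: "admissible d k"
  shows "cand th n d P (P i0) n \<subseteq> X"
proof -
  let ?h = "k\<^sup>2" and ?g = "2 * k\<^sup>2 + 1"
  obtain V Z where *: "\<forall>m<d. cand th n d P (grid_centre (P i0) (sqrt (sqd d (P i0) (P i1))) (real ?h) k V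
       (\<lambda>t. real ((m div ?g ^ t) mod ?g))) n \<subseteq> X"
    using ex unfolding explored_def by blast
  obtain m where m: "m < ?g ^ k" "\<forall>t<k. (m div ?g ^ t) mod ?g = ?h"
    using digits_surj[of ?g k "\<lambda>_. ?h"] by auto
  have "m < d" using m(1) adm unfolding admissible_def by linarith
  moreover have "cand th n d P (grid_centre (P i0) (sqrt (sqd d (P i0) (P i1))) (real ?h) k V
       (\<lambda>t. real ((m div ?g ^ t) mod ?g))) n = cand th n d P (P i0) n"
    by (rule cand_cong) (use m(2) in \<open>simp add: grid_centre_def\<close>)
  ultimately show ?thesis using * by metis
qed

lemma sqd_le_iff: "b \<ge> 0 \<Longrightarrow> sqd d x y \<le> b\<^sup>2 \<longleftrightarrow> nrm d (\<lambda>j. x j - y j) \<le> b"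
  unfolding sqd_nrm by (rule power_mono_iff) simp_all

text \<open>For \<open>r \<le> R\<close> the point \<open>P i0\<close> is a good centre. Otherwise
  \<open>c\<close> is closer than \<open>r\<close> to \<open>P i0\<close>, so its projection lies in
  the range of the grid. The \<open>6\<close> splits into \<open>4\<close> for the shift by
  \<open>w\<close> and \<open>2\<close> for the rounding, both using
  \<open>r \<le> 2 * R\<close>.\<close>

lemma radius_bound:
  fixes \<gamma> \<delta> R :: real
  assumes k: "k \<ge> 1" and adm: "admissible d k"
    and \<gamma>: "0 \<le> \<gamma>" "\<gamma> \<le> 1" "\<delta> \<le> 1" "\<gamma> * \<delta> > 0"
    and I: "I \<subseteq> {..<n}" "\<delta> * real n \<le> real (card I)" and R: "R \<ge> 0"
    and ball: "\<And>i. i \<in> I \<Longrightarrow> nrm d (\<lambda>j. P i j - c j) \<le> R"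
    and th: "th = (1 - \<gamma>) * real (card I)" and X0: "th \<le> 0 \<Longrightarrow> 0 \<in> X"
    and ex: "\<And>i0 i1. i0 < n \<Longrightarrow> i1 < n \<Longrightarrow> explored th n d P (k\<^sup>2) k X i0 i1"
  shows "\<exists>x\<in>X. sqrt x \<le> R * (1 + 6 / (real k * (\<gamma> * \<delta>)))"
proof (cases "th \<le> 0")
  case True
  have "0 \<le> R * (1 + 6 / (real k * (\<gamma> * \<delta>)))" using R \<gamma>(4) by (intro mult_nonneg_nonneg add_nonneg_nonneg) auto
  then show ?thesis using X0[OF True] by (intro bexI[of _ 0]) auto
next
  case th_pos: False
  have finI: "finite I" using I(1) finite_subset by blast
  have "I \<noteq> {}" using th_pos th by auto
  then obtain i0 where i0: "i0 \<in> I" by blast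
  define r where "r = Max ((\<lambda>i. nrm d (\<lambda>j. P i j - P i0 j)) ` I)"
  have "r \<in> (\<lambda>i. nrm d (\<lambda>j. P i j - P i0 j)) ` I"
    unfolding r_def using finI i0 by (intro Max_in) auto
  then obtain i1 where i1: "i1 \<in> I" "r = nrm d (\<lambda>j. P i1 j - P i0 j)" by auto
  have r_max: "nrm d (\<lambda>j. P i j - P i0 j) \<le> r" if "i \<in> I" for i
    unfolding r_def using finI that by (intro Max_ge) auto
  have r0: "r \<ge> 0" by (simp add: i1(2))
  have n: "i0 < n" "i1 < n" using i0 i1 I by auto
  have sq: "sqd d (P i0) (P i1) = r\<^sup>2" by (subst sqd_commute) (simp add: sqd_nrm i1(2))
  have factor: "R \<le> R * (1 + 6 / (real k * (\<gamma> * \<delta>)))"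
    using R \<gamma>(4) mult_left_mono[of 1 "1 + 6 / (real k * (\<gamma> * \<delta>))" R] by simp
  have thI: "th \<le> real (card I)" using \<gamma> mult_right_mono[of "1 - \<gamma>" 1 "real (card I)"] by (simp add: th)
  show ?thesis
  proof (cases "r \<le> R")
    case True
    have "\<exists>x\<in>cand th n d P (P i0) n. x \<le> r\<^sup>2"
      by (rule cand_ball[OF I(1) thI \<open>I \<noteq> {}\<close>]) (use r_max r0 in \<open>simp add: sqd_le_iff\<close>)
    then obtain x where x: "x \<in> X" "x \<le> r\<^sup>2" using explored_point[OF ex[OF n] adm] by blast
    have "sqrt x \<le> r" using x(2) r0 real_le_lsqrt real_sqrt_le_iff by (metis real_sqrt_abs2 real_sqrt_le_mono real_sqrt_unique)
    then show ?thesis using x(1) True factor by force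
  next
    case False
    define Y where "Y = centred d P i0 i1"
    obtain V Z where dirs: "dirs n d Y V k Z" and X: "\<And>m. m < d \<Longrightarrow>
       cand th n d P (grid_centre (P i0) r (real (k\<^sup>2)) k V
       (\<lambda>t. real ((m div (2 * k\<^sup>2 + 1) ^ t) mod (2 * k\<^sup>2 + 1)))) n \<subseteq> X"
      using ex[OF n] r0 unfolding explored_def sq Y_def by auto
    define u where "u = (\<lambda>j. c j - P i0 j)"
    define p where "p = (\<lambda>j. \<Sum>t<k. ip d u (V t) * V t j)"
    define w where "w = (\<lambda>j. u j - p j)"
    have w_orth: "ip d w (V s) = 0" if "s < k" for s
      unfolding w_def p_def by (rule orth_residual[OF dirs that])
    have "ip d p w = 0" unfolding p_def ip_sum_left using w_orth by (simp add: ip_commute[of d "V _" w])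
    then have uw: "ip d u w = ip d w w"
      using ip_diff_left[of d u p w] by (simp add: w_def[symmetric])
    have u_le: "nrm d u \<le> R"
    proof -
      have "nrm d u = nrm d (\<lambda>j. P i0 j - c j)"
        using nrm_scale[of d "-1" "\<lambda>j. P i0 j - c j"] by (simp add: u_def)
      then show ?thesis using ball[OF i0] by simp
    qed
    have r2R: "r \<le> 2 * R"
    proof -
      have "r = nrm d (\<lambda>j. (P i1 j - c j) + u j)" by (simp add: i1(2) u_def)
      also have "\<dots> \<le> nrm d (\<lambda>j. P i1 j - c j) + nrm d u" by (rule nrm_add)
      finally show ?thesis using ball[OF i1(1)] u_le by linarith
    qed
    have Rpos: "R > 0" and rpos: "r > 0" using False r2R r0 R by linarith+
    have kpos: "real k > 0" using k by simp
    \<comment> \<open>Chosen so that \<open>\<tau> * (\<gamma> * \<delta> * n)\<close> equals the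
      bound \<open>2 * n * r\<^sup>2 / k\<close> on the quadratic form; the number of exceptions is
      then at most \<open>\<gamma> * \<delta> * n\<close>.\<close>
    define \<tau> where "\<tau> = 2 * r\<^sup>2 / (real k * (\<gamma> * \<delta>))"
    have \<tau>: "\<tau> > 0" unfolding \<tau>_def using rpos kpos \<gamma>(4) by simp
    have quad_w: "quad n d Y w \<le> \<tau> * (\<gamma> * \<delta> * real n) * ip d w w"
    proof -
      have "real k * quad n d Y w \<le> 2 * (tr n d Y - tr n d Z) * ip d w w"
        using dirs w_orth by (simp add: dirs_def)
      also have "\<dots> \<le> 2 * (real n * r\<^sup>2) * ip d w w"
      proof (intro mult_right_mono mult_left_mono)
        have "tr n d Y \<le> (\<Sum>i<n. r\<^sup>2)" unfolding tr_def Y_def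
          using centred_le[of d P i0 i1] sq by (intro sum_mono) simp
        moreover have "tr n d Z \<ge> 0" unfolding tr_def by (simp add: sum_nonneg ip_nonneg)
        ultimately show "tr n d Y - tr n d Z \<le> real n * r\<^sup>2" by simp
      qed (auto simp: ip_nonneg)
      also have "\<dots> = real k * (\<tau> * (\<gamma> * \<delta> * real n) * ip d w w)"
      proof -
        have "real k * (2 * r\<^sup>2 / (real k * e) * (e * real n) * q) = 2 * (real n * r\<^sup>2) * q" if "e > 0" for e q
          using kpos that by (simp add: field_simps)
        from this[OF \<gamma>(4)] show ?thesis unfolding \<tau>_def by (rule sym)
      qed
      finally show ?thesis using kpos by (simp add: mult_le_cancel_left_pos)
    qed
    define B where "B = {i \<in> I. \<tau> * ip d w w < (ip d (Y i) w)\<^sup>2}"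
    have "real (card B) \<le> \<gamma> * \<delta> * real n"
      unfolding B_def by (rule residual_markov[OF I(1) quad_w \<tau>]) (use \<gamma>(4) in simp)
    \<comment> \<open>The exceptions are counted against all \<open>n\<close> points; the density of
      the subset turns this into a share of the subset.\<close>
    also have "\<dots> \<le> \<gamma> * real (card I)" using I(2) \<gamma>(1) by (simp add: mult.assoc mult_left_mono)
    finally have cB: "real (card B) \<le> \<gamma> * real (card I)" .
    define G where "G = I - B"
    have "B \<subseteq> I" by (auto simp: B_def)
    then have "card G + card B = card I" unfolding G_def using finI
      by (metis card_Diff_subset card_mono finite_subset le_add_diff_inverse2)
    then have "real (card G) + real (card B) = real (card I)" by (metis of_nat_add)
    then have cG: "th \<le> real (card G)" using cB th by (simp add: algebra_simps)
    have "G \<noteq> {}" using cG th_pos by auto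
    have "G \<subseteq> {..<n}" using I(1) by (auto simp: G_def)
    define R' where "R' = sqrt (R\<^sup>2 + \<tau>)"
    have near_p: "nrm d (\<lambda>j. P i j - (P i0 j + p j)) \<le> R'" if i: "i \<in> G" for i
    proof -
      have iI: "i \<in> I" and "\<not> \<tau> * ip d w w < (ip d (Y i) w)\<^sup>2" using i by (auto simp: G_def B_def)
      \<comment> \<open>By the choice of \<open>r\<close> no point of the subset is replaced by zero
        in \<open>centred\<close>.\<close>
      moreover have "sqd d (P i) (P i0) \<le> r\<^sup>2" using r_max[OF iI] r0 by (simp add: sqd_le_iff)
      then have Yi: "Y i = (\<lambda>j. P i j - P i0 j)" unfolding Y_def centred_def sq by (simp add: fun_eq_iff)
      ultimately have "ip d (\<lambda>j. Y i j - u j + w j) (\<lambda>j. Y i j - u j + w j) \<le> ip d (\<lambda>j. Y i j - u j) (\<lambda>j. Y i j - u j) + \<tau>"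
        using \<tau> by (intro shifted_dist uw) auto
      moreover have "(\<lambda>j. Y i j - u j) = (\<lambda>j. P i j - c j)" by (simp add: Yi u_def)
      moreover have "ip d (\<lambda>j. P i j - c j) (\<lambda>j. P i j - c j) \<le> R\<^sup>2"
        using power_mono[OF ball[OF iI], of 2] by (simp add: nrm_sq)
      moreover have "(\<lambda>j. Y i j - u j + w j) = (\<lambda>j. P i j - (P i0 j + p j))" by (simp add: Yi w_def fun_eq_iff)
      ultimately have "ip d (\<lambda>j. P i j - (P i0 j + p j)) (\<lambda>j. P i j - (P i0 j + p j)) \<le> R\<^sup>2 + \<tau>" by simp
      then show ?thesis by (simp add: nrm_def R'_def)
    qed
    have k2: "k\<^sup>2 \<ge> 1" using k by simp
    have "nrm d u \<le> r" using u_le False by simp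
    from grid_centre_dist[OF k2 rpos dirs this, of "P i0"] obtain m where m: "m < (2 * k\<^sup>2 + 1) ^ k"
      "nrm d (\<lambda>j. P i0 j + p j - grid_centre (P i0) r (real (k\<^sup>2)) k V
         (\<lambda>t. real ((m div (2 * k\<^sup>2 + 1) ^ t) mod (2 * k\<^sup>2 + 1))) j) \<le> real k * (r / real (k\<^sup>2))"
      unfolding p_def by auto
    define q where "q = grid_centre (P i0) r (real (k\<^sup>2)) k V
         (\<lambda>t. real ((m div (2 * k\<^sup>2 + 1) ^ t) mod (2 * k\<^sup>2 + 1)))"
    have "m < d" using m(1) adm unfolding admissible_def by linarith
    then have Xq: "cand th n d P q n \<subseteq> X" unfolding q_def by (rule X)
    have kk: "real k * (r / real (k\<^sup>2)) = r / real k" using kpos by (simp add: power2_eq_square)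
    define b where "b = R' + r / real k"
    have R'0: "R' \<ge> 0" using \<tau> by (simp add: R'_def)
    have b0: "b \<ge> 0" unfolding b_def using R'0 r0 by simp
    have near_q: "nrm d (\<lambda>j. P i j - q j) \<le> b" if "i \<in> G" for i
    proof -
      have "nrm d (\<lambda>j. P i j - q j) = nrm d (\<lambda>j. (P i j - (P i0 j + p j)) + (P i0 j + p j - q j))" by simp
      also have "\<dots> \<le> nrm d (\<lambda>j. P i j - (P i0 j + p j)) + nrm d (\<lambda>j. P i0 j + p j - q j)" by (rule nrm_add)
      also have "\<dots> \<le> R' + r / real k" using near_p[OF that] m(2) unfolding q_def kk by (intro add_mono)
      finally show ?thesis by (simp add: b_def)
    qed
    have "\<exists>x\<in>cand th n d P q n. x \<le> b\<^sup>2"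
      by (rule cand_ball[OF \<open>G \<subseteq> {..<n}\<close> cG \<open>G \<noteq> {}\<close>]) (use near_q b0 in \<open>simp add: sqd_le_iff\<close>)
    then obtain x where x: "x \<in> X" "x \<le> b\<^sup>2" using Xq by blast
    have "sqrt x \<le> b" using real_sqrt_le_mono[OF x(2)] b0 by simp
    also have "b \<le> R * (1 + 6 / (real k * (\<gamma> * \<delta>)))"
    proof -
      \<comment> \<open>From \<open>r \<le> 2 * R\<close> one gets
        \<open>\<tau> \<le> 8 * R\<^sup>2 / (k * (\<gamma> * \<delta>))\<close>, which is the mixed
        term in the square of the right-hand side.\<close>
      have "R' \<le> R + 4 * R / (real k * (\<gamma> * \<delta>))"
        unfolding R'_def
      proof (rule real_le_lsqrt)
        let ?e = "4 * R / (real k * (\<gamma> * \<delta>))"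
        have "r\<^sup>2 \<le> (2 * R)\<^sup>2" using r2R r0 by (rule power_mono)
        then have "\<tau> \<le> 2 * (2 * R)\<^sup>2 / (real k * (\<gamma> * \<delta>))"
          unfolding \<tau>_def using kpos \<gamma>(4) by (intro divide_right_mono mult_left_mono) auto
        also have "\<dots> = 2 * R * ?e" by (simp add: power2_eq_square)
        also have "\<dots> \<le> 2 * R * ?e + ?e\<^sup>2" by simp
        finally show "R\<^sup>2 + \<tau> \<le> (R + ?e)\<^sup>2" by (simp add: power2_sum)
        show "0 \<le> R + ?e" using Rpos kpos \<gamma>(4) by simp
      qed
      moreover have "r / real k \<le> 2 * R / (real k * (\<gamma> * \<delta>))"
      proof -
        have "\<gamma> * \<delta> \<le> 1"
        proof -
          have "\<gamma> * \<delta> \<le> \<gamma> * 1" using \<gamma> by (intro mult_left_mono) auto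
          then show ?thesis using \<gamma> by simp
        qed
        then have "real k * (\<gamma> * \<delta>) \<le> real k" using kpos by simp
        then show ?thesis using r2R r0 \<gamma>(4) kpos by (intro frac_le) auto
      qed
      ultimately have sum: "b \<le> R + 4 * R / (real k * (\<gamma> * \<delta>)) + 2 * R / (real k * (\<gamma> * \<delta>))"
        unfolding b_def by linarith
      have "R + 4 * R / x + 2 * R / x = R * (1 + 6 / x)" for x
        by (simp add: divide_inverse algebra_simps)
      from sum[unfolded this] show ?thesis .
    qed
    finally show ?thesis using x(1) by blast
  qed
qed

section \<open>The size of the largest admissible dimension of the grid\<close>

lemma ln_3_ge: "ln (3::real) \<ge> 1.09"
proof -
  have "ln (exp 1 / 3 :: real) \<le> exp 1 / 3 - 1" by (rule ln_le_minus_one) simp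
  moreover have "ln (exp 1 / 3 :: real) = 1 - ln 3" by (simp add: ln_div)
  ultimately show ?thesis using e_less_272 by simp
qed

text \<open>Maximality gives \<open>L < (k + 1) * ln (3 * (k + 1)\<^sup>2)\<close>. If
  \<open>k + 1\<close> were at most \<open>L / (2 * l)\<close> with \<open>l \<ge> 1\<close>, the
  logarithm would be at most \<open>2 * l\<close>, a contradiction. For \<open>l < 1\<close> the
  bound follows from \<open>k \<ge> 1\<close> alone.\<close>

lemma admissible_lower_bound:
  assumes d: "d \<ge> 3" and adm: "admissible d k" and max: "\<And>k'. k < k' \<Longrightarrow> k' \<le> d \<Longrightarrow> \<not> admissible d k'"
  shows "k \<ge> 1 \<and> 1 / real k \<le> 40 * (ln (ln (real d)) / ln (real d))"
proof -
  define L where "L = ln (real d)"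
  define l where "l = ln L"
  \<comment> \<open>A bound strictly above one keeps \<open>l = ln L\<close> away from zero already
    at \<open>d = 3\<close>.\<close>
  have L: "L \<ge> 1.09" 
  proof -
    have "ln 3 \<le> ln (real d)" using d by (subst ln_le_cancel_iff) auto
    then show ?thesis using ln_3_ge unfolding L_def by linarith
  qed
  have "k \<ge> 1"
  proof (rule ccontr)
    assume "\<not> k \<ge> 1"
    moreover have "admissible d 1" using d by (simp add: admissible_def)
    ultimately show False using max[of 1] d by simp
  qed
  \<comment> \<open>Maximality is known only up to \<open>d\<close>, so \<open>Suc k\<close> must
    not exceed \<open>d\<close>.\<close>
  have "k < d"
  proof (rule ccontr)
    assume "\<not> k < d"
    then have dk: "d \<le> k" by simp
    have "k \<le> k * k" using \<open>k \<ge> 1\<close> by simp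
    then have "k < 2 * k\<^sup>2 + 1" unfolding power2_eq_square by linarith
    also have "\<dots> \<le> (2 * k\<^sup>2 + 1) ^ k" using \<open>k \<ge> 1\<close> by (intro self_le_power) auto
    finally show False using adm dk by (simp add: admissible_def)
  qed
  then have "\<not> admissible d (Suc k)" using max[of "Suc k"] by simp
  then have "d < (2 * (Suc k)\<^sup>2 + 1) ^ Suc k" by (simp add: admissible_def del: power_Suc)
  also have "\<dots> \<le> (3 * (Suc k)\<^sup>2) ^ Suc k" by (intro power_mono) auto
  finally have "real d < real ((3 * (Suc k)\<^sup>2) ^ Suc k)" by (simp only: of_nat_less_iff)
  then have "real d < (3 * (real (Suc k))\<^sup>2) ^ Suc k" by (simp only: of_nat_power of_nat_mult of_nat_numeral)
  then have "L < ln ((3 * (real (Suc k))\<^sup>2) ^ Suc k)" unfolding L_def using d by (subst ln_less_cancel_iff) auto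
  moreover have "ln ((3 * (real (Suc k))\<^sup>2) ^ Suc k) = real (Suc k) * ln (3 * (real (Suc k))\<^sup>2)"
    by (rule ln_realpow)
  ultimately have Lk: "L < real (Suc k) * ln (3 * (real (Suc k))\<^sup>2)" by (rule ord_less_eq_trans)
  have l0: "l > 0" unfolding l_def using L by simp
  have "L \<le> 40 * (real k * l)"
  proof (cases "l \<ge> 1")
    case True
    have "real (Suc k) > L / (2 * l)"
    proof (rule ccontr)
      assume "\<not> ?thesis"
      then have le: "real (Suc k) \<le> L / (2 * l)" by simp
      also have "\<dots> \<le> L / 2" using True L by (intro divide_left_mono) auto
      finally have "(real (Suc k))\<^sup>2 \<le> (L / 2)\<^sup>2" by (intro power_mono) auto
      also have "\<dots> = L\<^sup>2 / 4" by (simp add: power_divide)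
      finally have "3 * (real (Suc k))\<^sup>2 \<le> L\<^sup>2" using zero_le_power2[of "real (Suc k)"] by linarith
      then have "ln (3 * (real (Suc k))\<^sup>2) \<le> ln (L\<^sup>2)" by (intro ln_mono) auto
      also have "ln (L\<^sup>2) = 2 * l" using L by (simp add: l_def ln_realpow)
      finally have "real (Suc k) * ln (3 * (real (Suc k))\<^sup>2) \<le> real (Suc k) * (2 * l)" by (intro mult_left_mono) auto
      also have "\<dots> \<le> (L / (2 * l)) * (2 * l)" using le l0 by (intro mult_right_mono) auto
      also have "\<dots> = L" using l0 by simp
      finally show False using Lk by simp
    qed
    then have "L < real (Suc k) * (2 * l)" using l0 by (simp add: divide_less_eq)
    also have "\<dots> \<le> (2 * real k) * (2 * l)" using \<open>k \<ge> 1\<close> l0 by (intro mult_right_mono) auto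
    also have "\<dots> \<le> 40 * (real k * l)" using l0 by simp
    finally show ?thesis by simp
  next
    case False
    have "L = exp l" unfolding l_def using L by simp
    also have "\<dots> < exp 1" using False by simp
    finally have L3: "L < 3" using e_less_272 by simp
    have "ln (1 / L) \<le> 1 / L - 1" by (rule ln_le_minus_one) (use L in simp)
    then have "l \<ge> 1 - 1 / L" using L by (simp add: l_def ln_div)
    moreover have "1 / L \<le> 1 / 1.09" using L by (intro divide_left_mono) auto
    \<comment> \<open>The constant 40 is due to this case: \<open>1 - 1 / 1.09\<close> exceeds
      \<open>3 / 40\<close>, whereas a factor 4 is enough for \<open>l \<ge> 1\<close>.\<close>
    ultimately have "40 * l \<ge> 3" by simp
    also have "40 * l \<le> 40 * (real k * l)" using \<open>k \<ge> 1\<close> l0 by simp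
    finally show ?thesis using L3 by simp
  qed
  then have "1 / real k \<le> 40 * (l / L)" using \<open>k \<ge> 1\<close> L by (simp add: field_simps)
  then show ?thesis using \<open>k \<ge> 1\<close> by (simp add: L_def l_def)
qed

text \<open>The state \<open>s\<close> is the outcome of one run and has to serve every subset and
  every ball. As \<open>ys\<close> is distinct, subsets correspond to index sets of the same size.
  The constant 240 is the product of the 6 in \<open>radius_bound\<close> and the 40 in
  \<open>admissible_lower_bound\<close>.\<close>

lemma ball_quality:
  fixes \<gamma> \<delta> :: real
  assumes d: "d \<ge> 1" and ys: "distinct ys" "set ys \<subseteq> Rd d" and n: "length ys = n"
    and \<delta>: "\<delta> \<le> 1" and \<gamma>: "0 \<le> \<gamma>" "\<gamma> \<le> 1"
    and P: "\<forall>i<n. \<forall>j<d. P i j = (ys ! i) j" and adm: "admissible d k"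
    and max: "\<forall>k'. k < k' \<longrightarrow> k' \<le> d \<longrightarrow> \<not> admissible d k'"
    and X0: "(1 - \<gamma>) * real m \<le> 0 \<longrightarrow> 0 \<in> X"
    and inv: "best_inv ((1 - \<gamma>) * real m) n d P X f"
    and ex: "\<forall>i0<n. \<forall>i1<n. explored ((1 - \<gamma>) * real m) n d P (k\<^sup>2) k X i0 i1"
    and out: "cell s 0 = sqrt (f (16, 0, 0))" "\<forall>j<d. cell s (1 + j) = f (8, 0, j)"
    and Ystar: "Ystar \<subseteq> set ys" "card Ystar = m" "\<delta> * real n \<le> real m"
    and ball: "R \<ge> 0" "Ystar \<subseteq> eucl_ball d c R"
  defines "Bhat \<equiv> eucl_ball d (out_centre d s) (out_radius s)"
  shows "out_radius s \<ge> 0" "real (card (set ys \<inter> Bhat)) \<ge> (1 - \<gamma>) * real m"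
    "d \<ge> 3 \<Longrightarrow> \<gamma> * \<delta> > 0 \<Longrightarrow> vol d Bhat powr (1 / real d) \<le> vol d (eucl_ball d c R) powr (1 / real d) *
       (1 + 240 * (ln (ln (real d)) / (\<gamma> * \<delta> * ln (real d))))"
proof -
  let ?th = "(1 - \<gamma>) * real m" and ?r = "f (16, 0, 0)" and ?c = "srow f 8 0"
  define I where "I = {i. i < n \<and> ys ! i \<in> Ystar}"
  have I: "I \<subseteq> {..<n}" by (auto simp: I_def)
  have "\<exists>i<n. ys ! i = x" if "x \<in> Ystar" for x
    using subsetD[OF Ystar(1) that] n by (simp add: in_set_conv_nth)
  then have "(!) ys ` I = Ystar" unfolding I_def by auto
  moreover have inj: "inj_on ((!) ys) {..<n}" using ys(1) n by (auto simp: inj_on_def nth_eq_iff_index_eq)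
  ultimately have cI: "card I = m" using Ystar(2) card_image[OF inj_on_subset[OF inj I]] by simp
  have near: "nrm d (\<lambda>j. P i j - c j) \<le> R" if "i \<in> I" for i
  proof -
    have "ys ! i \<in> eucl_ball d c R" using that ball(2) by (auto simp: I_def)
    then have "nrm d (\<lambda>j. (ys ! i) j - c j) \<le> R" by (simp add: eucl_ball_def nrm_L2_set)
    moreover have "nrm d (\<lambda>j. (ys ! i) j - c j) = nrm d (\<lambda>j. P i j - c j)"
      by (rule nrm_cong) (use P that in \<open>auto simp: I_def\<close>)
    ultimately show ?thesis by simp
  qed
  \<comment> \<open>A candidate must exist even for \<open>d < 3\<close> or
    \<open>\<gamma> * \<delta> = 0\<close>, where coverage is still claimed but
    \<open>radius_bound\<close> does not apply; a point of the subset as centre provides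
    one.\<close>
  have "X \<noteq> {}"
  proof (cases "?th \<le> 0")
    case True
    then show ?thesis using X0 by auto
  next
    case False
    then have "I \<noteq> {}" using cI by auto
    then obtain i0 where i0: "i0 \<in> I" by blast
    have "i0 < n" using i0 I by auto
    have "?th \<le> real (card I)" using \<gamma> mult_right_mono[of "1 - \<gamma>" 1 "real m"] by (simp add: cI)
    then have "\<exists>x\<in>cand ?th n d P (P i0) n. x \<le> Max ((\<lambda>i. sqd d (P i) (P i0)) ` I)"
      using I finite_subset[OF I] by (intro cand_ball[OF I _ \<open>I \<noteq> {}\<close>]) auto
    moreover have "cand ?th n d P (P i0) n \<subseteq> X"
      using explored_point[of ?th n d P k X i0 i0] ex adm \<open>i0 < n\<close> by blast
    ultimately show ?thesis by auto
  qed
  then have best: "?r \<ge> 0" "?th \<le> real (cnt n d P ?c ?r)" "\<And>x. x \<in> X \<Longrightarrow> ?r \<le> x"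
    using inv unfolding best_inv_def by blast+
  have rad: "out_radius s = sqrt ?r" by (simp add: out_radius_def out)
  then show nonneg: "out_radius s \<ge> 0" using best(1) by simp
  have mem: "ys ! i \<in> Bhat" if "i < n" "sqd d (P i) ?c \<le> ?r" for i
  proof -
    have "ys ! i \<in> Rd d" using ys(2) that(1) n by (auto dest: nth_mem)
    moreover have "L2_set (\<lambda>j. (ys ! i) j - out_centre d s j) {..<d} = nrm d (\<lambda>j. P i j - ?c j)"
      unfolding nrm_L2_set[symmetric] using P that(1) out(2) by (intro nrm_cong) (auto simp: out_centre_def)
    moreover have "nrm d (\<lambda>j. P i j - ?c j) \<le> sqrt ?r"
      using that(2) real_le_rsqrt unfolding sqd_nrm by blast
    ultimately show ?thesis by (simp add: Bhat_def eucl_ball_def rad)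
  qed
  have "cnt n d P ?c ?r \<le> card (set ys \<inter> Bhat)"
    unfolding cnt_def
  proof (rule card_inj_on_le)
    show "inj_on ((!) ys) {i. i < n \<and> sqd d (P i) ?c \<le> ?r}" by (rule inj_on_subset[OF inj]) auto
    show "(!) ys ` {i. i < n \<and> sqd d (P i) ?c \<le> ?r} \<subseteq> set ys \<inter> Bhat" using mem n by auto
  qed simp
  then show "real (card (set ys \<inter> Bhat)) \<ge> ?th" using best(2) by linarith
  assume d3: "d \<ge> 3" and pos: "\<gamma> * \<delta> > 0"
  have k: "k \<ge> 1" "1 / real k \<le> 40 * (ln (ln (real d)) / ln (real d))"
    using admissible_lower_bound[OF d3 adm] max by auto
  obtain x where x: "x \<in> X" "sqrt x \<le> R * (1 + 6 / (real k * (\<gamma> * \<delta>)))"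
    using radius_bound[OF k(1) adm \<gamma> \<delta> pos I, of R P c ?th X] ball(1) near cI Ystar(3) X0 ex by auto
  have "out_radius s \<le> sqrt x" using best(3)[OF x(1)] by (simp add: rad)
  also note x(2)
  also have "R * (1 + 6 / (real k * (\<gamma> * \<delta>))) \<le> R * (1 + 240 * (ln (ln (real d)) / (\<gamma> * \<delta> * ln (real d))))"
  proof (intro mult_left_mono add_left_mono)
    have "6 / (real k * (\<gamma> * \<delta>)) = 6 / (\<gamma> * \<delta>) * (1 / real k)" by simp
    also have "\<dots> \<le> 6 / (\<gamma> * \<delta>) * (40 * (ln (ln (real d)) / ln (real d)))"
      using k(2) pos by (intro mult_left_mono) auto
    finally show "6 / (real k * (\<gamma> * \<delta>)) \<le> 240 * (ln (ln (real d)) / (\<gamma> * \<delta> * ln (real d)))" by simp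
  qed (rule ball(1))
  finally have "unit_ball_vol (real d) powr (1 / real d) * out_radius s
      \<le> unit_ball_vol (real d) powr (1 / real d) * (R * (1 + 240 * (ln (ln (real d)) / (\<gamma> * \<delta> * ln (real d)))))"
    by (rule mult_left_mono) simp
  then show "vol d Bhat powr (1 / real d) \<le> vol d (eucl_ball d c R) powr (1 / real d) *
       (1 + 240 * (ln (ln (real d)) / (\<gamma> * \<delta> * ln (real d))))"
    using d nonneg ball(1) by (simp add: Bhat_def vol_eucl_ball_root mult.assoc)
qed

theorem theorem3p1:
  shows "\<exists>(prog :: com) (K :: nat) (e :: nat) (C :: real).
    \<forall>(d :: nat) (n :: nat) (m :: nat) (\<delta> :: real) (\<gamma> :: real)
      (Y :: (nat \<Rightarrow> real) set) (ys :: (nat \<Rightarrow> real) list).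
      d \<ge> 1 \<longrightarrow> finite Y \<longrightarrow> Y \<subseteq> Rd d \<longrightarrow> card Y = n \<longrightarrow> distinct ys \<longrightarrow> set ys = Y \<longrightarrow> m \<le> n \<longrightarrow>
      0 \<le> \<delta> \<longrightarrow> \<delta> \<le> 1 \<longrightarrow> 0 \<le> \<gamma> \<longrightarrow> \<gamma> \<le> 1 \<longrightarrow>
      (\<exists>t s. exec prog (input d ys \<delta> \<gamma> m) t s \<and> t \<le> K * (n + d) ^ e \<and>
        (\<forall>(Ystar :: (nat \<Rightarrow> real) set) (cstar :: nat \<Rightarrow> real) (Rstar :: real).
          Ystar \<subseteq> Y \<longrightarrow> card Ystar = m \<longrightarrow> real (card Ystar) \<ge> \<delta> * real (card Y) \<longrightarrow>
          cstar \<in> Rd d \<longrightarrow> Rstar \<ge> 0 \<longrightarrow> Ystar \<subseteq> eucl_ball d cstar Rstar \<longrightarrow>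
          (let chat = out_centre d s; Rhat = out_radius s; Bhat = eucl_ball d chat Rhat in
            Rhat \<ge> 0 \<and>
            real (card (Y \<inter> Bhat)) \<ge> (1 - \<gamma>) * real (card Ystar) \<and>
            (d \<ge> 3 \<longrightarrow> \<gamma> * \<delta> > 0 \<longrightarrow>
              vol d Bhat powr (1 / real d) \<le>
              vol d (eucl_ball d cstar Rstar) powr (1 / real d) *
                (1 + C * (ln (ln (real d)) / (\<gamma> * \<delta> * ln (real d))))))))"
proof (rule exI[of _ ball_prog], rule exI[of _ "3 ^ ball_exp"], rule exI[of _ ball_exp], rule exI[of _ 240],
    intro allI impI, goal_cases)
  case (1 d n m \<delta> \<gamma> Y ys)
  then have len: "length ys = n" using 1(4-6) distinct_card[of ys] by simp
  obtain t s k P X f where run: "exec ball_prog (input d ys \<delta> \<gamma> m) t s" "t \<le> (n + d + 2) ^ ball_exp"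
    and out: "\<forall>i<n. \<forall>j<d. P i j = (ys ! i) j" "admissible d k" "\<forall>k'. k < k' \<longrightarrow> k' \<le> d \<longrightarrow> \<not> admissible d k'"
      "(1 - \<gamma>) * real m \<le> 0 \<longrightarrow> 0 \<in> X" "best_inv ((1 - \<gamma>) * real m) n d P X f"
      "\<forall>i0<n. \<forall>i1<n. explored ((1 - \<gamma>) * real m) n d P (k\<^sup>2) k X i0 i1"
      "cell s 0 = sqrt (f (16, 0, 0))" "\<forall>j<d. cell s (1 + j) = f (8, 0, j)"
    using exec_ball_prog[OF 1(1) len 1(7) refl, of \<delta> \<gamma>] by blast
  \<comment> \<open>The size \<open>S = n + d + 2\<close> becomes a multiple of \<open>n + d\<close>
    because \<open>d \<ge> 1\<close>; this accounts for the factor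
    \<open>3 ^ ball_exp\<close>.\<close>
  have "n + d + 2 \<le> 3 * (n + d)" using 1(1) by simp
  then have "(n + d + 2) ^ ball_exp \<le> (3 * (n + d)) ^ ball_exp" by (intro power_mono) auto
  also have "\<dots> = 3 ^ ball_exp * (n + d) ^ ball_exp" by (rule power_mult_distrib)
  finally have time: "t \<le> 3 ^ ball_exp * (n + d) ^ ball_exp" using run(2) by linarith
  have sub: "set ys \<subseteq> Rd d" using 1(3,6) by simp
  show ?case
  proof (rule exI[of _ t], rule exI[of _ s], rule conjI[OF run(1)], rule conjI[OF time], intro allI impI, goal_cases)
    case (1 Ystar cstar Rstar)
    have "Ystar \<subseteq> set ys" "\<delta> * real n \<le> real m" using 1 \<open>set ys = Y\<close> \<open>card Y = n\<close> by auto
    note q = ball_quality[OF \<open>d \<ge> 1\<close> \<open>distinct ys\<close> sub len \<open>\<delta> \<le> 1\<close> \<open>0 \<le> \<gamma>\<close> \<open>\<gamma> \<le> 1\<close> out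
      this(1) 1(2) this(2) 1(5,6)]
    show ?case using q 1(2) \<open>set ys = Y\<close> by (simp add: Let_def)
  qed
qed

end
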